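(* The problem \textsc{Cutting at Most $k$ Vertices with Terminal} — given a graph $G=(V,E)$, a vertex $s\in V$ and integers $k\ge1$, $t\ge0$, decide whether there is a non-empty $X\subseteq V$ with $s\in X$, $|X|\le k$ and $|N(X)|\le t$ — is W[1]-hard when parameterized by $t$.
   Context: All graphs are finite, simple and undirected. For $U\subseteq V$, $N(U)=\bigcup_{v\in U}N(v)\setminus U$. W[1]-hardness is with respect to parameterized (FPT) many-one reductions. *)

theory Defs
  imports Main
begin

section \<open>Machine model\<close>

text \<open>
  The model is the WHILE language over binary trees of N. D. Jones, \<^emph>\<open>Computability and Complexity
  from a Programming Perspective\<close>. Instead of Jones' unit cost, every evaluation of an
  expression is charged the sizes of the values of all its subexpressions. In particular a value
  has to be paid for in full when it is written, so sharing of subtrees gives no advantage. With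
  this cost the model and multi-tape Turing machines simulate each other with polynomial overhead
  (a program has finitely many variables; keep each on its own tape in prefix notation).
  Trees play the role of words: in prefix notation a tree is a word over two letters, and
  \<open>tsize\<close> is its length.
\<close>

datatype tree = Leaf | Node tree tree

primrec tsize :: "tree \<Rightarrow> nat" where
  "tsize Leaf = 1"
| "tsize (Node a b) = 1 + tsize a + tsize b"

primrec left :: "tree \<Rightarrow> tree" where
  "left Leaf = Leaf"
| "left (Node a b) = a"

primrec right :: "tree \<Rightarrow> tree" where
  "right Leaf = Leaf"
| "right (Node a b) = b"

datatype expr = Var nat | Lf | Nd expr expr | Lft expr | Rgt expr

type_synonym store = "nat \<Rightarrow> tree"

primrec eval :: "expr \<Rightarrow> store \<Rightarrow> tree" where
  "eval (Var x) s = s x"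
| "eval Lf s = Leaf"
| "eval (Nd e1 e2) s = Node (eval e1 s) (eval e2 s)"
| "eval (Lft e) s = left (eval e s)"
| "eval (Rgt e) s = right (eval e s)"

primrec ecost :: "expr \<Rightarrow> store \<Rightarrow> nat" where
  "ecost (Var x) s = tsize (s x)"
| "ecost Lf s = 1"
| "ecost (Nd e1 e2) s = ecost e1 s + ecost e2 s + tsize (eval (Nd e1 e2) s)"
| "ecost (Lft e) s = ecost e s + tsize (eval (Lft e) s)"
| "ecost (Rgt e) s = ecost e s + tsize (eval (Rgt e) s)"

datatype com = Skip | Assign nat expr | Seq com com | Cond expr com com | While expr com

text \<open>
  \<open>exec c s n s'\<close>: started in store \<open>s\<close>, program \<open>c\<close> halts in store \<open>s'\<close> after time \<open>n\<close>.
  A test succeeds iff its value is not \<open>Leaf\<close>.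
\<close>

inductive exec :: "com \<Rightarrow> store \<Rightarrow> nat \<Rightarrow> store \<Rightarrow> bool" where
  Skip: "exec Skip s 1 s"
| Assign: "exec (Assign x e) s (ecost e s) (s(x := eval e s))"
| Seq: "exec c1 s m s' \<Longrightarrow> exec c2 s' n s'' \<Longrightarrow> exec (Seq c1 c2) s (m + n) s''"
| CondT: "eval e s \<noteq> Leaf \<Longrightarrow> exec c1 s n s' \<Longrightarrow> exec (Cond e c1 c2) s (ecost e s + n) s'"
| CondF: "eval e s = Leaf \<Longrightarrow> exec c2 s n s' \<Longrightarrow> exec (Cond e c1 c2) s (ecost e s + n) s'"
| WhileF: "eval e s = Leaf \<Longrightarrow> exec (While e c) s (ecost e s) s"
| WhileT: "eval e s \<noteq> Leaf \<Longrightarrow> exec c s m s' \<Longrightarrow> exec (While e c) s' n s'' \<Longrightarrow>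
    exec (While e c) s (ecost e s + m + n) s''"

text \<open>Input and output are in variable 0; all other variables initially hold \<open>Leaf\<close>.\<close>

definition runs :: "com \<Rightarrow> tree \<Rightarrow> nat \<Rightarrow> tree \<Rightarrow> bool" where
  "runs p v n w \<longleftrightarrow> (\<exists>s. exec p ((\<lambda>_. Leaf)(0 := v)) n s \<and> s 0 = w)"

section \<open>Encodings\<close>

primrec enc_nat :: "nat \<Rightarrow> tree" where
  "enc_nat 0 = Leaf"
| "enc_nat (Suc n) = Node Leaf (enc_nat n)"

text \<open>Binary numerals, least significant bit first.\<close>

fun enc_bin :: "nat \<Rightarrow> tree" where
  "enc_bin n = (if n = 0 then Leaf
     else Node (if odd n then Node Leaf Leaf else Leaf) (enc_bin (n div 2)))"

declare enc_bin.simps [simp del]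

primrec enc_list :: "tree list \<Rightarrow> tree" where
  "enc_list [] = Leaf"
| "enc_list (v # vs) = Node v (enc_list vs)"

section \<open>Parameterized problems and FPT reductions\<close>

definition computable :: "(nat \<Rightarrow> nat) \<Rightarrow> bool" where
  "computable f \<longleftrightarrow> (\<exists>p. \<forall>n. \<exists>m. runs p (enc_nat n) m (enc_nat (f n)))"

text \<open>
  A parameterized problem is a set of pairs of an instance and its parameter. Representing the
  parameter in unary in the input and output of a reduction is immaterial, since running times
  are measured up to a computable function of the parameter.
\<close>

type_synonym problem = "(tree \<times> nat) set"

definition fpt_reducible :: "problem \<Rightarrow> problem \<Rightarrow> bool" (infix "\<le>fpt" 50) where
  "L \<le>fpt L' \<longleftrightarrow>
    (\<exists>(R :: tree \<Rightarrow> nat \<Rightarrow> tree) (K :: tree \<Rightarrow> nat \<Rightarrow> nat) p f g c.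
      computable f \<and> computable g \<and>
      (\<forall>x k. ((x, k) \<in> L \<longleftrightarrow> (R x k, K x k) \<in> L') \<and>
             K x k \<le> g k \<and>
             (\<exists>n \<le> f k * tsize x ^ c.
                runs p (Node x (enc_nat k)) n (Node (R x k) (enc_nat (K x k))))))"

section \<open>Boolean circuits and the W-hierarchy\<close>

text \<open>
  A circuit is the list of its nodes in topological order; a node refers to its in-neighbours by
  their positions in the list, and the last node is the output. Gates are negations and
  conjunctions and disjunctions of fan-in at least two; a gate is large if its fan-in exceeds two.
\<close>

datatype gate = Inp | Neg nat | Conj "nat list" | Disj "nat list"

type_synonym circuit = "gate list"

primrec preds :: "gate \<Rightarrow> nat list" where
  "preds Inp = []"
| "preds (Neg j) = [j]"
| "preds (Conj js) = js"
| "preds (Disj js) = js"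

definition wf_circuit :: "circuit \<Rightarrow> bool" where
  "wf_circuit C \<longleftrightarrow> C \<noteq> [] \<and>
    (\<forall>i < length C. distinct (preds (C ! i)) \<and> (\<forall>j \<in> set (preds (C ! i)). j < i) \<and>
      (\<forall>js. C ! i = Conj js \<or> C ! i = Disj js \<longrightarrow> 2 \<le> length js))"

text \<open>
  An assignment is the set \<open>A\<close> of (positions of) input nodes that are set to true.
  \<open>node_vals A C\<close> lists the values of all nodes; \<open>gate_val A vs g\<close> is the value of a node \<open>g\<close>
  preceded by nodes with values \<open>vs\<close>, hence itself at position \<open>length vs\<close>.
\<close>

primrec gate_val :: "nat set \<Rightarrow> bool list \<Rightarrow> gate \<Rightarrow> bool" where
  "gate_val A vs Inp \<longleftrightarrow> length vs \<in> A"
| "gate_val A vs (Neg j) \<longleftrightarrow> \<not> vs ! j"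
| "gate_val A vs (Conj js) \<longleftrightarrow> (\<forall>j \<in> set js. vs ! j)"
| "gate_val A vs (Disj js) \<longleftrightarrow> (\<exists>j \<in> set js. vs ! j)"

definition node_vals :: "nat set \<Rightarrow> circuit \<Rightarrow> bool list" where
  "node_vals A C = foldl (\<lambda>vs g. vs @ [gate_val A vs g]) [] C"

definition inputs :: "circuit \<Rightarrow> nat set" where
  "inputs C = {i. i < length C \<and> C ! i = Inp}"

definition satisfiable_with_weight :: "circuit \<Rightarrow> nat \<Rightarrow> bool" where
  "satisfiable_with_weight C k \<longleftrightarrow> (\<exists>A \<subseteq> inputs C. card A = k \<and> last (node_vals A C))"

definition io_path :: "circuit \<Rightarrow> nat list \<Rightarrow> bool" where
  "io_path C p \<longleftrightarrow> p \<noteq> [] \<and> set p \<subseteq> {..<length C} \<and>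
    C ! hd p = Inp \<and> last p = length C - 1 \<and>
    successively (\<lambda>i j. i \<in> set (preds (C ! j))) p"

definition weft_at_most :: "circuit \<Rightarrow> nat \<Rightarrow> bool" where
  "weft_at_most C t \<longleftrightarrow>
    (\<forall>p. io_path C p \<longrightarrow> length (filter (\<lambda>i. 2 < length (preds (C ! i))) p) \<le> t)"

text \<open>Depth is the maximum number of gates on an input-output path, input nodes not counted.\<close>

definition depth_at_most :: "circuit \<Rightarrow> nat \<Rightarrow> bool" where
  "depth_at_most C d \<longleftrightarrow>
    (\<forall>p. io_path C p \<longrightarrow> length (filter (\<lambda>i. C ! i \<noteq> Inp) p) \<le> d)"

primrec enc_gate :: "gate \<Rightarrow> tree" where
  "enc_gate Inp = Node (enc_nat 0) Leaf"
| "enc_gate (Neg j) = Node (enc_nat 1) (enc_nat j)"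
| "enc_gate (Conj js) = Node (enc_nat 2) (enc_list (map enc_nat js))"
| "enc_gate (Disj js) = Node (enc_nat 3) (enc_list (map enc_nat js))"

definition enc_circuit :: "circuit \<Rightarrow> tree" where
  "enc_circuit C = enc_list (map enc_gate C)"

definition weighted_circuit_sat :: "nat \<Rightarrow> nat \<Rightarrow> problem" where
  "weighted_circuit_sat t d =
    {(enc_circuit C, k) | C k. wf_circuit C \<and> weft_at_most C t \<and> depth_at_most C d \<and>
       satisfiable_with_weight C k}"

definition W :: "nat \<Rightarrow> problem set" where
  "W t = {L. \<exists>d. L \<le>fpt weighted_circuit_sat t d}"

definition W_hard :: "nat \<Rightarrow> problem \<Rightarrow> bool" where
  "W_hard t L \<longleftrightarrow> (\<forall>L' \<in> W t. L' \<le>fpt L)"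

section \<open>Cutting at most k vertices with terminal\<close>

definition simple_graph :: "'a set \<Rightarrow> 'a set set \<Rightarrow> bool" where
  "simple_graph V E \<longleftrightarrow> finite V \<and> (\<forall>e \<in> E. e \<subseteq> V \<and> card e = 2)"

definition nbhd :: "'a set set \<Rightarrow> 'a \<Rightarrow> 'a set" where
  "nbhd E v = {u. {u, v} \<in> E}"

definition set_nbhd :: "'a set set \<Rightarrow> 'a set \<Rightarrow> 'a set" where
  "set_nbhd E U = (\<Union>v \<in> U. nbhd E v) - U"

definition has_terminal_cut :: "'a set \<Rightarrow> 'a set set \<Rightarrow> 'a \<Rightarrow> nat \<Rightarrow> nat \<Rightarrow> bool" where
  "has_terminal_cut V E s k t \<longleftrightarrow>
    (\<exists>X \<subseteq> V. X \<noteq> {} \<and> s \<in> X \<and> card X \<le> k \<and> card (set_nbhd E X) \<le> t)"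

text \<open>
  Vertices are named by arbitrary trees. A graph is presented by a list of its vertices and
  a list of its edges.
\<close>

definition edge_set :: "(tree \<times> tree) list \<Rightarrow> tree set set" where
  "edge_set es = (\<lambda>(u, v). {u, v}) ` set es"

definition enc_graph :: "tree list \<Rightarrow> (tree \<times> tree) list \<Rightarrow> tree" where
  "enc_graph vs es = Node (enc_list vs) (enc_list (map (\<lambda>(u, v). Node u v) es))"

text \<open>The instance consists of \<open>G\<close>, \<open>s\<close> and \<open>k\<close>; the second component \<open>t\<close> is the parameter.\<close>

definition cutting_at_most_k_with_terminal :: problem where
  "cutting_at_most_k_with_terminal =
    {(Node (enc_graph vs es) (Node s (enc_bin k)), t) | vs es s k t.
       simple_graph (set vs) (edge_set es) \<and> s \<in> set vs \<and> 1 \<le> k \<and>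
       has_terminal_cut (set vs) (edge_set es) s k t}"

end

theory Submission imports Defs begin

text \<open>
  A circuit of depth \<open>d\<close> and weft one is turned into a polynomial with integer coefficients in zero-one
  variables. Below its large gates every node is a polynomial of constant degree in the inputs. A large
  gate \<open>g\<close> contributes one variable for "all children of \<open>g\<close> have the value that does not decide it" and
  one variable per child for "this child decides \<open>g\<close>"; only boundedly many large gates, say \<open>L\<close>, matter
  for the output. Rewarding correct choices one obtains a polynomial whose value at a set of \<open>k + L\<close>
  variables is at most \<open>L + 1\<close>, with equality iff the chosen inputs satisfy the circuit.

  A positive monomial becomes a vertex adjacent to its variables. A monomial \<open>m\<close> of degree \<open>n\<close> with
  coefficient \<open>- 1\<close> becomes one vertex for each \<open>n\<close>-tuple of variables other than \<open>m\<close>: exactly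
  \<open>t ^ n - [m \<subseteq> S]\<close> of them have all their neighbours in a given set \<open>S\<close> of \<open>t\<close> variables. With a
  terminal adjacent to all variables, maximizing the polynomial over sets of \<open>t\<close> variables is the same as
  cutting off as many vertices as possible by removing \<open>t\<close> vertices, that is, as keeping the
  terminal's side small.

  That the reduction runs in polynomial time follows from closure properties of the
  functions on trees that WHILE programs compute in polynomial time.
\<close>

section \<open>Running programs on clean stores\<close>

text \<open>The score has to be bounded for wrong choices too, and this is where weft one enters: no
  large gate lies below another one, so whether a child decides its gate is a polynomial in the
  inputs alone, correct however the variables of the gates are chosen. Hence every gate checks its
  own choice, independently of the others. Fixing the number of chosen variables to exactly
  \<open>t = k + L\<close> serves twice. It leaves weight \<open>k\<close> for the inputs once every
  gate has exactly one chosen variable, and it makes \<open>t ^ n\<close> a constant, so that minus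
  signs can be simulated although a cut only counts vertices. The degree is at most
  \<open>2 ^ Suc d + 1\<close> with \<open>d\<close> fixed, so there are polynomially many tuples,
  and \<open>L\<close> is at most \<open>2 ^ Suc d\<close>, so the parameter stays bounded. The
  reduction to circuit satisfiability that is given for a problem in W[1] is arbitrary: its program
  may leave anything in its variables, and its output may be any tree.\<close>

primrec evars :: "expr \<Rightarrow> nat set" where
  "evars (Var x) = {x}"
| "evars Lf = {}"
| "evars (Nd e1 e2) = evars e1 \<union> evars e2"
| "evars (Lft e) = evars e"
| "evars (Rgt e) = evars e"

primrec cvars :: "com \<Rightarrow> nat set" where
  "cvars Skip = {}"
| "cvars (Assign x e) = insert x (evars e)"
| "cvars (Seq c1 c2) = cvars c1 \<union> cvars c2"
| "cvars (Cond e c1 c2) = evars e \<union> cvars c1 \<union> cvars c2"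
| "cvars (While e c) = evars e \<union> cvars c"

lemma finite_evars [simp]: "finite (evars e)"
  by (induction e) auto

lemma finite_cvars [simp]: "finite (cvars c)"
  by (induction c) auto

lemma tsize_pos [simp]: "0 < tsize v" "Suc 0 \<le> tsize v" "tsize v \<noteq> 0"
  by (cases v; simp)+

lemma eval_upd [simp]: "x \<notin> evars e \<Longrightarrow> eval e (s(x := a)) = eval e s"
  by (induction e) auto

lemma ecost_upd [simp]: "x \<notin> evars e \<Longrightarrow> ecost e (s(x := a)) = ecost e s"
  by (induction e) auto

text \<open>A program neither reads nor writes a variable that does not occur in it, so such a
  variable can store a value across a run at no cost.\<close>

lemma exec_frame: "exec c s n s' \<Longrightarrow> x \<notin> cvars c \<Longrightarrow> exec c (s(x := a)) n (s'(x := a))"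
proof (induction rule: exec.induct)
  case (Assign y e s)
  then show ?case
    using exec.Assign[of y e "s(x := a)"] by (simp add: fun_upd_twist del: fun_upd_apply)
next
  case (CondT e s c1 n s' c2)
  then show ?case
    using exec.CondT[of e "s(x := a)" c1 n "s'(x := a)" c2] by (simp del: fun_upd_apply)
next
  case (CondF e s c2 n s' c1)
  then show ?case
    using exec.CondF[of e "s(x := a)" c2 n "s'(x := a)" c1] by (simp del: fun_upd_apply)
next
  case (WhileF e s c)
  then show ?case
    using exec.WhileF[of e "s(x := a)" c] by (simp del: fun_upd_apply)
next
  case (WhileT e s c m s' n s'')
  then show ?case
    using exec.WhileT[of e "s(x := a)" c m "s'(x := a)" n "s''(x := a)"]
    by (simp del: fun_upd_apply)
qed (auto intro: exec.Skip[simplified] exec.Seq simp del: fun_upd_apply)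

lemma tsize_eval_le: "tsize (eval e s) \<le> ecost e s"
  by (induction e) auto

text \<open>Every written value is charged its full size. This is what bounds outputs polynomially
  in terms of running times.\<close>

lemma exec_size: "exec c s n s' \<Longrightarrow> tsize (s' x) \<le> tsize (s x) + n"
proof (induction rule: exec.induct)
  case (Assign y e s)
  then show ?case using tsize_eval_le[of e s] by auto
qed auto

lemma exec_untouched: "exec c s n s' \<Longrightarrow> x \<notin> cvars c \<Longrightarrow> s' x = s x"
  by (induction rule: exec.induct) auto

lemma exec_AssignI: "s' = s(x := eval e s) \<Longrightarrow> n = ecost e s \<Longrightarrow> exec (Assign x e) s n s'"
  by (simp add: exec.Assign)

text \<open>The initial store of \<open>runs\<close>. Programs that also end in a store of this form
  can be composed by \<open>Seq\<close>.\<close>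

definition st :: "tree \<Rightarrow> store" where
  "st v = (\<lambda>_. Leaf)(0 := v)"

lemma st_simps [simp]: "st v 0 = v" "x \<noteq> 0 \<Longrightarrow> st v x = Leaf" "(st v)(0 := w) = st w"
  by (auto simp: st_def)

lemma st_upd_Leaf [simp]: "x \<noteq> 0 \<Longrightarrow> (st v)(x := Leaf) = st v"
  by (auto simp: st_def)

definition clear :: "nat \<Rightarrow> com \<Rightarrow> com" where
  "clear m p = foldr (\<lambda>x c. Seq c (Assign (Suc x) Lf)) [0..<m] p"

lemma exec_clear:
  assumes "exec p s n s'"
  shows "exec (clear m p) s (n + m) (\<lambda>x. if 1 \<le> x \<and> x \<le> m then Leaf else s' x)"
proof -
  have "exec (foldr (\<lambda>x c. Seq c (Assign (Suc x) Lf)) xs p) s (n + length xs)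
      (\<lambda>y. if y \<in> Suc ` set xs then Leaf else s' y)" for xs
  proof (induction xs)
    case (Cons x xs)
    show ?case
      by (simp, rule exec.Seq[where m = "n + length xs" and n = 1, simplified])
        (rule Cons.IH, rule exec_AssignI, auto)
  qed (use assms in simp)
  from this[of "[0..<m]"] have "exec (clear m p) s (n + m)
      (\<lambda>y. if y \<in> Suc ` set [0..<m] then Leaf else s' y)"
    by (simp add: clear_def)
  then show ?thesis
    by (rule back_subst[of "exec _ _ _"]) (auto simp: image_Suc_atLeastLessThan fun_eq_iff)
qed

text \<open>Only finitely many variables occur in \<open>p\<close>, and resetting one to
  \<open>Leaf\<close> costs 1, so cleaning up adds a constant \<open>m\<close> independent of input
  and running time.\<close>

lemma clean_program:
  "\<exists>q m. \<forall>v n w. runs p v n w \<longrightarrow> exec q (st v) (n + m) (st w)"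
proof -
  obtain m where m: "\<And>x. x \<in> cvars p \<Longrightarrow> x \<le> m"
    using finite_nat_set_iff_bounded_le[of "cvars p"] by auto
  have "exec (clear m p) (st v) (n + m) (st w)" if "runs p v n w" for v n w
  proof -
    from that obtain s where s: "exec p (st v) n s" "s 0 = w"
      by (auto simp: runs_def st_def)
    have "(\<lambda>x. if 1 \<le> x \<and> x \<le> m then Leaf else s x) = st w"
    proof
      fix x
      show "(if 1 \<le> x \<and> x \<le> m then Leaf else s x) = st w x"
        using exec_untouched[OF s(1), of x] m[of x] s(2) by (cases "x = 0") auto
    qed
    with exec_clear[OF s(1), of m] show ?thesis by simp
  qed
  then show ?thesis by blast
qed

section \<open>Polynomial bounds\<close>

text \<open>One constant serves as coefficient and as exponent. This loses no generality because
  \<open>tsize\<close> is positive, which makes its powers increase with the exponent.\<close>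

definition pbd :: "(tree \<Rightarrow> nat) \<Rightarrow> bool" where
  "pbd b \<longleftrightarrow> (\<exists>c. \<forall>v. b v \<le> c * tsize v ^ c)"

lemma pbdI: "(\<And>v. b v \<le> c * tsize v ^ e) \<Longrightarrow> pbd b"
proof -
  assume b: "\<And>v. b v \<le> c * tsize v ^ e"
  have "b v \<le> (c + e) * tsize v ^ (c + e)" for v
    by (rule order_trans[OF b]) (intro mult_mono power_increasing; simp)
  then show ?thesis unfolding pbd_def by blast
qed

lemma pbd_mono: "pbd b \<Longrightarrow> (\<And>v. b' v \<le> b v) \<Longrightarrow> pbd b'"
  unfolding pbd_def by (meson order_trans)

lemma pbd_const: "pbd (\<lambda>_. c)"
  by (rule pbdI[of _ c 0]) simp

lemma pbd_tsize: "pbd tsize"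
  by (rule pbdI[of _ 1 1]) simp

lemma pbd_add:
  assumes "pbd a" "pbd b" shows "pbd (\<lambda>v. a v + b v)"
proof -
  obtain c d where c: "\<And>v. a v \<le> c * tsize v ^ c" and d: "\<And>v. b v \<le> d * tsize v ^ d"
    using assms by (auto simp: pbd_def)
  have "a v + b v \<le> (c + d) * tsize v ^ (c + d)" for v
  proof -
    have "a v \<le> c * tsize v ^ (c + d)" "b v \<le> d * tsize v ^ (c + d)"
      by (rule order_trans[OF c], intro mult_mono power_increasing; simp)
        (rule order_trans[OF d], intro mult_mono power_increasing; simp)
    then show ?thesis by (simp add: distrib_right)
  qed
  then show ?thesis by (rule pbdI)
qed

lemma pbd_mult:
  assumes "pbd a" "pbd b" shows "pbd (\<lambda>v. a v * b v)"
proof -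
  obtain c d where c: "\<And>v. a v \<le> c * tsize v ^ c" and d: "\<And>v. b v \<le> d * tsize v ^ d"
    using assms by (auto simp: pbd_def)
  have "a v * b v \<le> (c * d) * tsize v ^ (c + d)" for v
    using mult_mono[OF c d, of v v] by (simp add: power_add ac_simps)
  then show ?thesis by (rule pbdI)
qed

lemma pbd_power: "pbd b \<Longrightarrow> pbd (\<lambda>v. b v ^ n)"
  by (induction n) (auto intro: pbd_const pbd_mult)

lemma pbd_comp:
  assumes "pbd b" "pbd (\<lambda>v. tsize (g v))" shows "pbd (\<lambda>v. b (g v))"
proof -
  obtain c where c: "\<And>v. b v \<le> c * tsize v ^ c"
    using assms(1) by (auto simp: pbd_def)
  show ?thesis
    by (rule pbd_mono[OF pbd_mult[OF pbd_const pbd_power[OF assms(2)]] c])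
qed

section \<open>Polynomial-time functions on trees\<close>

definition pt :: "(tree \<Rightarrow> tree) \<Rightarrow> bool" where
  "pt f \<longleftrightarrow> (\<exists>p b. pbd b \<and> (\<forall>v. \<exists>n \<le> b v. exec p (st v) n (st (f v))))"

lemma ptI: "pbd b \<Longrightarrow> (\<And>v. \<exists>n \<le> b v. exec p (st v) n (st (f v))) \<Longrightarrow> pt f"
  unfolding pt_def by blast

lemma ptI_exact: "pbd b \<Longrightarrow> (\<And>v. exec p (st v) (b v) (st (f v))) \<Longrightarrow> pt f"
  unfolding pt_def by blast

text \<open>Choosing for each input one time actually taken turns the bound into an exact time
  function; times of consecutive runs then simply add up.\<close>

lemma pt_ex:
  assumes "pt f" shows "\<exists>b p. pbd b \<and> (\<forall>v. exec p (st v) (b v) (st (f v)))"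
proof -
  obtain p B where B: "pbd B" "\<And>v. \<exists>n \<le> B v. exec p (st v) n (st (f v))"
    using assms unfolding pt_def by (elim exE conjE) (rule that, auto)
  define b where "b v = (SOME n. n \<le> B v \<and> exec p (st v) n (st (f v)))" for v
  have b: "b v \<le> B v \<and> exec p (st v) (b v) (st (f v))" for v
    unfolding b_def by (rule someI_ex) (rule B(2))
  have "pbd b" by (rule pbd_mono[OF B(1)]) (use b in blast)
  with b show ?thesis by (intro exI conjI allI) auto
qed

lemma pt_size: "pt f \<Longrightarrow> pbd (\<lambda>v. tsize (f v))"
proof -
  assume f: "pt f"
  obtain b p where "pbd b" "\<forall>v. exec p (st v) (b v) (st (f v))"
    using pt_ex[OF f] by (elim exE conjE) (rule that)
  note b = this(1) this(2)[rule_format]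
  show ?thesis
    by (rule pbd_mono[where b = "\<lambda>v. tsize v + b v", OF pbd_add[OF pbd_tsize b(1)]])
      (use exec_size[OF b(2), where x = 0] in simp)
qed

lemma pt_comp:
  assumes "pt g" "pt f" shows "pt (\<lambda>v. g (f v))"
proof -
  obtain b p where "pbd b" "\<forall>v. exec p (st v) (b v) (st (f v))"
    using pt_ex[OF assms(2)] by (elim exE conjE) (rule that)
  note p = this(1) this(2)[rule_format]
  obtain c q where "pbd c" "\<forall>v. exec q (st v) (c v) (st (g v))"
    using pt_ex[OF assms(1)] by (elim exE conjE) (rule that)
  note q = this(1) this(2)[rule_format]
  show ?thesis
  proof (rule ptI_exact)
    show "pbd (\<lambda>v. b v + c (f v))"
      by (rule pbd_add[OF p(1) pbd_comp[OF q(1) pt_size[OF assms(2)]]])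
    show "exec (Seq p q) (st v) (b v + c (f v)) (st (g (f v)))" for v
      by (rule exec.Seq[OF p(2) q(2)])
  qed
qed

lemma pt_assign:
  assumes "pbd (\<lambda>v. ecost e (st v))" shows "pt (\<lambda>v. eval e (st v))"
proof (rule ptI_exact[OF assms])
  show "exec (Assign 0 e) (st v) (ecost e (st v)) (st (eval e (st v)))" for v
    by (rule exec_AssignI) simp_all
qed

lemma tsize_left_le [simp]: "tsize (left v) \<le> tsize v"
  by (cases v) auto

lemma tsize_right_le [simp]: "tsize (right v) \<le> tsize v"
  by (cases v) auto

lemma pbd_tsize_left: "pbd (\<lambda>v. tsize (left v))"
  by (rule pbd_mono[OF pbd_tsize]) simp

lemma pbd_tsize_right: "pbd (\<lambda>v. tsize (right v))"
  by (rule pbd_mono[OF pbd_tsize]) simp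

lemma pt_id: "pt (\<lambda>v. v)"
  using pt_assign[of "Var 0"] by (simp add: pbd_tsize)

lemma pt_left: "pt f \<Longrightarrow> pt (\<lambda>v. left (f v))"
  by (rule pt_comp[where g = left]) (use pt_assign[of "Lft (Var 0)"] in \<open>simp_all add: pbd_add pbd_tsize pbd_tsize_left\<close>)

lemma pt_right: "pt f \<Longrightarrow> pt (\<lambda>v. right (f v))"
  by (rule pt_comp[where g = right]) (use pt_assign[of "Rgt (Var 0)"] in \<open>simp_all add: pbd_add pbd_tsize pbd_tsize_right\<close>)

lemma pt_Leaf: "pt (\<lambda>v. Leaf)"
  using pt_assign[of Lf] by (simp add: pbd_const)

text \<open>Both functions need the original input, but each run overwrites variable 0. One fresh
  variable \<open>x\<close> suffices: it keeps the input during \<open>p\<close> and the first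
  result during \<open>q\<close>.\<close>

lemma pt_Node:
  assumes "pt f" "pt g" shows "pt (\<lambda>v. Node (f v) (g v))"
proof -
  obtain b p where "pbd b" "\<forall>v. exec p (st v) (b v) (st (f v))"
    using pt_ex[OF assms(1)] by (elim exE conjE) (rule that)
  note p = this(1) this(2)[rule_format]
  obtain c q where "pbd c" "\<forall>v. exec q (st v) (c v) (st (g v))"
    using pt_ex[OF assms(2)] by (elim exE conjE) (rule that)
  note q = this(1) this(2)[rule_format]
  have "finite (insert 0 (cvars p \<union> cvars q))" by simp
  then obtain x where x: "x \<notin> cvars p" "x \<notin> cvars q" "x \<noteq> 0"
    using ex_new_if_finite[OF infinite_UNIV_nat] by (metis UnCI insertCI)
  let ?prog = "Seq (Assign x (Var 0)) (Seq p (Seq (Assign 0 (Nd (Var 0) (Var x)))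
    (Seq (Assign x (Lft (Var 0))) (Seq (Assign 0 (Rgt (Var 0))) (Seq q
    (Seq (Assign 0 (Nd (Var x) (Var 0))) (Assign x Lf)))))))"
  let ?t = "\<lambda>v. tsize v + (b v + ((tsize (f v) + tsize v + (1 + tsize (f v) + tsize v)) +
    (((1 + tsize (f v) + tsize v) + tsize (f v)) + (((1 + tsize (f v) + tsize v) + tsize v) +
    (c v + ((tsize (f v) + tsize (g v) + (1 + tsize (f v) + tsize (g v))) + 1))))))"
  have st0: "(st u)(x := a, 0 := w) = (st w)(x := a)" for u a w
    using x(3) by (auto simp: st_def)
  have "exec ?prog (st v) (?t v) (st (Node (f v) (g v)))" for v
  proof (intro exec.Seq)
    show "exec (Assign x (Var 0)) (st v) (tsize v) ((st v)(x := v))"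
      by (rule exec_AssignI) simp_all
    show "exec p ((st v)(x := v)) (b v) ((st (f v))(x := v))"
      by (rule exec_frame[OF p(2) x(1)])
    \<comment> \<open>Packing both values into one pair and unpacking it in the other order swaps
      the contents of variables 0 and \<open>x\<close> without a second auxiliary variable.\<close>
    show "exec (Assign 0 (Nd (Var 0) (Var x))) ((st (f v))(x := v))
        (tsize (f v) + tsize v + (1 + tsize (f v) + tsize v)) ((st (Node (f v) v))(x := v))"
      by (rule exec_AssignI) (use x(3) in \<open>simp_all add: st0\<close>)
    show "exec (Assign x (Lft (Var 0))) ((st (Node (f v) v))(x := v))
        (1 + tsize (f v) + tsize v + tsize (f v)) ((st (Node (f v) v))(x := f v))"
      by (rule exec_AssignI) (use x(3) in simp_all)
    show "exec (Assign 0 (Rgt (Var 0))) ((st (Node (f v) v))(x := f v))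
        (1 + tsize (f v) + tsize v + tsize v) ((st v)(x := f v))"
      by (rule exec_AssignI) (use x(3) in \<open>simp_all add: st0\<close>)
    show "exec q ((st v)(x := f v)) (c v) ((st (g v))(x := f v))"
      by (rule exec_frame[OF q(2) x(2)])
    show "exec (Assign 0 (Nd (Var x) (Var 0))) ((st (g v))(x := f v))
        (tsize (f v) + tsize (g v) + (1 + tsize (f v) + tsize (g v)))
        ((st (Node (f v) (g v)))(x := f v))"
      by (rule exec_AssignI) (use x(3) in \<open>simp_all add: st0\<close>)
    show "exec (Assign x Lf) ((st (Node (f v) (g v)))(x := f v)) 1 (st (Node (f v) (g v)))"
      by (rule exec_AssignI) (use x(3) in simp_all)
  qed
  then show ?thesis
  proof (rule ptI_exact[rotated])
    show "pbd ?t"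
      by (intro pbd_add pbd_const pbd_tsize p(1) q(1) pt_size[OF assms(1)] pt_size[OF assms(2)])
  qed
qed

lemma pt_const: "pt (\<lambda>v. c)"
  by (induction c) (rule pt_Leaf, rule pt_Node)

definition ptp :: "(tree \<Rightarrow> bool) \<Rightarrow> bool" where
  "ptp P \<longleftrightarrow> pt (\<lambda>v. if P v then Node Leaf Leaf else Leaf)"

lemma pt_case_left:
  assumes "pt f" "pt g"
  shows "pt (\<lambda>v. if left v \<noteq> Leaf then f (right v) else g (right v))"
proof -
  obtain b p where "pbd b" "\<forall>v. exec p (st v) (b v) (st (f (right v)))"
    using pt_ex[OF pt_comp[OF assms(1) pt_right[OF pt_id]]] by (elim exE conjE) (rule that)
  note p = this(1) this(2)[rule_format]
  obtain c q where "pbd c" "\<forall>v. exec q (st v) (c v) (st (g (right v)))"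
    using pt_ex[OF pt_comp[OF assms(2) pt_right[OF pt_id]]] by (elim exE conjE) (rule that)
  note q = this(1) this(2)[rule_format]
  let ?t = "\<lambda>v. tsize v + tsize (left v)"
  show ?thesis
  proof (rule ptI[where b = "\<lambda>v. ?t v + (b v + c v)" and p = "Cond (Lft (Var 0)) p q"])
    show "pbd (\<lambda>v. ?t v + (b v + c v))" by (intro pbd_add pbd_tsize pbd_tsize_left p(1) q(1))
    show "\<exists>n \<le> ?t v + (b v + c v). exec (Cond (Lft (Var 0)) p q) (st v) n
        (st (if left v \<noteq> Leaf then f (right v) else g (right v)))" for v
    proof (cases "left v = Leaf")
      case True
      then have "exec (Cond (Lft (Var 0)) p q) (st v) (?t v + c v) (st (g (right v)))"
        using exec.CondF[of "Lft (Var 0)" "st v" q "c v" _ p] q(2) by simp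
      with True show ?thesis by (intro exI[of _ "?t v + c v"]) simp
    next
      case False
      then have "exec (Cond (Lft (Var 0)) p q) (st v) (?t v + b v) (st (f (right v)))"
        using exec.CondT[of "Lft (Var 0)" "st v" p "b v" _ q] p(2) by simp
      with False show ?thesis by (intro exI[of _ "?t v + b v"]) simp
    qed
  qed
qed

lemma pt_cong: "pt f \<Longrightarrow> (\<And>v. f v = g v) \<Longrightarrow> pt g"
  by (drule ext) simp

text \<open>The truth value is computed first and paired with the input; the branch then tests the
  left component and continues with the right one.\<close>

lemma pt_If:
  assumes "ptp P" "pt f" "pt g" shows "pt (\<lambda>v. if P v then f v else g v)"
proof -
  have "pt (\<lambda>v. Node (if P v then Node Leaf Leaf else Leaf) v)"
    by (rule pt_Node[OF assms(1)[unfolded ptp_def] pt_id])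
  from pt_comp[OF pt_case_left[OF assms(2,3)] this] show ?thesis
    by (rule pt_cong) simp
qed

lemma ptpI: "pt f \<Longrightarrow> (\<And>v. f v = (if P v then Node Leaf Leaf else Leaf)) \<Longrightarrow> ptp P"
  unfolding ptp_def by (rule pt_cong)

lemma ptp_eq_Leaf:
  assumes "pt f" shows "ptp (\<lambda>v. f v = Leaf)"
proof (rule ptpI)
  show "pt (\<lambda>v. if left (Node (f v) Leaf) \<noteq> Leaf then Leaf else Node Leaf Leaf)"
    by (rule pt_comp[OF pt_case_left[OF pt_Leaf pt_const] pt_Node[OF assms pt_Leaf]])
qed simp

lemma ptp_not:
  assumes "ptp P" shows "ptp (\<lambda>v. \<not> P v)"
proof (rule ptpI)
  show "pt (\<lambda>v. if P v then Leaf else Node Leaf Leaf)"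
    by (rule pt_If[OF assms pt_Leaf pt_const])
qed simp

lemma ptp_conj:
  assumes "ptp P" "ptp Q" shows "ptp (\<lambda>v. P v \<and> Q v)"
proof (rule ptpI)
  show "pt (\<lambda>v. if P v then if Q v then Node Leaf Leaf else Leaf else Leaf)"
    by (rule pt_If[OF assms(1) assms(2)[unfolded ptp_def] pt_Leaf])
qed simp

lemma ptp_disj:
  assumes "ptp P" "ptp Q" shows "ptp (\<lambda>v. P v \<or> Q v)"
proof (rule ptpI)
  show "pt (\<lambda>v. if P v then Node Leaf Leaf else if Q v then Node Leaf Leaf else Leaf)"
    by (rule pt_If[OF assms(1) pt_const assms(2)[unfolded ptp_def]])
qed simp

lemma ptp_imp:
  assumes "ptp P" "ptp Q" shows "ptp (\<lambda>v. P v \<longrightarrow> Q v)"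
  unfolding imp_conv_disj by (rule ptp_disj[OF ptp_not[OF assms(1)] assms(2)])

lemma ptp_const: "ptp (\<lambda>v. b)"
  unfolding ptp_def by (rule pt_const)

section \<open>Trees as lists of trees\<close>

text \<open>Read along its right spine, every tree is a list of trees, and \<open>elems\<close> and
  \<open>enc_list\<close> are inverse bijections. List operations are therefore total on trees,
  without format checks. A unary numeral is a list of leaves, and \<open>num\<close> decodes
  it.\<close>

primrec elems :: "tree \<Rightarrow> tree list" where
  "elems Leaf = []"
| "elems (Node a b) = a # elems b"

abbreviation num :: "tree \<Rightarrow> nat" where
  "num t \<equiv> length (elems t)"

lemma elems_enc_list [simp]: "elems (enc_list xs) = xs"
  by (induction xs) auto

lemma enc_list_elems [simp]: "enc_list (elems t) = t"
  by (induction t) auto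

lemma elems_eq_Nil [simp]: "elems t = [] \<longleftrightarrow> t = Leaf"
  by (cases t) auto

lemma elems_eq_iff: "elems s = elems t \<longleftrightarrow> s = t"
  by (metis enc_list_elems)

lemma elems_enc_nat [simp]: "elems (enc_nat n) = replicate n Leaf"
  by (induction n) auto

lemma enc_nat_inject [simp]: "enc_nat m = enc_nat n \<longleftrightarrow> m = n"
  by (metis elems_enc_nat length_replicate)

lemma enc_nat_num: "(\<forall>x \<in> set (elems t). x = Leaf) \<longleftrightarrow> t = enc_nat (num t)"
  by (induction t) auto

lemma elems_funpow_right [simp]: "elems ((right ^^ n) t) = drop n (elems t)"
proof (induction n arbitrary: t)
  case (Suc n)
  then show ?case by (cases t) (simp_all add: funpow_swap1)
qed simp

lemma tsize_funpow_right: "tsize ((right ^^ n) t) \<le> tsize t"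
  by (induction n) (auto intro: order_trans[OF tsize_right_le])

lemma tsize_elem_le: "x \<in> set (elems t) \<Longrightarrow> tsize x \<le> tsize t"
  by (induction t) auto

lemma num_le_tsize: "num t \<le> tsize t"
  by (induction t) auto

lemma tsize_enc_list_le:
  "(\<And>x. x \<in> set xs \<Longrightarrow> tsize x \<le> B) \<Longrightarrow> length xs \<le> n \<Longrightarrow> tsize (enc_list xs) \<le> 1 + n * (1 + B)"
proof -
  assume B: "\<And>x. x \<in> set xs \<Longrightarrow> tsize x \<le> B" and n: "length xs \<le> n"
  have "tsize (enc_list xs) \<le> 1 + length xs * (1 + B)"
    using B
  proof (induction xs)
    case (Cons x xs)
    then have "tsize x \<le> B" "tsize (enc_list xs) \<le> 1 + length xs * (1 + B)" by auto
    then show ?case by simp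
  qed simp
  also have "\<dots> \<le> 1 + n * (1 + B)" using mult_le_mono1[OF n, of "1 + B"] by simp
  finally show ?thesis .
qed

section \<open>Bounded iteration\<close>

text \<open>\<open>M\<close> bounds the cost of test and body in every state that is visited. The
  factor is \<open>Suc i\<close> because the final, failing test is charged as well.\<close>

lemma exec_loop:
  assumes p: "\<And>v. exec p (st v) (b v) (st (F v))"
    and "left ((F ^^ i) v) = Leaf" "\<And>j. j < i \<Longrightarrow> left ((F ^^ j) v) \<noteq> Leaf"
    and "\<And>j. j \<le> i \<Longrightarrow> tsize ((F ^^ j) v) + tsize (left ((F ^^ j) v)) + b ((F ^^ j) v) \<le> M"
  shows "\<exists>n \<le> Suc i * M. exec (While (Lft (Var 0)) p) (st v) n (st ((F ^^ i) v))"
  using assms(2-)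
proof (induction i arbitrary: v)
  case 0
  have "exec (While (Lft (Var 0)) p) (st v) (tsize v + tsize (left v)) (st v)"
    using exec.WhileF[of "Lft (Var 0)" "st v" p] 0(1) by simp
  moreover have "tsize v + tsize (left v) \<le> M" using 0(3)[of 0] by simp
  ultimately show ?case by (intro exI[of _ "tsize v + tsize (left v)"]) simp
next
  case (Suc i)
  have "\<exists>n \<le> Suc i * M. exec (While (Lft (Var 0)) p) (st (F v)) n (st ((F ^^ i) (F v)))"
  proof (rule Suc.IH)
    show "left ((F ^^ i) (F v)) = Leaf" using Suc.prems(1) by (simp add: funpow_swap1)
    show "left ((F ^^ j) (F v)) \<noteq> Leaf" if "j < i" for j
      using Suc.prems(2)[of "Suc j"] that by (simp add: funpow_swap1)
    show "tsize ((F ^^ j) (F v)) + tsize (left ((F ^^ j) (F v))) + b ((F ^^ j) (F v)) \<le> M"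
      if "j \<le> i" for j
      using Suc.prems(3)[of "Suc j"] that by (simp add: funpow_swap1)
  qed
  then obtain n where n: "n \<le> Suc i * M"
    "exec (While (Lft (Var 0)) p) (st (F v)) n (st ((F ^^ i) (F v)))" by blast
  have "exec (While (Lft (Var 0)) p) (st v) (ecost (Lft (Var 0)) (st v) + b v + n)
      (st ((F ^^ i) (F v)))"
    by (rule exec.WhileT[OF _ p n(2)]) (use Suc.prems(2)[of 0] in simp)
  moreover have "ecost (Lft (Var 0)) (st v) + b v \<le> M" using Suc.prems(3)[of 0] by simp
  ultimately show ?case
    using n(1) by (intro exI[of _ "ecost (Lft (Var 0)) (st v) + b v + n"]) (simp add: funpow_swap1)
qed

text \<open>Iterating a polynomial-time function can blow up its argument exponentially, so a
  polynomial bound \<open>S\<close> on all intermediate values has to be supplied. The elements of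
  \<open>h v\<close> serve as loop counter.\<close>

lemma pt_iter:
  assumes "pt f" "pt g" "pt h" "pbd S"
    and bound: "\<And>v i. i \<le> num (h v) \<Longrightarrow> tsize ((f ^^ i) (g v)) \<le> S v"
  shows "pt (\<lambda>v. (f ^^ num (h v)) (g v))"
proof -
  \<comment> \<open>The state of the loop is the remaining counter together with the current
    value.\<close>
  define F where "F w = Node (right (left w)) (f (right w))" for w
  have "pt F"
    unfolding F_def by (intro pt_Node pt_comp[OF assms(1)] pt_right pt_left pt_id)
  then obtain b p where "pbd b" "\<forall>v. exec p (st v) (b v) (st (F v))"
    using pt_ex by blast
  then obtain c where p: "\<And>v. exec p (st v) (b v) (st (F v))" and c: "\<And>v. b v \<le> c * tsize v ^ c"
    unfolding pbd_def by blast
  obtain b0 q where "pbd b0" "\<forall>v. exec q (st v) (b0 v) (st (Node (h v) (g v)))"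
    using pt_ex[OF pt_Node[OF assms(3,2)]] by blast
  note q = this(1) this(2)[rule_format]
  have F: "(F ^^ j) (Node s t) = Node ((right ^^ j) s) ((f ^^ j) t)" for j s t
    by (induction j) (auto simp: F_def)
  have nLeaf: "(right ^^ j) s = Leaf \<longleftrightarrow> num s \<le> j" for j s
    by (metis elems_eq_Nil elems_funpow_right drop_eq_Nil)
  define Z where "Z v = 1 + tsize (h v) + S v" for v
  define M where "M v = Z v + Z v + c * Z v ^ c" for v
  let ?loop = "While (Lft (Var 0)) p"
  show ?thesis
  proof (rule ptI)
    show "pbd (\<lambda>v. b0 v + ((1 + tsize (h v)) * M v + (Z v + tsize ((f ^^ 0) (g v)) + S v)))"
      unfolding M_def Z_def
      by (intro pbd_add pbd_mult pbd_power pbd_const q(1) pt_size assms(3,4)) (simp add: pt_size assms(2))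
    show "\<exists>n \<le> b0 v + ((1 + tsize (h v)) * M v + (Z v + tsize ((f ^^ 0) (g v)) + S v)).
        exec (Seq q (Seq ?loop (Assign 0 (Rgt (Var 0))))) (st v) n (st ((f ^^ num (h v)) (g v)))" for v
    proof -
      let ?w = "Node (h v) (g v)"
      have Z: "tsize ((F ^^ j) ?w) \<le> Z v" if "j \<le> num (h v)" for j
        using bound[OF that] tsize_funpow_right[of j "h v"] by (simp add: F Z_def)
      have "\<exists>n \<le> Suc (num (h v)) * M v. exec ?loop (st ?w) n (st ((F ^^ num (h v)) ?w))"
      proof (rule exec_loop[OF p])
        show "left ((F ^^ num (h v)) ?w) = Leaf" by (simp add: F nLeaf)
        show "left ((F ^^ j) ?w) \<noteq> Leaf" if "j < num (h v)" for j using that by (simp add: F nLeaf)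
        show "tsize ((F ^^ j) ?w) + tsize (left ((F ^^ j) ?w)) + b ((F ^^ j) ?w) \<le> M v"
          if "j \<le> num (h v)" for j
        proof -
          have "b ((F ^^ j) ?w) \<le> c * Z v ^ c"
            by (rule order_trans[OF c]) (intro mult_mono power_mono Z that; simp)
          then show ?thesis
            using Z[OF that] tsize_left_le[of "(F ^^ j) ?w"] unfolding M_def by linarith
        qed
      qed
      then obtain n where n: "n \<le> Suc (num (h v)) * M v"
        "exec ?loop (st ?w) n (st (Node ((right ^^ num (h v)) (h v)) ((f ^^ num (h v)) (g v))))"
        by (auto simp: F)
      let ?r = "(right ^^ num (h v)) (h v)" and ?s = "(f ^^ num (h v)) (g v)"
      have "exec (Assign 0 (Rgt (Var 0))) (st (Node ?r ?s)) (tsize (Node ?r ?s) + tsize ?s) (st ?s)"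
        by (rule exec_AssignI) simp_all
      from exec.Seq[OF q(2) exec.Seq[OF n(2) this]]
      have "exec (Seq q (Seq ?loop (Assign 0 (Rgt (Var 0))))) (st v)
        (b0 v + (n + (tsize (Node ?r ?s) + tsize ?s))) (st ?s)" .
      moreover have "n \<le> (1 + tsize (h v)) * M v"
        by (rule order_trans[OF n(1)]) (use num_le_tsize[of "h v"] in \<open>intro mult_mono; simp\<close>)
      moreover have "tsize (Node ?r ?s) \<le> Z v" using Z[of "num (h v)"] by (simp add: F)
      moreover have "tsize ?s \<le> S v" by (rule bound) simp
      ultimately show ?thesis
        by (intro exI[of _ "b0 v + (n + (tsize (Node ?r ?s) + tsize ?s))"] conjI) linarith
    qed
  qed
qed

text \<open>The step function may depend on the input \<open>v\<close>. Since programs have no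
  closures, it takes the triple of input, accumulator and element as one tree; the loop carries
  \<open>v\<close> along unchanged.\<close>

lemma pt_foldl:
  assumes f: "pt (\<lambda>w. f (left w) (left (right w)) (right (right w)))" and "pt g" "pt l" "pbd S"
    and bound: "\<And>v i. i \<le> num (l v) \<Longrightarrow> tsize (foldl (f v) (g v) (take i (elems (l v)))) \<le> S v"
  shows "pt (\<lambda>v. foldl (f v) (g v) (elems (l v)))"
proof -
  define F where "F w = Node (left w) (Node (right (left (right w)))
    (f (left w) (right (right w)) (left (left (right w)))))" for w
  let ?init = "\<lambda>v. Node v (Node (l v) (g v))"
  have "pt (\<lambda>w. f (left w) (right (right w)) (left (left (right w))))"
    using pt_comp[OF f, of "\<lambda>w. Node (left w) (Node (right (right w)) (left (left (right w))))"]
    by (simp add: pt_Node pt_left pt_right pt_id)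
  then have F: "pt F"
    unfolding F_def by (intro pt_Node pt_left pt_right pt_id)
  have iter: "(F ^^ i) (Node v (Node t a)) = Node v (Node ((right ^^ i) t) (foldl (f v) a (take i (elems t))))"
    if "i \<le> num t" for i v t a
    using that
  proof (induction i)
    case (Suc i)
    then have "left ((right ^^ i) t) = elems t ! i"
      by (cases "(right ^^ i) t")
        (metis elems_eq_Nil elems_funpow_right Suc_le_lessD drop_eq_Nil leD,
         metis Cons_nth_drop_Suc Suc_le_lessD elems.simps(2) elems_funpow_right left.simps(2) list.inject)
    with Suc show ?case by (simp add: F_def take_Suc_conv_app_nth)
  qed simp
  have "pt (\<lambda>v. (F ^^ num (l v)) (?init v))"
  proof (rule pt_iter[OF F])
    show "pt ?init" by (intro pt_Node pt_id assms)
    show "pbd (\<lambda>v. 1 + tsize v + (1 + tsize (l v) + S v))"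
      by (intro pbd_add pbd_const pbd_tsize pt_size assms)
    show "tsize ((F ^^ i) (?init v)) \<le> 1 + tsize v + (1 + tsize (l v) + S v)" if "i \<le> num (l v)" for v i
      using that bound[OF that] tsize_funpow_right[of i "l v"] by (simp add: iter)
  qed (rule assms)
  then have "pt (\<lambda>v. right (right ((F ^^ num (l v)) (?init v))))"
    by (intro pt_right)
  then show ?thesis by (rule pt_cong) (simp add: iter)
qed

text \<open>If a step adds at most a multiple of the size of the element it consumes, the
  accumulator stays linear in the list, which settles the size bound of the general rule.\<close>

lemma pt_foldl_additive:
  assumes "pt (\<lambda>w. f (left w) (left (right w)) (right (right w)))" "pt g" "pt l"
    and add: "\<And>v a x. tsize (f v a x) \<le> tsize a + k * tsize x"
  shows "pt (\<lambda>v. foldl (f v) (g v) (elems (l v)))"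
proof (rule pt_foldl[OF assms(1-3)])
  show "pbd (\<lambda>v. tsize (g v) + k * tsize (l v))"
    by (intro pbd_add pbd_mult pbd_const pt_size assms)
  show "tsize (foldl (f v) (g v) (take i (elems (l v)))) \<le> tsize (g v) + k * tsize (l v)" for v i
  proof -
    \<comment> \<open>The extra \<open>k\<close> on the left is paid by the \<open>Leaf\<close> that
      ends the list, which has size 1.\<close>
    have *: "tsize (foldl (f v) a xs) + k \<le> tsize a + k * tsize (enc_list xs)" for a xs
    proof (induction xs arbitrary: a)
      case (Cons x xs)
      show ?case
        using Cons.IH[of "f v a x"] add[of v a x] by (simp add: algebra_simps)
    qed simp
    have "tsize (enc_list (take i xs)) \<le> tsize (enc_list xs)" for xs
    proof (induction xs arbitrary: i)
      case (Cons x xs)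
      then show ?case by (cases i) auto
    qed simp
    from this[of "elems (l v)"] have "k * tsize (enc_list (take i (elems (l v)))) \<le> k * tsize (l v)" by simp
    with *[of "g v" "take i (elems (l v))"] show ?thesis by linarith
  qed
qed

section \<open>List operations in polynomial time\<close>

definition trev :: "tree \<Rightarrow> tree" where
  "trev t = enc_list (rev (elems t))"

definition tmap :: "(tree \<Rightarrow> tree) \<Rightarrow> tree \<Rightarrow> tree" where
  "tmap f t = enc_list (map f (elems t))"

definition tapp :: "tree \<Rightarrow> tree \<Rightarrow> tree" where
  "tapp s t = enc_list (elems s @ elems t)"

definition tconcat :: "tree \<Rightarrow> tree" where
  "tconcat t = enc_list (concat (map elems (elems t)))"

definition tfilter :: "(tree \<Rightarrow> bool) \<Rightarrow> tree \<Rightarrow> tree" where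
  "tfilter P t = enc_list (filter P (elems t))"

definition tdrop :: "tree \<Rightarrow> tree \<Rightarrow> tree" where
  "tdrop s t = enc_list (drop (num s) (elems t))"

definition tnth :: "tree \<Rightarrow> tree \<Rightarrow> tree" where
  "tnth t i = left (tdrop i t)"

definition tidx :: "tree \<Rightarrow> tree" where
  "tidx t = enc_list (map enc_nat [0..<num t])"

definition tbin :: "tree \<Rightarrow> tree" where
  "tbin t = enc_bin (num t)"

lemma elems_ops [simp]:
  "elems (trev t) = rev (elems t)"
  "elems (tmap f t) = map f (elems t)"
  "elems (tapp s t) = elems s @ elems t"
  "elems (tconcat t) = concat (map elems (elems t))"
  "elems (tfilter P t) = filter P (elems t)"
  "elems (tdrop s t) = drop (num s) (elems t)"
  "elems (tidx t) = map enc_nat [0..<num t]"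
  by (simp_all add: trev_def tmap_def tapp_def tconcat_def tfilter_def tdrop_def tidx_def)

lemma tnth_enc_nat [simp]: "i < num t \<Longrightarrow> tnth t (enc_nat i) = elems t ! i"
  by (simp add: tnth_def tdrop_def Cons_nth_drop_Suc[symmetric])

lemma foldl_Node: "foldl (\<lambda>a x. Node (f x) a) a xs = enc_list (rev (map f xs) @ elems a)"
  by (induction xs arbitrary: a) auto

text \<open>Folding with \<open>Node\<close> reverses the list. The accumulator is bounded through
  its length and a polynomial bound on each entry, since the entries may be superlinear in
  size.\<close>

lemma pt_rev_map:
  assumes f: "pt (\<lambda>w. f (left w) (right w))" and l: "pt l"
  shows "pt (\<lambda>v. enc_list (rev (map (f v) (elems (l v)))))"
proof -
  obtain c where c: "\<And>w. tsize (f (left w) (right w)) \<le> c * tsize w ^ c"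
    using pt_size[OF f] by (auto simp: pbd_def)
  define B where "B v = c * (1 + tsize v + tsize (l v)) ^ c" for v
  have "pt (\<lambda>v. foldl (\<lambda>a x. Node (f v x) a) Leaf (elems (l v)))"
  proof (rule pt_foldl)
    have "pt (\<lambda>w. f (left w) (right (right w)))"
      using pt_comp[OF f, of "\<lambda>w. Node (left w) (right (right w))"]
      by (simp add: pt_Node pt_left pt_right pt_id)
    then show "pt (\<lambda>w. Node (f (left w) (right (right w))) (left (right w)))"
      by (intro pt_Node pt_left pt_right pt_id)
    show "pbd (\<lambda>v. 1 + tsize (l v) * (1 + B v))"
      unfolding B_def by (intro pbd_add pbd_mult pbd_power pbd_const pbd_tsize pt_size l)
    show "tsize (foldl (\<lambda>a x. Node (f v x) a) Leaf (take i (elems (l v)))) \<le> 1 + tsize (l v) * (1 + B v)"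
      for v i
      unfolding foldl_Node
    proof (rule tsize_enc_list_le)
      fix y assume "y \<in> set (rev (map (f v) (take i (elems (l v)))) @ elems Leaf)"
      then obtain x where x: "x \<in> set (elems (l v))" "y = f v x" by (auto dest: in_set_takeD)
      have "tsize y \<le> c * tsize (Node v x) ^ c" using c[of "Node v x"] x by simp
      also have "\<dots> \<le> B v"
        unfolding B_def using tsize_elem_le[OF x(1)] by (intro mult_mono power_mono) auto
      finally show "tsize y \<le> B v" .
    next
      show "length (rev (map (f v) (take i (elems (l v)))) @ elems Leaf) \<le> tsize (l v)"
        using num_le_tsize[of "l v"] by simp
    qed
  qed (rule pt_Leaf l)+
  then show ?thesis by (rule pt_cong) (simp add: foldl_Node)
qed

lemma pt_trev: "pt l \<Longrightarrow> pt (\<lambda>v. trev (l v))"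
  using pt_rev_map[of "\<lambda>_ x. x" l] by (simp add: trev_def pt_right pt_id)

lemma pt_tmap:
  assumes "pt (\<lambda>w. f (left w) (right w))" "pt l" shows "pt (\<lambda>v. tmap (f v) (l v))"
  using pt_trev[OF pt_rev_map[OF assms]] by (simp add: trev_def tmap_def)

lemma tsize_tapp_le: "tsize (tapp s t) \<le> tsize s + tsize t"
  unfolding tapp_def by (induction s) auto

lemma pt_tapp:
  assumes "pt f" "pt g" shows "pt (\<lambda>v. tapp (f v) (g v))"
proof -
  have "pt (\<lambda>v. foldl (\<lambda>a x. Node x a) (g v) (elems (trev (f v))))"
  proof (rule pt_foldl_additive)
    show "tsize (Node x a) \<le> tsize a + 2 * tsize x" for a x
      using tsize_pos(2)[of x] by simp
  qed (intro pt_Node pt_left pt_right pt_id pt_trev assms)+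
  then show ?thesis
    by (rule pt_cong) (use foldl_Node[of "\<lambda>x. x"] in \<open>simp add: tapp_def\<close>)
qed

lemma pt_tconcat:
  assumes "pt l" shows "pt (\<lambda>v. tconcat (l v))"
proof -
  have "pt (\<lambda>v. foldl (\<lambda>a x. tapp a x) Leaf (elems (l v)))"
  proof (rule pt_foldl_additive)
    show "tsize (tapp a x) \<le> tsize a + 1 * tsize x" for a x
      using tsize_tapp_le[of a x] by simp
  qed (intro pt_tapp pt_left pt_right pt_id pt_Leaf assms)+
  moreover have "foldl (\<lambda>a x. tapp a x) a xs = enc_list (elems a @ concat (map elems xs))" for a xs
    by (induction xs arbitrary: a) (auto simp: tapp_def)
  ultimately show ?thesis by (simp add: tconcat_def)
qed

lemma pt_tfilter:
  assumes "ptp (\<lambda>w. P (left w) (right w))" "pt l" shows "pt (\<lambda>v. tfilter (P v) (l v))"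
proof -
  have "pt (\<lambda>v. tconcat (tmap (\<lambda>x. if P v x then Node x Leaf else Leaf) (l v)))"
    by (intro pt_tconcat pt_tmap pt_If assms pt_Node pt_right pt_id pt_Leaf)
  moreover have "concat (map (\<lambda>x. elems (if Q x then Node x Leaf else Leaf)) xs) = filter Q xs" for Q xs
    by (induction xs) auto
  ultimately show ?thesis by (simp add: tconcat_def tfilter_def comp_def)
qed

text \<open>Bounded quantification amounts to testing whether the list of counterexamples is
  empty.\<close>

lemma ptp_ball:
  assumes "ptp (\<lambda>w. P (left w) (right w))" "pt l" shows "ptp (\<lambda>v. \<forall>x \<in> set (elems (l v)). P v x)"
proof -
  have "ptp (\<lambda>v. tfilter (\<lambda>x. \<not> P v x) (l v) = Leaf)"
    by (intro ptp_eq_Leaf pt_tfilter ptp_not assms)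
  moreover have "tfilter (\<lambda>x. \<not> P v x) (l v) = Leaf \<longleftrightarrow> (\<forall>x \<in> set (elems (l v)). P v x)" for v
    by (simp add: elems_eq_Nil[symmetric] filter_empty_conv del: elems_eq_Nil)
  ultimately show ?thesis by simp
qed

lemma ptp_bex:
  assumes "ptp (\<lambda>w. P (left w) (right w))" "pt l" shows "ptp (\<lambda>v. \<exists>x \<in> set (elems (l v)). P v x)"
  using ptp_not[OF ptp_ball[OF ptp_not[OF assms(1)] assms(2)]] by simp

lemma pt_tdrop:
  assumes "pt f" "pt g" shows "pt (\<lambda>v. tdrop (f v) (g v))"
proof -
  have "pt (\<lambda>v. (right ^^ num (f v)) (g v))"
    by (rule pt_iter[OF pt_right[OF pt_id] assms(2,1) pt_size[OF assms(2)]]) (rule tsize_funpow_right)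
  then show ?thesis by (rule pt_cong) (simp add: tdrop_def flip: elems_eq_iff)
qed

lemma pt_tnth: "pt f \<Longrightarrow> pt g \<Longrightarrow> pt (\<lambda>v. tnth (f v) (g v))"
  unfolding tnth_def by (intro pt_left pt_tdrop)

lemma tsize_enc_nat [simp]: "tsize (enc_nat n) = 2 * n + 1"
  by (induction n) auto

text \<open>One round increments all entries and puts 0 in front.\<close>

lemma pt_tidx:
  assumes "pt l" shows "pt (\<lambda>v. tidx (l v))"
proof -
  let ?F = "\<lambda>t. Node Leaf (tmap (Node Leaf) t)"
  have F: "(?F ^^ n) Leaf = enc_list (map enc_nat [0..<n])" for n
  proof (induction n)
    case (Suc n)
    have "[0..<Suc n] = 0 # map Suc [0..<n]"
      by (simp add: upt_conv_Cons map_Suc_upt del: upt_Suc)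
    then have "enc_list (map enc_nat [0..<Suc n]) = ?F (enc_list (map enc_nat [0..<n]))"
      by (simp add: tmap_def comp_def del: upt_Suc)
    then show ?case using Suc.IH by simp
  qed simp
  have "pt (\<lambda>v. (?F ^^ num (l v)) Leaf)"
  proof (rule pt_iter)
    show "pbd (\<lambda>v. 1 + tsize (l v) * (1 + (2 * tsize (l v) + 1)))"
      by (intro pbd_add pbd_mult pbd_const pt_size assms)
    show "tsize ((?F ^^ i) Leaf) \<le> 1 + tsize (l v) * (1 + (2 * tsize (l v) + 1))" if "i \<le> num (l v)" for v i
      unfolding F by (rule tsize_enc_list_le) (use that num_le_tsize[of "l v"] in auto)
  qed (intro pt_Node pt_tmap pt_Leaf pt_right pt_id assms)+
  then show ?thesis by (simp add: F tidx_def)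
qed

section \<open>Binary counting\<close>

primrec bits_inc :: "tree list \<Rightarrow> tree list" where
  "bits_inc [] = [Node Leaf Leaf]"
| "bits_inc (x # xs) = (if x = Leaf then Node Leaf Leaf # xs else Leaf # bits_inc xs)"

lemma bits_inc_enc_bin: "bits_inc (elems (enc_bin n)) = elems (enc_bin (Suc n))"
proof (induction n rule: less_induct)
  case (less n)
  show ?case
  proof (cases "n = 0")
    case True
    then show ?thesis by (simp add: enc_bin.simps[of 0] enc_bin.simps[of "Suc 0"])
  next
    case False
    then have "bits_inc (elems (enc_bin (n div 2))) = elems (enc_bin (Suc (n div 2)))"
      by (intro less) simp
    with False show ?thesis
      by (auto simp: enc_bin.simps[of n] enc_bin.simps[of "Suc n"] elim!: oddE)
  qed
qed

lemma pt_bits_inc: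
  assumes "pt l" shows "pt (\<lambda>v. enc_list (bits_inc (elems (l v))))"
proof -
  let ?one = "Node Leaf Leaf"
  \<comment> \<open>The left component of the state is \<open>Leaf\<close> as long as a carry is pending.\<close>
  define f where "f a x = (if left a = Leaf
      then if x = Leaf then Node ?one (Node ?one (right a)) else Node Leaf (Node Leaf (right a))
      else Node ?one (Node x (right a)))" for a x
  define fin where "fin a = trev (if left a = Leaf then Node ?one (right a) else right a)" for a
  have f: "pt (\<lambda>w. f (a w) (b w))" if "pt a" "pt b" for a b
    unfolding f_def by (intro pt_If ptp_eq_Leaf pt_Node pt_left pt_right pt_Leaf that)
  have "pt (\<lambda>v. foldl f (Node Leaf Leaf) (elems (l v)))"
  proof (rule pt_foldl_additive)
    show "tsize (f a x) \<le> tsize a + 8 * tsize x" for a x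
      by (cases a; cases x) (auto simp: f_def Suc_le_eq)
  qed (intro f pt_left pt_right pt_id pt_const assms)+
  then have "pt (\<lambda>v. fin (foldl f (Node Leaf Leaf) (elems (l v))))"
    unfolding fin_def by (intro pt_trev pt_If ptp_eq_Leaf pt_left pt_Node pt_const pt_right)
  moreover have "f (Node ?one t) x = Node ?one (Node x t)" for t x
    by (simp add: f_def)
  then have noc: "fin (foldl f (Node ?one t) xs) = enc_list (rev (elems t) @ xs)" for t xs
    by (induction xs arbitrary: t) (simp_all add: fin_def trev_def)
  have "f (Node Leaf t) x = (if x = Leaf then Node ?one (Node ?one t) else Node Leaf (Node Leaf t))" for t x
    by (simp add: f_def)
  then have "fin (foldl f (Node Leaf t) xs) = enc_list (rev (elems t) @ bits_inc xs)" for t xs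
    by (induction xs arbitrary: t) (simp_all add: noc, simp add: fin_def trev_def)
  ultimately show ?thesis by simp
qed

text \<open>Instances contain their budget in binary, while the reduction obtains it as the length
  of a list. That list has polynomial size, so the counter can be incremented once per
  element.\<close>

lemma pt_tbin:
  assumes "pt l" shows "pt (\<lambda>v. tbin (l v))"
proof -
  have pt_fold: "pt (\<lambda>v. foldl (\<lambda>a x. enc_list (bits_inc (elems a))) Leaf (elems (l v)))"
  proof (rule pt_foldl_additive)
    \<comment> \<open>The worst case is a carry out of the last digit: a \<open>Leaf\<close> of size
      1 becomes a one-digit list of size 5.\<close>
    have "tsize (enc_list (bits_inc (elems a))) \<le> tsize a + 4" for a
    proof (induction a)
      case (Node a1 a2)
      then show ?case by (cases a1) auto
    qed simp
    then show "tsize (enc_list (bits_inc (elems a))) \<le> tsize a + 4 * tsize x" for a x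
      by (rule order_trans) (simp add: Suc_le_eq)
  qed (intro pt_bits_inc pt_left pt_right pt_id pt_Leaf assms)+
  have "foldl (\<lambda>a x. enc_list (bits_inc (elems a))) (enc_bin n) xs = enc_bin (n + length xs)"
    for n xs
    by (induction xs arbitrary: n) (simp_all add: bits_inc_enc_bin)
  from this[of 0] have "foldl (\<lambda>a x. enc_list (bits_inc (elems a))) Leaf xs = enc_bin (length xs)" for xs
    by (simp add: enc_bin.simps[of 0])
  then show ?thesis by (intro pt_cong[OF pt_fold]) (simp add: tbin_def)
qed

lemma ptp_num_le:
  assumes "pt f" "pt g" shows "ptp (\<lambda>v. num (f v) \<le> num (g v))"
proof -
  have "ptp (\<lambda>v. tdrop (g v) (f v) = Leaf)"
    by (intro ptp_eq_Leaf pt_tdrop assms)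
  moreover have "tdrop t s = Leaf \<longleftrightarrow> num s \<le> num t" for s t
    by (simp flip: elems_eq_Nil)
  ultimately show ?thesis by simp
qed

lemma ptp_num_less: "pt f \<Longrightarrow> pt g \<Longrightarrow> ptp (\<lambda>v. num (f v) < num (g v))"
  using ptp_not[OF ptp_num_le, of g f] by (simp add: not_le)

lemma ptp_num_eq: "pt f \<Longrightarrow> pt g \<Longrightarrow> ptp (\<lambda>v. num (f v) = num (g v))"
  using ptp_conj[OF ptp_num_le ptp_num_le, of f g g f] by (simp add: eq_iff)

lemmas pt_intros = pt_Node pt_left pt_right pt_id pt_const pt_If pt_trev pt_tmap pt_tapp pt_tconcat
  pt_tfilter pt_tdrop pt_tnth pt_tidx pt_tbin ptp_eq_Leaf ptp_not ptp_conj ptp_disj ptp_imp ptp_const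
  ptp_ball ptp_bex ptp_num_le ptp_num_less ptp_num_eq

section \<open>Composing FPT reductions with polynomial-time functions\<close>

lemma runs_exec_st: "exec p (st v) n (st w) \<Longrightarrow> runs p v n w"
  unfolding runs_def st_def[symmetric] by auto

text \<open>Lets new time and parameter bounds be derived from given computable ones by unary
  arithmetic. The program saves its argument, so that \<open>h\<close> sees both \<open>k\<close>
  and \<open>f k\<close>.\<close>

lemma computable_pt:
  assumes "computable f" "pt h"
    and h: "\<And>k. h (Node (enc_nat k) (enc_nat (f k))) = enc_nat (f' k)"
  shows "computable f'"
proof -
  obtain p where p: "\<And>n. \<exists>m. runs p (enc_nat n) m (enc_nat (f n))"
    using assms(1) by (auto simp: computable_def)
  obtain q m where "\<And>v n w. runs p v n w \<Longrightarrow> exec q (st v) (n + m) (st w)"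
    using clean_program[of p] by blast
  then have q: "\<exists>n. exec q (st (enc_nat k)) n (st (enc_nat (f k)))" for k
    using p by blast
  obtain b r where "pbd b" and r: "\<forall>v. exec r (st v) (b v) (st (h v))"
    using pt_ex[OF assms(2)] by (elim exE conjE) (rule that)
  have "finite (insert 0 (cvars q))" by simp
  then obtain x where x: "x \<notin> cvars q" "x \<noteq> 0"
    using ex_new_if_finite[OF infinite_UNIV_nat] by (metis insertCI)
  let ?prog = "Seq (Assign x (Var 0)) (Seq q (Seq (Assign 0 (Nd (Var x) (Var 0))) (Seq (Assign x Lf) r)))"
  have st0: "(st u)(x := a, 0 := w) = (st w)(x := a)" for u a w
    using x(2) by (auto simp: st_def)
  have "\<exists>n. runs ?prog (enc_nat k) n (enc_nat (f' k))" for k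
  proof -
    let ?v = "enc_nat k" and ?w = "enc_nat (f k)"
    obtain n where n: "exec q (st ?v) n (st ?w)" using q by blast
    have 1: "exec (Assign x (Var 0)) (st ?v) (ecost (Var 0) (st ?v)) ((st ?v)(x := ?v))"
      by (rule exec_AssignI) simp_all
    note 2 = exec_frame[OF n x(1), of ?v]
    have 3: "exec (Assign 0 (Nd (Var x) (Var 0))) ((st ?w)(x := ?v))
        (ecost (Nd (Var x) (Var 0)) ((st ?w)(x := ?v))) ((st (Node ?v ?w))(x := ?v))"
      by (rule exec_AssignI) (use x(2) in \<open>simp_all add: st0\<close>)
    have 4: "exec (Assign x Lf) ((st (Node ?v ?w))(x := ?v)) 1 (st (Node ?v ?w))"
      by (rule exec_AssignI) (use x(2) in simp_all)
    have 5: "exec r (st (Node ?v ?w)) (b (Node ?v ?w)) (st (enc_nat (f' k)))"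
      using r[rule_format, of "Node ?v ?w"] by (simp only: h)
    show ?thesis
      by (rule exI, rule runs_exec_st, rule exec.Seq[OF 1 exec.Seq[OF 2 exec.Seq[OF 3 exec.Seq[OF 4 5]]]])
  qed
  then show ?thesis unfolding computable_def by blast
qed

section \<open>Arithmetic on unary numerals\<close>

definition tmul :: "tree \<Rightarrow> tree \<Rightarrow> tree" where
  "tmul s t = tconcat (tmap (\<lambda>_. t) s)"

primrec tpow :: "nat \<Rightarrow> tree \<Rightarrow> tree" where
  "tpow 0 t = enc_nat 1"
| "tpow (Suc n) t = tmul t (tpow n t)"

lemma enc_nat_eqI: "elems t = replicate n Leaf \<Longrightarrow> t = enc_nat n"
  by (simp flip: elems_eq_iff)

lemma tapp_enc_nat: "tapp (enc_nat m) (enc_nat n) = enc_nat (m + n)"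
  by (rule enc_nat_eqI) (simp add: replicate_add)

lemma tmul_enc_nat: "tmul (enc_nat m) (enc_nat n) = enc_nat (m * n)"
proof (rule enc_nat_eqI)
  show "elems (tmul (enc_nat m) (enc_nat n)) = replicate (m * n) Leaf"
    by (induction m) (simp_all add: tmul_def replicate_add comp_def)
qed

lemma tpow_enc_nat: "tpow e (enc_nat n) = enc_nat (n ^ e)"
proof (induction e)
  case (Suc e)
  then show ?case by (simp only: tpow.simps tmul_enc_nat power_Suc)
qed simp

lemma pt_tmul:
  assumes "pt f" "pt g" shows "pt (\<lambda>v. tmul (f v) (g v))"
  unfolding tmul_def by (intro pt_tconcat pt_tmap pt_comp[OF assms(2) pt_left[OF pt_id]] assms(1))

lemma pt_tpow: "pt f \<Longrightarrow> pt (\<lambda>v. tpow e (f v))"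
  by (induction e) (simp_all add: pt_const pt_tmul)

text \<open>The output of the first reduction is no larger than its input plus its running time, so
  a polynomial-time function applied to it still takes a computable function of \<open>k\<close>
  times a power of the size of \<open>x\<close>.\<close>

lemma fpt_reducible_pt_trans:
  assumes "L \<le>fpt L'" "pt red"
    and red: "\<And>x k. red (Node x (enc_nat k)) = Node (R x k) (enc_nat (K x k))"
    and iff: "\<And>x k. (x, k) \<in> L' \<longleftrightarrow> (R x k, K x k) \<in> L''"
    and K: "\<And>x k. K x k \<le> k + d"
  shows "L \<le>fpt L''"
proof -
  obtain R1 K1 p f g c where f: "computable f" and g: "computable g"
    and iff1: "\<And>x k. (x, k) \<in> L \<longleftrightarrow> (R1 x k, K1 x k) \<in> L'"
    and K1: "\<And>x k. K1 x k \<le> g k"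
    and p: "\<And>x k. \<exists>n \<le> f k * tsize x ^ c. runs p (Node x (enc_nat k)) n (Node (R1 x k) (enc_nat (K1 x k)))"
    using assms(1) unfolding fpt_reducible_def by blast
  obtain q m where q: "\<And>v n w. runs p v n w \<Longrightarrow> exec q (st v) (n + m) (st w)"
    using clean_program[of p] by blast
  obtain b r where "pbd b" and r: "\<forall>v. exec r (st v) (b v) (st (red v))"
    using pt_ex[OF assms(2)] by (elim exE conjE) (rule that)
  then obtain e where e: "\<And>v. b v \<le> e * tsize v ^ e" by (auto simp: pbd_def)
  \<comment> \<open>The base collects the contributions to the size of the intermediate instance:
    the first running time, \<open>m\<close> for cleaning up, \<open>2 * k + 2\<close> for the unary
    parameter and the pairing node, and 1 for \<open>x\<close> itself. The outer \<open>1 +\<close>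
    and \<open>+ 1\<close> absorb the first run into the time of the second.\<close>
  define F where "F k = (1 + e) * (f k + (k + (k + (3 + m)))) ^ (e + 1)" for k
  have F: "computable F"
  proof (rule computable_pt[OF f])
    show "pt (\<lambda>v. tmul (enc_nat (1 + e)) (tpow (e + 1) (tapp (right v) (tapp (left v) (tapp (left v) (enc_nat (3 + m)))))))"
      by (intro pt_tmul pt_const pt_tpow pt_tapp pt_left pt_right pt_id)
    show "tmul (enc_nat (1 + e)) (tpow (e + 1) (tapp (right (Node (enc_nat k) (enc_nat (f k))))
        (tapp (left (Node (enc_nat k) (enc_nat (f k)))) (tapp (left (Node (enc_nat k) (enc_nat (f k))))
        (enc_nat (3 + m)))))) = enc_nat (F k)" for k
      by (simp only: left.simps right.simps tapp_enc_nat tpow_enc_nat tmul_enc_nat F_def)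
  qed
  have G: "computable (\<lambda>k. g k + d)"
  proof (rule computable_pt[OF g])
    show "pt (\<lambda>v. tapp (right v) (enc_nat d))" by (intro pt_tapp pt_right pt_id pt_const)
  qed (simp add: tapp_enc_nat)
  have time: "\<exists>n \<le> F k * tsize x ^ ((c + 1) * (e + 1)). runs (Seq q r) (Node x (enc_nat k)) n
      (Node (R (R1 x k) (K1 x k)) (enc_nat (K (R1 x k) (K1 x k))))" for x k
  proof -
    let ?v = "Node x (enc_nat k)" and ?w = "Node (R1 x k) (enc_nat (K1 x k))"
    obtain n where n: "n \<le> f k * tsize x ^ c" "runs p ?v n ?w" using p by blast
    note ex = q[OF n(2)]
    \<comment> \<open>The exponent \<open>c + 1\<close> instead of \<open>c\<close> makes
      \<open>X\<close> an upper bound on \<open>tsize x\<close> even for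
      \<open>c = 0\<close>.\<close>
    define X where "X = tsize x ^ (c + 1)"
    define a where "a = f k + (k + (k + (3 + m)))"
    have X: "1 \<le> X" "tsize x \<le> X" "tsize x ^ c \<le> X"
      using power_increasing[of 1 "c + 1" "tsize x"] power_increasing[of c "c + 1" "tsize x"]
      by (simp_all add: X_def del: power_Suc)
    have "n \<le> f k * X" using n(1) X(3) by (meson mult_le_mono2 order_trans)
    moreover have "(2 * k + 2 + m) * 1 \<le> (2 * k + 2 + m) * X" using X(1) by (intro mult_le_mono2)
    ultimately have aX: "n + m + (2 * k + 2) + tsize x \<le> a * X"
      using X(2) by (simp add: a_def algebra_simps)
    have "tsize ?w \<le> tsize ?v + (n + m)" using exec_size[OF ex, of 0] by simp
    with aX have w: "tsize ?w \<le> a * X" by simp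
    have "1 \<le> a * X" using X(1) by (simp add: a_def)
    have "b ?w \<le> e * (a * X) ^ e"
      by (rule order_trans[OF e]) (intro mult_mono power_mono w; simp)
    also have "\<dots> \<le> e * (a * X) ^ (e + 1)"
      using \<open>1 \<le> a * X\<close> by (intro mult_le_mono2 power_increasing) simp_all
    finally have "b ?w \<le> e * (a * X) ^ (e + 1)" .
    moreover have "(a * X) ^ 1 \<le> (a * X) ^ (e + 1)"
      using \<open>1 \<le> a * X\<close> by (intro power_increasing) simp_all
    ultimately have "n + m + b ?w \<le> (a * X) ^ (e + 1) + e * (a * X) ^ (e + 1)"
      using aX by (simp only: power_one_right)
    also have "\<dots> = (1 + e) * (a * X) ^ (e + 1)" by (simp only: add_mult_distrib mult_1)
    finally have "n + m + b ?w \<le> (1 + e) * (a * X) ^ (e + 1)" .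
    also have "(1 + e) * (a * X) ^ (e + 1) = F k * tsize x ^ ((c + 1) * (e + 1))"
      by (simp only: F_def a_def X_def power_mult_distrib power_mult mult.assoc)
    finally have "n + m + b ?w \<le> F k * tsize x ^ ((c + 1) * (e + 1))" .
    moreover have "runs (Seq q r) ?v (n + m + b ?w) (red ?w)"
      by (rule runs_exec_st, rule exec.Seq[OF ex]) (rule r[rule_format])
    ultimately show ?thesis unfolding red by blast
  qed
  have "K (R1 x k) (K1 x k) \<le> g k + d" for x k
    using K[of "R1 x k" "K1 x k"] K1[of x k] by linarith
  moreover have "(x, k) \<in> L \<longleftrightarrow> (R (R1 x k) (K1 x k), K (R1 x k) (K1 x k)) \<in> L''" for x k
    using iff1 iff by blast
  ultimately show ?thesis
    unfolding fpt_reducible_def using F G time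
    by (intro exI[of _ "\<lambda>x k. R (R1 x k) (K1 x k)"] exI[of _ "\<lambda>x k. K (R1 x k) (K1 x k)"]
        exI[of _ "Seq q r"] exI[of _ F] exI[of _ "\<lambda>k. g k + d"] exI[of _ "(c + 1) * (e + 1)"]) blast
qed

section \<open>Circuits\<close>

definition large :: "gate \<Rightarrow> bool" where
  "large g \<longleftrightarrow> 2 < length (preds g)"

text \<open>Replaces the quantification over paths by a recursion of constant nesting:
  \<open>d\<close> is the depth still allowed and \<open>b\<close> the number of large gates still
  allowed on the way down from \<open>i\<close>.\<close>

primrec chk :: "nat \<Rightarrow> circuit \<Rightarrow> nat \<Rightarrow> nat \<Rightarrow> bool" where
  "chk 0 C b i \<longleftrightarrow> C ! i = Inp"
| "chk (Suc d) C b i \<longleftrightarrow> C ! i = Inp \<or>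
    (large (C ! i) \<longrightarrow> 0 < b \<and> (\<forall>j \<in> set (preds (C ! i)). chk d C (b - 1) j)) \<and>
    (\<not> large (C ! i) \<longrightarrow> (\<forall>j \<in> set (preds (C ! i)). chk d C b j))"

definition path_to :: "circuit \<Rightarrow> nat \<Rightarrow> nat list \<Rightarrow> bool" where
  "path_to C i p \<longleftrightarrow> p \<noteq> [] \<and> set p \<subseteq> {..<length C} \<and> C ! hd p = Inp \<and> last p = i \<and>
    successively (\<lambda>i j. i \<in> set (preds (C ! j))) p"

lemma io_path_iff: "io_path C p \<longleftrightarrow> path_to C (length C - 1) p"
  by (auto simp: io_path_def path_to_def)

lemma path_to_snoc:
  assumes "i < length C"
  shows "path_to C i p \<longleftrightarrow> C ! i = Inp \<and> p = [i] \<or> (\<exists>j \<in> set (preds (C ! i)). \<exists>q. p = q @ [i] \<and> path_to C j q)"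
proof (cases p rule: rev_cases)
  case Nil
  then show ?thesis by (auto simp: path_to_def)
next
  case (snoc q k)
  show ?thesis
  proof (cases "q = []")
    case False
    then show ?thesis
      using assms snoc unfolding path_to_def by (auto simp: successively_append_iff)
  qed (use assms snoc in \<open>auto simp: path_to_def\<close>)
qed

lemma wf_circuitD:
  assumes "wf_circuit C" "i < length C"
  shows "distinct (preds (C ! i))" "j \<in> set (preds (C ! i)) \<Longrightarrow> j < i"
    "C ! i = Conj js \<or> C ! i = Disj js \<Longrightarrow> 2 \<le> length js"
  using assms unfolding wf_circuit_def by blast+

lemma preds_nonempty: "wf_circuit C \<Longrightarrow> i < length C \<Longrightarrow> C ! i \<noteq> Inp \<Longrightarrow> preds (C ! i) \<noteq> []"
  using wf_circuitD(3)[of C i] by (cases "C ! i") fastforce+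

text \<open>Gates have predecessors, all at smaller positions, so walking backwards ends in an
  input. Without such a path, a bound on all paths to a node would say nothing about the
  node.\<close>

lemma path_to_exists: "wf_circuit C \<Longrightarrow> i < length C \<Longrightarrow> \<exists>p. path_to C i p"
proof (induction i rule: less_induct)
  case (less i)
  show ?case
  proof (cases "C ! i = Inp")
    case True
    then show ?thesis using path_to_snoc[OF less.prems(2)] by blast
  next
    case False
    then obtain j where j: "j \<in> set (preds (C ! i))"
      using preds_nonempty[OF less.prems] by (meson list.set_sel(1))
    then have "j < i" using wf_circuitD(2)[OF less.prems] by blast
    then obtain p where "path_to C j p" using less by force
    then show ?thesis using path_to_snoc[OF less.prems(2)] j by blast
  qed
qed

lemma chk_iff:
  assumes "wf_circuit C" "i < length C"
  shows "chk d C b i \<longleftrightarrow> (\<forall>p. path_to C i p \<longrightarrow>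
    length (filter (\<lambda>i. large (C ! i)) p) \<le> b \<and> length (filter (\<lambda>i. C ! i \<noteq> Inp) p) \<le> d)"
    (is "_ \<longleftrightarrow> ?R d b i")
  using assms(2)
proof (induction d arbitrary: b i)
  case (0 b i)
  show ?case
  proof (cases "C ! i = Inp")
    case True
    then show ?thesis using path_to_snoc[OF 0] by (auto simp: large_def)
  next
    case False
    \<comment> \<open>A gate counts itself on any path that reaches it, which already exceeds depth
      0.\<close>
    obtain p where p: "path_to C i p" using path_to_exists[OF assms(1) 0] by blast
    with False have "i \<in> set p" by (auto simp: path_to_def)
    with False have "filter (\<lambda>i. C ! i \<noteq> Inp) p \<noteq> []" by (auto simp: filter_empty_conv)
    with p False show ?thesis by auto
  qed
next
  case (Suc d b i)
  show ?case
  proof (cases "C ! i = Inp")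
    case True
    then show ?thesis using path_to_snoc[OF Suc.prems] by (auto simp: large_def)
  next
    case False
    note lt = wf_circuitD(2)[OF assms(1) Suc.prems]
    have IH: "chk d C b' j \<longleftrightarrow> ?R d b' j" if "j \<in> set (preds (C ! i))" for j b'
      using Suc.IH[of j b'] lt[OF that] Suc.prems by simp
    have R: "?R (Suc d) b i \<longleftrightarrow> (\<forall>j \<in> set (preds (C ! i)). \<forall>q. path_to C j q \<longrightarrow>
      length (filter (\<lambda>i. large (C ! i)) q) + (if large (C ! i) then 1 else 0) \<le> b \<and>
      length (filter (\<lambda>i. C ! i \<noteq> Inp) q) \<le> d)"
    proof -
      have paths: "path_to C i p \<longleftrightarrow> (\<exists>j \<in> set (preds (C ! i)). \<exists>q. p = q @ [i] \<and> path_to C j q)" for p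
        using path_to_snoc[OF Suc.prems] False by blast
      have "?R (Suc d) b i \<longleftrightarrow> (\<forall>j \<in> set (preds (C ! i)). \<forall>q. path_to C j q \<longrightarrow>
        length (filter (\<lambda>i. large (C ! i)) (q @ [i])) \<le> b \<and>
        length (filter (\<lambda>i. C ! i \<noteq> Inp) (q @ [i])) \<le> Suc d)"
        by (simp only: paths) blast
      also have "\<dots> \<longleftrightarrow> (\<forall>j \<in> set (preds (C ! i)). \<forall>q. path_to C j q \<longrightarrow>
        length (filter (\<lambda>i. large (C ! i)) q) + (if large (C ! i) then 1 else 0) \<le> b \<and>
        length (filter (\<lambda>i. C ! i \<noteq> Inp) q) \<le> d)"
        using False by simp
      finally show ?thesis .
    qed
    show ?thesis
    proof (cases "large (C ! i)")
      case True
      \<comment> \<open>An actual path through the large gate is needed to conclude that the budget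
        \<open>b\<close> is positive.\<close>
      obtain j where j: "j \<in> set (preds (C ! i))"
        using preds_nonempty[OF assms(1) Suc.prems False] by (meson list.set_sel(1))
      have "j < length C" using lt[OF j] Suc.prems by simp
      then obtain q where "path_to C j q" using path_to_exists[OF assms(1)] by blast
      then have "0 < b" if "?R (Suc d) b i"
        using that[unfolded R, rule_format, OF j] True by fastforce
      moreover have "?R (Suc d) b i \<longleftrightarrow> (\<forall>j \<in> set (preds (C ! i)). ?R d (b - 1) j)" if "0 < b"
      proof -
        have "n + (if large (C ! i) then 1 else 0) \<le> b \<longleftrightarrow> n \<le> b - 1" for n
          using True that by auto
        then show ?thesis unfolding R by blast
      qed
      ultimately show ?thesis using True False IH by (simp only: chk.simps) blast
    next
      case F: False
      then have "?R (Suc d) b i \<longleftrightarrow> (\<forall>j \<in> set (preds (C ! i)). ?R d b j)" unfolding R by auto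
      then show ?thesis using F False IH by (simp only: chk.simps) blast
    qed
  qed
qed

lemma chk_output:
  assumes "wf_circuit C"
  shows "chk d C b (length C - 1) \<longleftrightarrow> weft_at_most C b \<and> depth_at_most C d"
proof -
  have "length C - 1 < length C" using assms by (auto simp: wf_circuit_def)
  from chk_iff[OF assms this] show ?thesis
    unfolding weft_at_most_def depth_at_most_def io_path_iff large_def by blast
qed

lemma chk_mono: "wf_circuit C \<Longrightarrow> i < length C \<Longrightarrow> chk d C b i \<Longrightarrow> d \<le> d' \<Longrightarrow> chk d' C b i"
  by (meson chk_iff order_trans)

section \<open>Values of the nodes\<close>

lemma node_vals_snoc: "node_vals A (C @ [g]) = node_vals A C @ [gate_val A (node_vals A C) g]"
  by (simp add: node_vals_def)

lemma length_node_vals [simp]: "length (node_vals A C) = length C"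
  by (induction C rule: rev_induct) (simp_all add: node_vals_snoc, simp add: node_vals_def)

lemma node_vals_nth:
  "i < length C \<Longrightarrow> node_vals A C ! i \<longleftrightarrow> gate_val A (take i (node_vals A C)) (C ! i)"
proof (induction C rule: rev_induct)
  case (snoc g C)
  then show ?case
    by (cases "i < length C") (auto simp: node_vals_snoc nth_append less_Suc_eq)
qed simp

lemma node_vals_simps:
  assumes "wf_circuit C" "i < length C"
  shows "C ! i = Inp \<Longrightarrow> node_vals A C ! i \<longleftrightarrow> i \<in> A"
    "C ! i = Neg j \<Longrightarrow> node_vals A C ! i \<longleftrightarrow> \<not> node_vals A C ! j"
    "C ! i = Conj js \<Longrightarrow> node_vals A C ! i \<longleftrightarrow> (\<forall>j \<in> set js. node_vals A C ! j)"
    "C ! i = Disj js \<Longrightarrow> node_vals A C ! i \<longleftrightarrow> (\<exists>j \<in> set js. node_vals A C ! j)"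
proof -
  have "take i (node_vals A C) ! j = node_vals A C ! j" if "j \<in> set (preds (C ! i))" for j
    using wf_circuitD(2)[OF assms that] by simp
  then show "C ! i = Inp \<Longrightarrow> node_vals A C ! i \<longleftrightarrow> i \<in> A"
    "C ! i = Neg j \<Longrightarrow> node_vals A C ! i \<longleftrightarrow> \<not> node_vals A C ! j"
    "C ! i = Conj js \<Longrightarrow> node_vals A C ! i \<longleftrightarrow> (\<forall>j \<in> set js. node_vals A C ! j)"
    "C ! i = Disj js \<Longrightarrow> node_vals A C ! i \<longleftrightarrow> (\<exists>j \<in> set js. node_vals A C ! j)"
    using assms(2) by (simp_all add: node_vals_nth)
qed

lemma last_node_vals: "wf_circuit C \<Longrightarrow> last (node_vals A C) \<longleftrightarrow> node_vals A C ! (length C - 1)"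
  by (metis last_conv_nth length_0_conv length_node_vals wf_circuit_def)

section \<open>Recognizing encodings of circuits\<close>

lemma ptp_num_eq_const: "pt f \<Longrightarrow> ptp (\<lambda>v. num (f v) = n)"
  using ptp_num_eq[OF _ pt_const, of f "enc_nat n"] by simp

lemma ptp_num_le_const: "pt f \<Longrightarrow> ptp (\<lambda>v. num (f v) \<le> n)"
  using ptp_num_le[OF _ pt_const, of f "enc_nat n"] by simp

lemma ptp_num_ge_const: "pt f \<Longrightarrow> ptp (\<lambda>v. n \<le> num (f v))"
  using ptp_num_le[OF pt_const, of f "enc_nat n"] by simp

text \<open>The tags 0 to 3 stand for input, negation, conjunction and disjunction; once tag 0 is
  excluded, \<open>num (left g) \<le> 1\<close> singles out negations.\<close>

definition tpreds :: "tree \<Rightarrow> tree" where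
  "tpreds g = (if left g = Leaf then Leaf
    else if num (left g) \<le> 1 then Node (right g) Leaf else right g)"

definition tlarge :: "tree \<Rightarrow> bool" where
  "tlarge g \<longleftrightarrow> 3 \<le> num (tpreds g)"

text \<open>The tests available on trees are emptiness and comparison of lengths. Comparing entries
  by \<open>num\<close> is faithful on unary numerals, which \<open>tgate\<close> enforces
  separately.\<close>

definition tdistinct :: "tree \<Rightarrow> bool" where
  "tdistinct l \<longleftrightarrow> (\<forall>p \<in> set (elems (tidx l)). \<forall>q \<in> set (elems (tidx l)).
    num p = num q \<or> num (tnth l p) \<noteq> num (tnth l q))"

definition tnat :: "tree \<Rightarrow> bool" where
  "tnat t \<longleftrightarrow> (\<forall>y \<in> set (elems t). y = Leaf)"

text \<open>The position of the output in unary: the tail of the node list has one entry less than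
  the list, and overwriting its entries makes it a numeral.\<close>

definition tlast :: "tree \<Rightarrow> tree" where
  "tlast x = tmap (\<lambda>_. Leaf) (right x)"

text \<open>Characterizes the range of \<open>enc_gate\<close>; the implication is there because the
  encoding of an input gate has the fixed right component \<open>Leaf\<close>.\<close>

definition tgate :: "tree \<Rightarrow> bool" where
  "tgate g \<longleftrightarrow> g \<noteq> Leaf \<and> tnat (left g) \<and> num (left g) \<le> 3 \<and> (left g = Leaf \<longrightarrow> right g = Leaf) \<and>
    (\<forall>j \<in> set (elems (tpreds g)). tnat j)"

definition tgate_ok :: "tree \<Rightarrow> tree \<Rightarrow> bool" where
  "tgate_ok g i \<longleftrightarrow> tgate g \<and> (\<forall>j \<in> set (elems (tpreds g)). num j < num i) \<and> tdistinct (tpreds g) \<and>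
    (2 \<le> num (left g) \<longrightarrow> 2 \<le> num (tpreds g))"

primrec tchk :: "nat \<Rightarrow> nat \<Rightarrow> tree \<Rightarrow> tree \<Rightarrow> bool" where
  "tchk 0 b x i \<longleftrightarrow> left (tnth x i) = Leaf"
| "tchk (Suc d) b x i \<longleftrightarrow> left (tnth x i) = Leaf \<or>
    (tlarge (tnth x i) \<longrightarrow> 0 < b \<and> (\<forall>j \<in> set (elems (tpreds (tnth x i))). tchk d (b - 1) x j)) \<and>
    (\<not> tlarge (tnth x i) \<longrightarrow> (\<forall>j \<in> set (elems (tpreds (tnth x i))). tchk d b x j))"

text \<open>A many-one reduction must also answer correctly on trees that encode no circuit, or one
  of the wrong weft or depth, so these have to be recognized in polynomial time.\<close>

definition tvalid :: "nat \<Rightarrow> tree \<Rightarrow> bool" where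
  "tvalid d x \<longleftrightarrow> x \<noteq> Leaf \<and> (\<forall>i \<in> set (elems (tidx x)). tgate_ok (tnth x i) i) \<and> tchk d 1 x (tlast x)"

lemma pt_tpreds: "pt f \<Longrightarrow> pt (\<lambda>v. tpreds (f v))"
  unfolding tpreds_def by (intro pt_intros ptp_num_le_const)

lemma ptp_tlarge: "pt f \<Longrightarrow> ptp (\<lambda>v. tlarge (f v))"
  unfolding tlarge_def by (intro pt_tpreds ptp_num_ge_const)

lemma ptp_tdistinct: assumes "pt f" shows "ptp (\<lambda>v. tdistinct (f v))"
  unfolding tdistinct_def by (intro pt_intros pt_comp[OF assms])

lemma ptp_tnat: "pt f \<Longrightarrow> ptp (\<lambda>v. tnat (f v))"
  unfolding tnat_def by (intro pt_intros)

lemma pt_tlast: "pt f \<Longrightarrow> pt (\<lambda>v. tlast (f v))"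
  unfolding tlast_def by (intro pt_intros)

lemma ptp_tgate_ok: assumes "pt f" "pt g" shows "ptp (\<lambda>v. tgate_ok (f v) (g v))"
  unfolding tgate_ok_def tgate_def
  by (intro pt_intros ptp_num_le_const ptp_num_ge_const ptp_tnat ptp_tdistinct pt_tpreds
      pt_comp[OF assms(1)] pt_comp[OF assms(2)])

lemma ptp_tchk: "pt f \<Longrightarrow> pt g \<Longrightarrow> ptp (\<lambda>v. tchk d b (f v) (g v))"
proof (induction d arbitrary: b f g)
  case 0
  then show ?case by (simp only: tchk.simps) (intro pt_intros)
next
  case (Suc d)
  have *: "pt (\<lambda>w. f (left w))" by (rule pt_comp[OF Suc.prems(1) pt_left[OF pt_id]])
  show ?case
    unfolding tchk.simps
    by (intro pt_intros ptp_tlarge pt_tpreds Suc.prems Suc.IH *)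
qed

lemma ptp_tvalid: assumes "pt f" shows "ptp (\<lambda>v. tvalid d (f v))"
  unfolding tvalid_def
  by (intro pt_intros ptp_tgate_ok ptp_tchk pt_tlast pt_comp[OF assms])

lemma enc_gate_simps [simp]:
  "enc_gate g \<noteq> Leaf"
  "left (enc_gate g) = Leaf \<longleftrightarrow> g = Inp"
  "elems (tpreds (enc_gate g)) = map enc_nat (preds g)"
  "tlarge (enc_gate g) = large g"
  "tgate (enc_gate g)"
  "2 \<le> num (left (enc_gate g)) \<longleftrightarrow> (\<exists>js. g = Conj js \<or> g = Disj js)"
  by (induct g, simp_all add: tpreds_def tlarge_def large_def tgate_def tnat_def numeral_eq_Suc Suc_le_eq)

lemma enc_gate_exists:
  assumes "tgate g" shows "\<exists>h. g = enc_gate h"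
proof -
  obtain a b where g: "g = Node a b" using assms by (cases g) (auto simp: tgate_def)
  have a: "a = enc_nat (num a)" and a3: "num a \<le> 3" and b: "a = Leaf \<longrightarrow> b = Leaf"
    and js: "\<forall>j \<in> set (elems (tpreds g)). j = enc_nat (num j)"
    using assms enc_nat_num by (auto simp: tgate_def tnat_def g)
  have list: "b = enc_list (map enc_nat (map num (elems b)))" if "2 \<le> num a"
  proof -
    have "tpreds g = b" using that by (auto simp: tpreds_def g)
    then have "map (\<lambda>j. enc_nat (num j)) (elems b) = elems b"
      using js by (intro map_idI) auto
    then show ?thesis by (simp add: comp_def)
  qed
  consider "a = enc_nat 0" | "a = enc_nat 1" | "a = enc_nat 2" | "a = enc_nat 3"
  proof -
    have "num a = 0 \<or> num a = 1 \<or> num a = 2 \<or> num a = 3" using a3 by linarith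
    then show thesis using that a by metis
  qed
  then show ?thesis
  proof cases
    case 1
    then show ?thesis using b g by (intro exI[of _ Inp]) simp
  next
    case 2
    then have "tpreds g = Node b Leaf" by (simp add: tpreds_def g)
    then have "b = enc_nat (num b)" using js by auto
    with 2 g have "g = enc_gate (Neg (num b))" by (metis enc_gate.simps(2))
    then show ?thesis by blast
  next
    case 3
    with list have "b = enc_list (map enc_nat (map num (elems b)))" by simp
    with 3 g have "g = enc_gate (Conj (map num (elems b)))" by (metis enc_gate.simps(3))
    then show ?thesis by blast
  next
    case 4
    with list have "b = enc_list (map enc_nat (map num (elems b)))" by simp
    with 4 g have "g = enc_gate (Disj (map num (elems b)))" by (metis enc_gate.simps(4))
    then show ?thesis by blast
  qed
qed

lemma elems_enc_circuit [simp]: "elems (enc_circuit C) = map enc_gate C"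
  by (simp add: enc_circuit_def)

lemma tlast_enc_circuit: "tlast (enc_circuit C) = enc_nat (length C - 1)"
proof (rule enc_nat_eqI)
  show "elems (tlast (enc_circuit C)) = replicate (length C - 1) Leaf"
    by (cases C) (simp_all add: tlast_def enc_circuit_def map_replicate_const)
qed

lemma tdistinct_iff: "tdistinct (enc_list (map enc_nat js)) \<longleftrightarrow> distinct js"
proof -
  have "tdistinct (enc_list (map enc_nat js)) \<longleftrightarrow>
    (\<forall>p < length js. \<forall>q < length js. p = q \<or> js ! p \<noteq> js ! q)"
    unfolding tdistinct_def by (simp add: atLeast0LessThan) (auto simp: lessThan_def)
  then show ?thesis unfolding distinct_conv_nth by blast
qed

lemma tgate_ok_enc_gate:
  "tgate_ok (enc_gate g) (enc_nat i) \<longleftrightarrow> distinct (preds g) \<and> (\<forall>j \<in> set (preds g). j < i) \<and>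
    (\<forall>js. g = Conj js \<or> g = Disj js \<longrightarrow> 2 \<le> length js)"
proof -
  have "tpreds (enc_gate g) = enc_list (map enc_nat (preds g))"
    by (simp flip: elems_eq_iff)
  then show ?thesis unfolding tgate_ok_def by (auto simp: tdistinct_iff)
qed

lemma tchk_enc_circuit:
  "wf_circuit C \<Longrightarrow> i < length C \<Longrightarrow> tchk d b (enc_circuit C) (enc_nat i) \<longleftrightarrow> chk d C b i"
proof (induction d arbitrary: b i)
  case (Suc d)
  have "j < length C" if "j \<in> set (preds (C ! i))" for j
    using wf_circuitD(2)[OF Suc.prems that] Suc.prems by simp
  then have "tchk d b' (enc_circuit C) (enc_nat j) \<longleftrightarrow> chk d C b' j" if "j \<in> set (preds (C ! i))" for j b'
    using Suc that by blast
  then show ?case using Suc.prems by simp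
qed simp

lemma tvalid_enc_circuit:
  "tvalid d (enc_circuit C) \<longleftrightarrow> wf_circuit C \<and> weft_at_most C 1 \<and> depth_at_most C d"
proof -
  have "enc_circuit C = Leaf \<longleftrightarrow> C = []" by (simp flip: elems_eq_Nil)
  then have wf: "wf_circuit C \<longleftrightarrow> enc_circuit C \<noteq> Leaf \<and>
      (\<forall>i \<in> set (elems (tidx (enc_circuit C))). tgate_ok (tnth (enc_circuit C) i) i)"
    by (auto simp: wf_circuit_def tgate_ok_enc_gate)
  show ?thesis
  proof (cases "wf_circuit C")
    case True
    then have "length C - 1 < length C" by (auto simp: wf_circuit_def)
    then have "tchk d 1 (enc_circuit C) (tlast (enc_circuit C)) \<longleftrightarrow> weft_at_most C 1 \<and> depth_at_most C d"
      unfolding tlast_enc_circuit by (simp only: tchk_enc_circuit[OF True] chk_output[OF True])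
    then show ?thesis using wf unfolding tvalid_def by blast
  qed (use wf in \<open>unfold tvalid_def, blast\<close>)
qed

lemma tvalidD: "tvalid d x \<Longrightarrow> \<exists>C. x = enc_circuit C"
proof -
  assume "tvalid d x"
  then have "\<forall>i < num x. tgate (elems x ! i)"
    unfolding tvalid_def tgate_ok_def by simp
  then have "\<forall>g \<in> set (elems x). \<exists>h. g = enc_gate h"
    using enc_gate_exists by (auto simp: in_set_conv_nth)
  then obtain C where "elems x = map enc_gate C"
    using ex_map_conv[of "elems x" enc_gate] by blast
  then show ?thesis by (metis enc_circuit_def enc_list_elems)
qed

section \<open>Polynomials in zero-one variables\<close>

text \<open>
  A polynomial is a list of monomials. A monomial is a pair of a sign (\<open>Leaf\<close> means plus) and a
  list of variables; variables are arbitrary trees, and \<open>S\<close> is the set of variables of value one.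
\<close>

definition mval :: "tree set \<Rightarrow> tree \<Rightarrow> int" where
  "mval S a = (if left a = Leaf then 1 else - 1) * of_bool (set (elems (right a)) \<subseteq> S)"

definition pval :: "tree set \<Rightarrow> tree \<Rightarrow> int" where
  "pval S p = (\<Sum>a\<leftarrow>elems p. mval S a)"

definition pvars :: "tree \<Rightarrow> tree set" where
  "pvars p = (\<Union>a \<in> set (elems p). set (elems (right a)))"

definition pdeg_le :: "nat \<Rightarrow> tree \<Rightarrow> bool" where
  "pdeg_le D p \<longleftrightarrow> (\<forall>a \<in> set (elems p). num (right a) \<le> D)"

definition pone :: tree where
  "pone = Node (Node Leaf Leaf) Leaf"

definition pvar :: "tree \<Rightarrow> tree" where
  "pvar x = Node (Node Leaf (Node x Leaf)) Leaf"

definition sneg :: "tree \<Rightarrow> tree" where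
  "sneg s = (if s = Leaf then Node Leaf Leaf else Leaf)"

definition pneg :: "tree \<Rightarrow> tree" where
  "pneg p = tmap (\<lambda>a. Node (sneg (left a)) (right a)) p"

definition pcompl :: "tree \<Rightarrow> tree" where
  "pcompl p = tapp pone (pneg p)"

definition mmul :: "tree \<Rightarrow> tree \<Rightarrow> tree" where
  "mmul a b = Node (if left a = Leaf then left b else sneg (left b)) (tapp (right a) (right b))"

definition pmul :: "tree \<Rightarrow> tree \<Rightarrow> tree" where
  "pmul p q = tconcat (tmap (\<lambda>a. tmap (\<lambda>b. mmul a b) q) p)"

definition psum :: "tree \<Rightarrow> tree" where
  "psum l = tmap (\<lambda>u. Node Leaf (Node u Leaf)) l"

text \<open>For \<open>c\<close> the number of variables of \<open>l\<close> in \<open>S\<close>, the value of \<open>pgroup l\<close> is \<open>c (2 - c)\<close>,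
  which is at most one, with equality only for \<open>c = 1\<close>.\<close>

definition pgroup :: "tree \<Rightarrow> tree" where
  "pgroup l = pmul (psum l) (tapp pone (pcompl (psum l)))"

lemma pval_Leaf [simp]: "pval S Leaf = 0"
  by (simp add: pval_def)

lemma pval_tapp [simp]: "pval S (tapp p q) = pval S p + pval S q"
  by (simp add: pval_def)

lemma pval_tconcat [simp]: "pval S (tconcat l) = (\<Sum>p\<leftarrow>elems l. pval S p)"
  by (induction l) (simp_all add: pval_def)

lemma pval_pone [simp]: "pval S pone = 1"
  by (simp add: pval_def mval_def pone_def)

lemma pval_pvar [simp]: "pval S (pvar x) = of_bool (x \<in> S)"
  by (simp add: pval_def mval_def pvar_def)

lemma pval_pneg [simp]: "pval S (pneg p) = - pval S p"
  by (induction p) (simp_all add: pval_def mval_def pneg_def sneg_def tmap_def)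

lemma pval_pcompl [simp]: "pval S (pcompl p) = 1 - pval S p"
  by (simp add: pcompl_def)

text \<open>Both variable lists lie in \<open>S\<close> iff their concatenation does. Repeated
  variables do no harm, as variables take only the values zero and one.\<close>

lemma mval_mmul: "mval S (mmul a b) = mval S a * mval S b"
  by (auto simp: mval_def mmul_def sneg_def)

lemma pval_pmul [simp]: "pval S (pmul p q) = pval S p * pval S q"
proof -
  have "(\<Sum>a\<leftarrow>xs. \<Sum>b\<leftarrow>ys. mval S (mmul a b)) = (\<Sum>a\<leftarrow>xs. mval S a) * (\<Sum>b\<leftarrow>ys. mval S b)" for xs ys
    by (induction xs) (simp_all add: mval_mmul sum_list_const_mult distrib_right)
  then show ?thesis by (simp add: pmul_def comp_def) (simp add: pval_def comp_def)
qed

lemma pval_psum: "distinct (elems l) \<Longrightarrow> pval S (psum l) = int (card (S \<inter> set (elems l)))"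
proof -
  have "distinct xs \<Longrightarrow> (\<Sum>u\<leftarrow>xs. of_bool (u \<in> S)) = int (card (S \<inter> set xs))" for xs
    by (induction xs) auto
  then show "distinct (elems l) \<Longrightarrow> ?thesis"
    by (simp add: pval_def psum_def mval_def comp_def)
qed

lemma pval_pgroup:
  "distinct (elems l) \<Longrightarrow> pval S (pgroup l) = 1 - (int (card (S \<inter> set (elems l))) - 1)\<^sup>2"
  by (simp add: pgroup_def pval_psum power2_eq_square algebra_simps)

lemma pvars_simps [simp]:
  "pvars Leaf = {}" "pvars pone = {}" "pvars (pvar x) = {x}" "pvars (pneg p) = pvars p"
  "pvars (pcompl p) = pvars p" "pvars (tapp p q) = pvars p \<union> pvars q"
  "pvars (tconcat l) = (\<Union>p \<in> set (elems l). pvars p)" "pvars (psum l) = set (elems l)"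
  by (auto simp: pvars_def pone_def pvar_def pneg_def pcompl_def psum_def)

lemma pvars_pmul: "pvars (pmul p q) \<subseteq> pvars p \<union> pvars q"
  by (auto simp: pvars_def pmul_def mmul_def)

lemma pvars_pgroup: "pvars (pgroup l) \<subseteq> set (elems l)"
  unfolding pgroup_def using pvars_pmul by fastforce

lemma pdeg_le_simps [simp]:
  "pdeg_le D Leaf" "pdeg_le D pone" "pdeg_le D (pvar x) \<longleftrightarrow> 1 \<le> D" "pdeg_le D (pneg p) \<longleftrightarrow> pdeg_le D p"
  "pdeg_le D (pcompl p) \<longleftrightarrow> pdeg_le D p" "pdeg_le D (tapp p q) \<longleftrightarrow> pdeg_le D p \<and> pdeg_le D q"
  "pdeg_le D (tconcat l) \<longleftrightarrow> (\<forall>p \<in> set (elems l). pdeg_le D p)" "pdeg_le (Suc 0) (psum l)"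
  by (auto simp: pdeg_le_def pone_def pvar_def pneg_def pcompl_def psum_def)

lemma pdeg_le_pmul: "pdeg_le D p \<Longrightarrow> pdeg_le E q \<Longrightarrow> pdeg_le (D + E) (pmul p q)"
  by (fastforce simp: pdeg_le_def pmul_def mmul_def)

lemma pdeg_le_mono: "pdeg_le D p \<Longrightarrow> D \<le> E \<Longrightarrow> pdeg_le E p"
  by (auto simp: pdeg_le_def)

lemma pdeg_le_pgroup: "pdeg_le 2 (pgroup l)"
proof -
  have "pdeg_le (Suc 0 + Suc 0) (pgroup l)"
    unfolding pgroup_def by (rule pdeg_le_pmul) simp_all
  then show ?thesis by (simp add: numeral_2_eq_2)
qed

lemma pt_pvar: "pt f \<Longrightarrow> pt (\<lambda>v. pvar (f v))"
  unfolding pvar_def by (intro pt_intros)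

lemma pt_pneg: "pt f \<Longrightarrow> pt (\<lambda>v. pneg (f v))"
  unfolding pneg_def sneg_def by (intro pt_intros)

lemma pt_pcompl: "pt f \<Longrightarrow> pt (\<lambda>v. pcompl (f v))"
  unfolding pcompl_def by (intro pt_intros pt_pneg)

lemma pt_pmul: assumes "pt f" "pt g" shows "pt (\<lambda>v. pmul (f v) (g v))"
  unfolding pmul_def mmul_def sneg_def by (intro pt_intros assms(1) pt_comp[OF assms(2)])

lemma pt_pgroup: "pt f \<Longrightarrow> pt (\<lambda>v. pgroup (f v))"
  unfolding pgroup_def psum_def by (intro pt_pmul pt_pcompl pt_intros)

section \<open>From circuits to polynomials\<close>

text \<open>
  In the polynomial of a node above large gates, the truth value of a large gate is expressed by the
  variable that names the gate: it stands for "all children are true" for a conjunction and for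
  "all children are false" for a disjunction. The number \<open>d\<close> is fuel for the recursion.
\<close>

primrec gpoly :: "nat \<Rightarrow> tree \<Rightarrow> tree \<Rightarrow> tree" where
  "gpoly 0 x i = Leaf"
| "gpoly (Suc d) x i =
    (if left (tnth x i) = Leaf then pvar i
     else if num (left (tnth x i)) = 1 then pcompl (gpoly d x (right (tnth x i)))
     else if tlarge (tnth x i) then
       (if num (left (tnth x i)) = 2 then pvar i else pcompl (pvar i))
     else if num (left (tnth x i)) = 2 then
       pmul (gpoly d x (left (right (tnth x i)))) (gpoly d x (left (right (right (tnth x i)))))
     else pcompl (pmul (pcompl (gpoly d x (left (right (tnth x i)))))
       (pcompl (gpoly d x (left (right (right (tnth x i))))))))"

text \<open>The large gates from which \<open>i\<close> is reached through small gates only.\<close>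

primrec trel :: "nat \<Rightarrow> tree \<Rightarrow> tree \<Rightarrow> tree" where
  "trel 0 x i = Leaf"
| "trel (Suc d) x i = (if tlarge (tnth x i) then Node i Leaf
    else tconcat (tmap (\<lambda>j. trel d x j) (tpreds (tnth x i))))"

text \<open>A gate reached along several routes occurs repeatedly in \<open>trel\<close>. Filtering
  the list of all positions lists it once, as is needed for one reward per gate.\<close>

definition trels :: "nat \<Rightarrow> tree \<Rightarrow> tree" where
  "trels d x = tfilter (\<lambda>i. \<exists>j \<in> set (elems (trel (Suc d) x (tlast x))). num i = num j) (tidx x)"

text \<open>The variable \<open>tz i j\<close> stands for the choice of a child \<open>j\<close> that witnesses that the statement
  expressed by the variable \<open>i\<close> is false.\<close>

definition tz :: "tree \<Rightarrow> tree \<Rightarrow> tree" where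
  "tz i j = Node (Node i j) Leaf"

definition tgroup :: "tree \<Rightarrow> tree \<Rightarrow> tree" where
  "tgroup x i = Node i (tmap (\<lambda>j. tz i j) (tpreds (tnth x i)))"

text \<open>The polynomial of "child \<open>j\<close> does not decide gate \<open>i\<close>": the
  child is true for a conjunction, false for a disjunction.\<close>

definition tchild :: "nat \<Rightarrow> tree \<Rightarrow> tree \<Rightarrow> tree \<Rightarrow> tree" where
  "tchild d x i j = (if num (left (tnth x i)) = 2 then gpoly (Suc d) x j else pcompl (gpoly (Suc d) x j))"

text \<open>The reward of the large gate \<open>i\<close>. The group term asks for exactly one
  chosen variable of the gate; choosing \<open>i\<close> costs 1 for every deciding child, choosing
  \<open>tz i j\<close> costs 1 if \<open>j\<close> does not decide.\<close>

definition tcon :: "nat \<Rightarrow> tree \<Rightarrow> tree \<Rightarrow> tree" where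
  "tcon d x i = tapp (pgroup (tgroup x i)) (tconcat (tmap (\<lambda>j.
    pneg (tapp (pmul (pvar i) (pcompl (tchild d x i j))) (pmul (pvar (tz i j)) (tchild d x i j))))
    (tpreds (tnth x i))))"

definition tscore :: "nat \<Rightarrow> tree \<Rightarrow> tree" where
  "tscore d x = tapp (gpoly (Suc d) x (tlast x)) (tconcat (tmap (\<lambda>i. tcon d x i) (trels d x)))"

definition tinputs :: "tree \<Rightarrow> tree" where
  "tinputs x = tfilter (\<lambda>i. left (tnth x i) = Leaf) (tidx x)"

definition tuniv :: "nat \<Rightarrow> tree \<Rightarrow> tree" where
  "tuniv d x = tapp (tinputs x) (tconcat (tmap (\<lambda>i. tgroup x i) (trels d x)))"

text \<open>The fuel \<open>d\<close> is a constant, so the branching recursion unfolds into a fixed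
  composition of polynomial-time functions.\<close>

lemma pt_gpoly: "pt f \<Longrightarrow> pt g \<Longrightarrow> pt (\<lambda>v. gpoly d (f v) (g v))"
proof (induction d arbitrary: f g)
  case (Suc d)
  show ?case
    unfolding gpoly.simps
    by (intro pt_If ptp_eq_Leaf ptp_num_eq_const ptp_tlarge pt_left pt_right pt_tnth pt_pvar pt_pcompl
        pt_pmul Suc.IH Suc.prems)
qed (simp add: pt_Leaf)

lemma pt_trel: "pt f \<Longrightarrow> pt g \<Longrightarrow> pt (\<lambda>v. trel d (f v) (g v))"
proof (induction d arbitrary: f g)
  case (Suc d)
  have *: "pt (\<lambda>w. f (left w))" by (rule pt_comp[OF Suc.prems(1) pt_left[OF pt_id]])
  show ?case
    unfolding trel.simps
    by (intro pt_intros ptp_tlarge pt_tpreds Suc.IH Suc.prems *)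
qed (simp add: pt_Leaf)

lemma pt_trels: assumes "pt f" shows "pt (\<lambda>v. trels d (f v))"
  unfolding trels_def by (intro pt_intros pt_trel pt_tlast pt_comp[OF assms])

lemma pt_tz: "pt f \<Longrightarrow> pt g \<Longrightarrow> pt (\<lambda>v. tz (f v) (g v))"
  unfolding tz_def by (intro pt_intros)

lemma pt_tgroup: assumes "pt f" "pt g" shows "pt (\<lambda>v. tgroup (f v) (g v))"
  unfolding tgroup_def
  by (intro pt_intros pt_tz pt_tpreds assms(1) pt_comp[OF assms(2)])

lemma pt_tchild: "pt f \<Longrightarrow> pt g \<Longrightarrow> pt h \<Longrightarrow> pt (\<lambda>v. tchild d (f v) (g v) (h v))"
  unfolding tchild_def by (intro pt_If ptp_num_eq_const pt_left pt_tnth pt_gpoly pt_pcompl)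

lemma pt_tcon: assumes "pt f" "pt g" shows "pt (\<lambda>v. tcon d (f v) (g v))"
  unfolding tcon_def
  by (intro pt_tapp pt_pgroup pt_tgroup pt_tconcat pt_tmap pt_pneg pt_pmul pt_pvar pt_tz pt_pcompl
      pt_tchild pt_tpreds pt_tnth pt_left pt_right pt_id pt_comp[OF assms(1)] pt_comp[OF assms(2)])

lemma pt_tscore: assumes "pt f" shows "pt (\<lambda>v. tscore d (f v))"
  unfolding tscore_def
  by (intro pt_tapp pt_gpoly pt_tlast pt_tconcat pt_tmap pt_tcon pt_trels pt_right pt_left pt_id
      pt_comp[OF assms])

lemma pt_tinputs: assumes "pt f" shows "pt (\<lambda>v. tinputs (f v))"
  unfolding tinputs_def by (intro pt_intros pt_comp[OF assms])

lemma pt_tuniv: assumes "pt f" shows "pt (\<lambda>v. tuniv d (f v))"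
  unfolding tuniv_def
  by (intro pt_tapp pt_tinputs pt_tconcat pt_tmap pt_tgroup pt_trels pt_right pt_left pt_id
      pt_comp[OF assms])

text \<open>Holds for every \<open>S\<close>, even one whose gate variables are wrong, and so caps
  the contribution of the output at 1.\<close>

lemma pval_gpoly: "pval S (gpoly d x i) = 0 \<or> pval S (gpoly d x i) = 1"
proof (induction d arbitrary: i)
  case (Suc d)
  define Z where "Z a \<longleftrightarrow> a = 0 \<or> a = 1" for a :: int
  have Z: "Z a \<Longrightarrow> Z b \<Longrightarrow> Z (a * b)" "Z a \<Longrightarrow> Z (1 - a)" "Z (of_bool P)" for a b P
    by (auto simp: Z_def)
  have "Z (pval S (gpoly d x j))" for j using Suc.IH by (simp add: Z_def)
  then have "Z (pval S (gpoly (Suc d) x i))" by (simp add: Z)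
  then show ?case by (simp only: Z_def)
qed simp

text \<open>A small gate multiplies at most two polynomials, so the degree at most doubles per
  level.\<close>

lemma pdeg_le_gpoly: "pdeg_le (2 ^ d) (gpoly d x i)"
proof (induction d arbitrary: i)
  case (Suc d)
  have mono: "pdeg_le (2 ^ d) p \<Longrightarrow> pdeg_le (2 ^ Suc d) p" for p
    by (erule pdeg_le_mono) simp
  have mul: "pdeg_le (2 ^ d) p \<Longrightarrow> pdeg_le (2 ^ d) q \<Longrightarrow> pdeg_le (2 ^ Suc d) (pmul p q)" for p q
    using pdeg_le_pmul[of "2 ^ d" p "2 ^ d" q] by (simp add: mult_2)
  show ?case
    unfolding gpoly.simps if_distrib[of "pdeg_le (2 ^ Suc d)"] pdeg_le_simps
    using Suc.IH mono mul by simp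
qed simp

text \<open>The search stops at large gates and otherwise branches at most twice per level. This
  bounds the growth of the parameter.\<close>

lemma num_trel_le: "num (trel d x i) \<le> 2 ^ d"
proof (induction d arbitrary: i)
  case (Suc d)
  show ?case
  proof (cases "tlarge (tnth x i)")
    case False
    then obtain js where js: "elems (tpreds (tnth x i)) = js" "length js \<le> 2"
      by (simp add: tlarge_def)
    have "(\<Sum>j\<leftarrow>js. num (trel d x j)) \<le> (\<Sum>j\<leftarrow>js. 2 ^ d)"
      by (rule sum_list_mono) (rule Suc.IH)
    also have "\<dots> \<le> 2 * 2 ^ d" using js(2) by (simp add: sum_list_triv)
    finally show ?thesis using False js(1) by (simp add: length_concat comp_def)
  qed simp
qed simp

section \<open>The polynomials of an encoded circuit\<close>

definition isconj :: "gate \<Rightarrow> bool" where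
  "isconj g \<longleftrightarrow> (\<exists>js. g = Conj js)"

lemma num_left_enc_gate [simp]:
  "num (left (enc_gate g)) = Suc 0 \<longleftrightarrow> (\<exists>j. g = Neg j)"
  "num (left (enc_gate g)) = 2 \<longleftrightarrow> isconj g"
  by (induct g, simp_all add: isconj_def numeral_eq_Suc)

lemma right_enc_gate [simp]:
  "right (enc_gate (Neg j)) = enc_nat j"
  "right (enc_gate (Conj js)) = enc_list (map enc_nat js)"
  "right (enc_gate (Disj js)) = enc_list (map enc_nat js)"
  by simp_all

declare enc_gate.simps [simp del] gpoly.simps(2) [simp del] trel.simps(2) [simp del]

text \<open>The statement that the variable of the large gate \<open>l\<close> stands for:
  \<open>isconj (C ! l)\<close> is the value of a child that does not decide the gate.\<close>

definition lit :: "circuit \<Rightarrow> nat set \<Rightarrow> nat \<Rightarrow> bool" where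
  "lit C A l \<longleftrightarrow> (\<forall>j \<in> set (preds (C ! l)). node_vals A C ! j \<longleftrightarrow> isconj (C ! l))"

lemma gpoly_enc:
  assumes "wf_circuit C" "i < length C"
  shows "C ! i = Inp \<Longrightarrow> gpoly (Suc e) (enc_circuit C) (enc_nat i) = pvar (enc_nat i)"
    "C ! i = Neg j \<Longrightarrow> gpoly (Suc e) (enc_circuit C) (enc_nat i) = pcompl (gpoly e (enc_circuit C) (enc_nat j))"
    "large (C ! i) \<Longrightarrow> gpoly (Suc e) (enc_circuit C) (enc_nat i) =
      (if isconj (C ! i) then pvar (enc_nat i) else pcompl (pvar (enc_nat i)))"
    "C ! i = Conj [a, b] \<Longrightarrow> gpoly (Suc e) (enc_circuit C) (enc_nat i) =
      pmul (gpoly e (enc_circuit C) (enc_nat a)) (gpoly e (enc_circuit C) (enc_nat b))"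
    "C ! i = Disj [a, b] \<Longrightarrow> gpoly (Suc e) (enc_circuit C) (enc_nat i) =
      pcompl (pmul (pcompl (gpoly e (enc_circuit C) (enc_nat a))) (pcompl (gpoly e (enc_circuit C) (enc_nat b))))"
  using assms(2) by (simp_all add: gpoly.simps(2)) (auto simp: isconj_def large_def)

lemma small_gate_cases:
  assumes "wf_circuit C" "i < length C" "\<not> large (C ! i)"
  obtains "C ! i = Inp" | j where "C ! i = Neg j" | a b where "C ! i = Conj [a, b]"
    | a b where "C ! i = Disj [a, b]"
proof -
  have two: "\<exists>a b. js = [a, b]" if "C ! i = Conj js \<or> C ! i = Disj js" for js
  proof -
    have "length js = 2"
      using that assms(3) wf_circuitD(3)[OF assms(1,2) that] by (auto simp: large_def)
    then show ?thesis by (auto simp: length_Suc_conv numeral_2_eq_2)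
  qed
  show ?thesis
    by (cases "C ! i") (use two that in blast)+
qed

lemma node_vals_large:
  assumes "wf_circuit C" "i < length C" "large (C ! i)"
  shows "node_vals A C ! i \<longleftrightarrow> (lit C A i \<longleftrightarrow> isconj (C ! i))"
  using node_vals_simps[OF assms(1,2)] assms(3)
  by (cases "C ! i") (auto simp: lit_def isconj_def large_def)

lemma trel_enc:
  assumes "i < length C"
  shows "elems (trel (Suc e) (enc_circuit C) (enc_nat i)) = (if large (C ! i) then [enc_nat i]
    else concat (map (\<lambda>j. elems (trel e (enc_circuit C) (enc_nat j))) (preds (C ! i))))"
  using assms by (simp add: trel.simps(2) comp_def)

text \<open>The first large gate on the way down uses up the budget 1, so its children are left with
  budget 0.\<close>

lemma trel_props:
  assumes wf: "wf_circuit C" and "chk e C 1 i" "i < length C"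
    and "t \<in> set (elems (trel (Suc e) (enc_circuit C) (enc_nat i)))"
  shows "\<exists>l < length C. t = enc_nat l \<and> large (C ! l) \<and> (\<forall>j \<in> set (preds (C ! l)). chk e C 0 j)"
  using assms(2-)
proof (induction e arbitrary: i)
  case 0
  then show ?case by (simp add: trel_enc large_def)
next
  case (Suc e)
  note lt = wf_circuitD(2)[OF wf Suc.prems(2)]
  show ?case
  proof (cases "large (C ! i)")
    case True
    then have "\<forall>j \<in> set (preds (C ! i)). chk e C 0 j" "t = enc_nat i"
      using Suc.prems by (auto simp: trel_enc large_def)
    moreover have "chk (Suc e) C 0 j" if "j \<in> set (preds (C ! i))" "chk e C 0 j" for j
      by (rule chk_mono[OF wf _ that(2)]) (use lt[OF that(1)] Suc.prems(2) in simp_all)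
    ultimately show ?thesis using True Suc.prems(2) by blast
  next
    case False
    then obtain j where j: "j \<in> set (preds (C ! i))"
      "t \<in> set (elems (trel (Suc e) (enc_circuit C) (enc_nat j)))"
      using Suc.prems(3) by (auto simp: trel_enc[OF Suc.prems(2)])
    moreover have "chk e C 1 j" using Suc.prems(1) j(1) False by auto
    moreover have "j < length C" using lt[OF j(1)] Suc.prems(2) by simp
    ultimately obtain l where l: "l < length C" "t = enc_nat l" "large (C ! l)"
      "\<forall>j \<in> set (preds (C ! l)). chk e C 0 j"
      using Suc.IH by blast
    moreover have "chk (Suc e) C 0 j" if "j \<in> set (preds (C ! l))" for j
      by (rule chk_mono[OF wf _ l(4)[rule_format, OF that]])
        (use wf_circuitD(2)[OF wf l(1) that] l(1) in simp_all)
    ultimately show ?thesis by blast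
  qed
qed

text \<open>With budget 0 there is no large gate below \<open>i\<close>, hence the polynomial of
  \<open>i\<close> involves inputs only.\<close>

lemma trel_flat:
  "wf_circuit C \<Longrightarrow> chk e C 0 i \<Longrightarrow> i < length C \<Longrightarrow> trel (Suc e) (enc_circuit C) (enc_nat i) = Leaf"
proof (induction e arbitrary: i)
  case 0
  then show ?case by (simp add: trel_enc large_def flip: elems_eq_Nil)
next
  case (Suc e)
  show ?case
  proof (cases "C ! i = Inp")
    case True
    then show ?thesis using Suc.prems by (simp add: trel_enc large_def flip: elems_eq_Nil)
  next
    case False
    then have "\<not> large (C ! i)" "\<forall>j \<in> set (preds (C ! i)). chk e C 0 j"
      using Suc.prems(2) by auto
    moreover have "j < length C" if "j \<in> set (preds (C ! i))" for j
      using wf_circuitD(2)[OF Suc.prems(1,3) that] Suc.prems(3) by simp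
    ultimately have "elems (trel (Suc (Suc e)) (enc_circuit C) (enc_nat i)) = []"
      using Suc.IH[OF Suc.prems(1)] trel_enc[OF Suc.prems(3), of "Suc e"] by simp
    then show ?thesis by (simp only: elems_eq_Nil)
  qed
qed

text \<open>Truthful variables are required only for the large gates at which the recursion stops.
  Depth \<open>e\<close> takes fuel \<open>Suc e\<close>, as an input node already consumes one
  unit.\<close>

lemma pval_gpoly_enc:
  assumes wf: "wf_circuit C" and "chk e C b i" "i < length C"
    and inp: "\<And>a. a \<in> inputs C \<Longrightarrow> enc_nat a \<in> S \<longleftrightarrow> a \<in> A"
    and "\<And>l. enc_nat l \<in> set (elems (trel (Suc e) (enc_circuit C) (enc_nat i))) \<Longrightarrow>
      enc_nat l \<in> S \<longleftrightarrow> lit C A l"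
  shows "pval S (gpoly (Suc e) (enc_circuit C) (enc_nat i)) = of_bool (node_vals A C ! i)"
  using assms(2,3,5)
proof (induction e arbitrary: b i)
  case 0
  then show ?case
    using inp[of i] by (simp add: gpoly_enc[OF wf] node_vals_simps[OF wf] inputs_def)
next
  case (Suc e)
  show ?case
  proof (cases "large (C ! i)")
    case True
    then have "enc_nat i \<in> S \<longleftrightarrow> lit C A i"
      using Suc.prems(2,3) trel_enc[of i C "Suc e"] by simp
    with True Suc.prems(2) show ?thesis
      by (simp add: gpoly_enc[OF wf] node_vals_large[OF wf])
  next
    case False
    have IH: "pval S (gpoly (Suc e) (enc_circuit C) (enc_nat j)) = of_bool (node_vals A C ! j)"
      if "j \<in> set (preds (C ! i))" for j
    proof (rule Suc.IH)
      show "chk e C b j" using Suc.prems(1) False that by auto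
      show "j < length C" using wf_circuitD(2)[OF wf Suc.prems(2) that] Suc.prems(2) by simp
      show "enc_nat l \<in> S \<longleftrightarrow> lit C A l"
        if "enc_nat l \<in> set (elems (trel (Suc e) (enc_circuit C) (enc_nat j)))" for l
        using that \<open>j \<in> _\<close> False by (intro Suc.prems(3)) (auto simp: trel_enc[OF Suc.prems(2)])
    qed
    show ?thesis
      using wf Suc.prems(2) False
    proof (cases rule: small_gate_cases)
      case 1
      then show ?thesis
        using inp[of i] Suc.prems(2)
        by (simp add: gpoly_enc[OF wf] node_vals_simps[OF wf] inputs_def)
    qed (use IH Suc.prems(2) in \<open>simp_all add: gpoly_enc[OF wf] node_vals_simps[OF wf] del: gpoly.simps\<close>)
  qed
qed

lemma pvars_gpoly_enc:
  assumes wf: "wf_circuit C" and "chk e C b i" "i < length C"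
  shows "pvars (gpoly (Suc e) (enc_circuit C) (enc_nat i)) \<subseteq>
    enc_nat ` inputs C \<union> set (elems (trel (Suc e) (enc_circuit C) (enc_nat i)))"
  using assms(2-)
proof (induction e arbitrary: b i)
  case 0
  then show ?case by (simp add: gpoly_enc[OF wf] inputs_def)
next
  case (Suc e)
  show ?case
  proof (cases "large (C ! i)")
    case True
    with Suc.prems(2) show ?thesis
      by (simp add: gpoly_enc[OF wf] trel_enc)
  next
    case False
    have IH: "pvars (gpoly (Suc e) (enc_circuit C) (enc_nat j)) \<subseteq>
      enc_nat ` inputs C \<union> set (elems (trel (Suc (Suc e)) (enc_circuit C) (enc_nat i)))"
      if "j \<in> set (preds (C ! i))" for j
    proof -
      have "chk e C b j" using Suc.prems(1) False that by auto
      moreover have "j < length C" using wf_circuitD(2)[OF wf Suc.prems(2) that] Suc.prems(2) by simp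
      ultimately have "pvars (gpoly (Suc e) (enc_circuit C) (enc_nat j)) \<subseteq>
        enc_nat ` inputs C \<union> set (elems (trel (Suc e) (enc_circuit C) (enc_nat j)))"
        by (rule Suc.IH)
      with False that show ?thesis
        unfolding trel_enc[OF Suc.prems(2)] by auto
    qed
    show ?thesis
      using wf Suc.prems(2) False
    proof (cases rule: small_gate_cases)
      case 1
      then show ?thesis
        using Suc.prems(2) by (simp add: gpoly_enc[OF wf] inputs_def)
    next
      case (3 a b)
      have "pvars (gpoly (Suc (Suc e)) (enc_circuit C) (enc_nat i)) \<subseteq>
        pvars (gpoly (Suc e) (enc_circuit C) (enc_nat a)) \<union> pvars (gpoly (Suc e) (enc_circuit C) (enc_nat b))"
        unfolding gpoly_enc(4)[OF wf Suc.prems(2) 3] by (rule pvars_pmul)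
      with IH[of a] IH[of b] 3 show ?thesis by simp blast
    next
      case (4 a b)
      have "pvars (gpoly (Suc (Suc e)) (enc_circuit C) (enc_nat i)) \<subseteq>
        pvars (gpoly (Suc e) (enc_circuit C) (enc_nat a)) \<union> pvars (gpoly (Suc e) (enc_circuit C) (enc_nat b))"
        unfolding gpoly_enc(5)[OF wf Suc.prems(2) 4] pvars_simps(5)
        by (rule order_trans[OF pvars_pmul]) simp
      with IH[of a] IH[of b] 4 show ?thesis by simp blast
    qed (use IH Suc.prems(2) in \<open>simp_all add: gpoly_enc[OF wf] del: gpoly.simps trel.simps\<close>)
  qed
qed

text \<open>A numeral has only leaves as entries, whereas the single entry of \<open>tz i j\<close>
  is a node; so witness variables never clash with inputs or gates.\<close>

lemma enc_nat_neq_tz [simp]: "enc_nat m \<noteq> tz i j" "tz i j \<noteq> enc_nat m"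
  by (cases m; simp add: tz_def)+

lemma tz_inject [simp]: "tz i j = tz i' j' \<longleftrightarrow> i = i' \<and> j = j'"
  by (simp add: tz_def)

lemma inj_enc_nat: "inj_on enc_nat A"
  by (auto simp: inj_on_def)

lemma sum_list_le_length:
  "(\<And>x. x \<in> set xs \<Longrightarrow> f x \<le> (1::int)) \<Longrightarrow> (\<Sum>x\<leftarrow>xs. f x) \<le> int (length xs)"
  by (induction xs) (simp, fastforce)

lemma sum_list_eq_length:
  "(\<And>x. x \<in> set xs \<Longrightarrow> f x \<le> (1::int)) \<Longrightarrow> int (length xs) \<le> (\<Sum>x\<leftarrow>xs. f x) \<Longrightarrow>
    x \<in> set xs \<Longrightarrow> f x = 1"
proof (induction xs)
  case (Cons y ys)
  have ys: "(\<Sum>x\<leftarrow>ys. f x) \<le> int (length ys)"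
    by (rule sum_list_le_length) (use Cons.prems(1) in simp)
  have y: "f y \<le> 1" using Cons.prems(1) by simp
  show ?case
  proof (cases "x = y")
    case True
    then show ?thesis using Cons.prems(2) ys y by simp
  next
    case False
    have "int (length ys) \<le> (\<Sum>x\<leftarrow>ys. f x)" using Cons.prems(2) y by simp
    with False Cons.prems show ?thesis by (intro Cons.IH) auto
  qed
qed simp

section \<open>Scores of variable sets for a circuit of weft one\<close>

locale weft_one =
  fixes C :: circuit and d :: nat
  assumes wf: "wf_circuit C" and chk: "chk d C 1 (length C - 1)"
begin

abbreviation x :: tree where
  "x \<equiv> enc_circuit C"

definition rl :: "nat list" where
  "rl = filter (\<lambda>i. enc_nat i \<in> set (elems (trel (Suc d) x (enc_nat (length C - 1))))) [0..<length C]"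

definition ip :: "nat list" where
  "ip = filter (\<lambda>i. C ! i = Inp) [0..<length C]"

definition grp :: "nat \<Rightarrow> tree list" where
  "grp l = enc_nat l # map (\<lambda>j. tz (enc_nat l) (enc_nat j)) (preds (C ! l))"

definition inp :: "tree set \<Rightarrow> nat set" where
  "inp S = {a \<in> inputs C. enc_nat a \<in> S}"

definition ok :: "tree set \<Rightarrow> nat \<Rightarrow> bool" where
  "ok S l \<longleftrightarrow> card (S \<inter> set (grp l)) = 1 \<and> (\<forall>j \<in> set (preds (C ! l)).
    (enc_nat l \<in> S \<longrightarrow> node_vals (inp S) C ! j = isconj (C ! l)) \<and>
    (tz (enc_nat l) (enc_nat j) \<in> S \<longrightarrow> node_vals (inp S) C ! j \<noteq> isconj (C ! l)))"

lemma out_less: "length C - 1 < length C"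
  using wf by (auto simp: wf_circuit_def)

lemma set_ip: "set ip = inputs C" and distinct_ip: "distinct ip"
  by (auto simp: ip_def inputs_def)

lemma distinct_rl: "distinct rl"
  by (simp add: rl_def)

lemma trel_out: "t \<in> set (elems (trel (Suc d) x (enc_nat (length C - 1)))) \<Longrightarrow>
    \<exists>l \<in> set rl. t = enc_nat l \<and> large (C ! l) \<and> (\<forall>j \<in> set (preds (C ! l)). chk d C 0 j)"
  using trel_props[OF wf chk out_less] by (fastforce simp: rl_def)

lemma rl_props:
  assumes "l \<in> set rl"
  shows "l < length C" "large (C ! l)" "j \<in> set (preds (C ! l)) \<Longrightarrow> chk d C 0 j"
    "j \<in> set (preds (C ! l)) \<Longrightarrow> j < length C" "distinct (preds (C ! l))" "l \<notin> inputs C"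
proof -
  show l: "l < length C" using assms by (simp add: rl_def)
  have "enc_nat l \<in> set (elems (trel (Suc d) x (enc_nat (length C - 1))))"
    using assms by (simp add: rl_def)
  from trel_out[OF this] show "large (C ! l)" "j \<in> set (preds (C ! l)) \<Longrightarrow> chk d C 0 j" by auto
  then show "l \<notin> inputs C" by (auto simp: inputs_def large_def)
  show "j \<in> set (preds (C ! l)) \<Longrightarrow> j < length C" using wf_circuitD(2)[OF wf l] l by fastforce
  show "distinct (preds (C ! l))" by (rule wf_circuitD(1)[OF wf l])
qed

lemma length_rl: "length rl \<le> 2 ^ Suc d"
proof -
  have "length rl = card (enc_nat ` set rl)"
    by (simp add: card_image[OF inj_enc_nat] distinct_card[OF distinct_rl])
  also have "\<dots> \<le> card (set (elems (trel (Suc d) x (enc_nat (length C - 1)))))"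
    by (intro card_mono) (auto simp: rl_def)
  also have "\<dots> \<le> 2 ^ Suc d"
    using card_length num_trel_le order_trans by blast
  finally show ?thesis .
qed

lemma elems_trels: "elems (trels d x) = map enc_nat rl"
proof -
  \<comment> \<open>Comparing by \<open>num\<close> is as good as equality because all entries of
    \<open>trel\<close> are unary numerals here.\<close>
  have "(\<exists>j \<in> set (elems (trel (Suc d) x (enc_nat (length C - 1)))). i = num j) \<longleftrightarrow>
    enc_nat i \<in> set (elems (trel (Suc d) x (enc_nat (length C - 1))))" for i
  proof
    assume "\<exists>j \<in> set (elems (trel (Suc d) x (enc_nat (length C - 1)))). i = num j"
    then obtain j where j: "j \<in> set (elems (trel (Suc d) x (enc_nat (length C - 1))))" "i = num j" by blast
    with trel_out[OF j(1)] show "enc_nat i \<in> set (elems (trel (Suc d) x (enc_nat (length C - 1))))" by auto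
  next
    assume "enc_nat i \<in> set (elems (trel (Suc d) x (enc_nat (length C - 1))))"
    then show "\<exists>j \<in> set (elems (trel (Suc d) x (enc_nat (length C - 1)))). i = num j"
      by (rule bexI[rotated]) simp
  qed
  then show ?thesis
    by (simp add: trels_def tlast_enc_circuit rl_def filter_map comp_def)
qed

lemma elems_tinputs: "elems (tinputs x) = map enc_nat ip"
proof -
  have "filter (\<lambda>i. left (tnth x (enc_nat i)) = Leaf) [0..<length C] = ip"
    unfolding ip_def by (rule filter_cong) auto
  then show ?thesis by (simp add: tinputs_def filter_map comp_def)
qed

lemma tpreds_node: "l < length C \<Longrightarrow> elems (tpreds (tnth x (enc_nat l))) = map enc_nat (preds (C ! l))"
  by simp

lemma elems_tgroup: "l < length C \<Longrightarrow> elems (tgroup x (enc_nat l)) = grp l"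
  by (simp add: tgroup_def grp_def)

lemma elems_tuniv: "elems (tuniv d x) = map enc_nat ip @ concat (map grp rl)"
  by (simp add: tuniv_def elems_tinputs elems_trels elems_tgroup rl_props(1) cong: map_cong)

lemma distinct_grp: "l \<in> set rl \<Longrightarrow> distinct (grp l)"
  by (auto simp: grp_def distinct_map inj_on_def rl_props)

lemma grp_disjoint: "l \<noteq> l' \<Longrightarrow> set (grp l) \<inter> set (grp l') = {}"
  by (auto simp: grp_def)

lemma grp_eq: "y \<in> set (grp l) \<Longrightarrow> y \<in> set (grp l') \<Longrightarrow> l = l'"
  using grp_disjoint by blast

lemma enc_nat_in_grp: "enc_nat a \<in> set (grp l) \<longleftrightarrow> a = l"
  by (auto simp: grp_def)

lemma distinct_tuniv: "distinct (elems (tuniv d x))"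
proof -
  have "inj_on grp (set rl)"
    by (auto simp: inj_on_def grp_def)
  moreover have "set (map enc_nat ip) \<inter> set (concat (map grp rl)) = {}"
    using rl_props(6) by (auto simp: enc_nat_in_grp set_ip)
  ultimately show ?thesis
    by (auto simp: elems_tuniv distinct_map inj_enc_nat distinct_ip distinct_rl distinct_grp
        intro!: distinct_concat dest: grp_eq)
qed

text \<open>Nothing large lies below a large gate, so the value depends only on the inputs in
  \<open>S\<close> and is right for arbitrary choices of gate variables.\<close>

lemma pval_tchild:
  assumes l: "l \<in> set rl" and j: "j \<in> set (preds (C ! l))"
  shows "pval S (tchild d x (enc_nat l) (enc_nat j)) = of_bool (node_vals (inp S) C ! j = isconj (C ! l))"
proof -
  have flat: "chk d C 0 j" and len: "j < length C" using rl_props[OF l] j by auto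
  have "pval S (gpoly (Suc d) x (enc_nat j)) = of_bool (node_vals (inp S) C ! j)"
    by (rule pval_gpoly_enc[OF wf flat len]) (simp_all add: inp_def trel_flat[OF wf flat len])
  then show ?thesis using rl_props(1)[OF l] by (simp add: tchild_def)
qed

text \<open>The value is \<open>1 - c - s\<close>, where \<open>c\<close> is the squared deviation
  of the group from one chosen variable and \<open>s\<close> counts false claims; both are
  nonnegative, and \<open>ok\<close> says that both vanish.\<close>

lemma pval_tcon:
  assumes l: "l \<in> set rl"
  shows "pval S (tcon d x (enc_nat l)) \<le> 1" "pval S (tcon d x (enc_nat l)) = 1 \<longleftrightarrow> ok S l"
proof -
  define r where "r j = (of_bool (node_vals (inp S) C ! j = isconj (C ! l)) :: int)" for j
  define f where "f j = of_bool (enc_nat l \<in> S) * (1 - r j) + of_bool (tz (enc_nat l) (enc_nat j) \<in> S) * r j" for j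
  define s where "s = (\<Sum>j\<leftarrow>preds (C ! l). f j)"
  define c where "c = (int (card (S \<inter> set (grp l))) - 1)\<^sup>2"
  have "(\<Sum>j\<leftarrow>preds (C ! l). pval S (pneg (tapp (pmul (pvar (enc_nat l)) (pcompl (tchild d x (enc_nat l) (enc_nat j))))
      (pmul (pvar (tz (enc_nat l) (enc_nat j))) (tchild d x (enc_nat l) (enc_nat j)))))) = (\<Sum>j\<leftarrow>preds (C ! l). - f j)"
    by (rule arg_cong[of _ _ sum_list], rule map_cong[OF refl]) (simp add: pval_tchild[OF l] f_def r_def)
  also have "\<dots> = - s" unfolding s_def by (induction "preds (C ! l)") (simp_all add: uminus_sum_list_map comp_def)
  finally have val: "pval S (tcon d x (enc_nat l)) = 1 - c - s"
    using rl_props(1)[OF l] distinct_grp[OF l]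
    by (simp add: tcon_def pval_pgroup elems_tgroup c_def comp_def)
  have f: "0 \<le> f j" for j by (simp add: f_def r_def)
  have s: "0 \<le> s" unfolding s_def by (rule sum_list_nonneg) (auto simp: f)
  have c: "0 \<le> c" by (simp add: c_def)
  show "pval S (tcon d x (enc_nat l)) \<le> 1" using val s c by simp
  have "pval S (tcon d x (enc_nat l)) = 1 \<longleftrightarrow> c = 0 \<and> s = 0" using val s c by linarith
  moreover have "s = 0 \<longleftrightarrow> (\<forall>j \<in> set (preds (C ! l)). f j = 0)"
    unfolding s_def by (subst sum_list_nonneg_eq_0_iff) (auto simp: f)
  moreover have "f j = 0 \<longleftrightarrow> (enc_nat l \<in> S \<longrightarrow> node_vals (inp S) C ! j = isconj (C ! l)) \<and>
    (tz (enc_nat l) (enc_nat j) \<in> S \<longrightarrow> node_vals (inp S) C ! j \<noteq> isconj (C ! l))" for j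
    by (simp add: f_def r_def)
  moreover have "c = 0 \<longleftrightarrow> card (S \<inter> set (grp l)) = 1" by (simp add: c_def)
  ultimately show "pval S (tcon d x (enc_nat l)) = 1 \<longleftrightarrow> ok S l" unfolding ok_def by blast
qed

text \<open>If \<open>l\<close> is not chosen, the one chosen variable of its group names a child
  that decides the gate, which refutes the statement.\<close>

lemma ok_lit:
  assumes "ok S l" shows "enc_nat l \<in> S \<longleftrightarrow> lit C (inp S) l"
proof
  show "enc_nat l \<in> S \<Longrightarrow> lit C (inp S) l" using assms by (auto simp: ok_def lit_def)
  show "enc_nat l \<in> S" if "lit C (inp S) l"
  proof (rule ccontr)
    assume "enc_nat l \<notin> S"
    have "S \<inter> set (grp l) \<noteq> {}" using assms by (auto simp: ok_def)
    with \<open>enc_nat l \<notin> S\<close> obtain j where "j \<in> set (preds (C ! l))" "tz (enc_nat l) (enc_nat j) \<in> S"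
      by (auto simp: grp_def)
    with assms that show False by (auto simp: ok_def lit_def)
  qed
qed

lemma pval_tscore:
  "pval S (tscore d x) = pval S (gpoly (Suc d) x (enc_nat (length C - 1))) +
    (\<Sum>l\<leftarrow>rl. pval S (tcon d x (enc_nat l)))"
  by (simp add: tscore_def tlast_enc_circuit elems_trels comp_def)

lemma pval_output:
  assumes "\<And>l. l \<in> set rl \<Longrightarrow> ok S l"
  shows "pval S (gpoly (Suc d) x (enc_nat (length C - 1))) = of_bool (last (node_vals (inp S) C))"
  unfolding last_node_vals[OF wf]
proof (rule pval_gpoly_enc[OF wf chk out_less])
  show "enc_nat l \<in> S \<longleftrightarrow> lit C (inp S) l"
    if "enc_nat l \<in> set (elems (trel (Suc d) x (enc_nat (length C - 1))))" for l
    using trel_out[OF that] ok_lit assms by auto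
qed (simp add: inp_def)

text \<open>Each group contributes exactly one element, so the size of \<open>S\<close> determines
  the weight of the input assignment.\<close>

lemma card_ok:
  assumes S: "S \<subseteq> set (elems (tuniv d x))" and ok: "\<And>l. l \<in> set rl \<Longrightarrow> ok S l"
  shows "card S = card (inp S) + length rl"
proof -
  have "S = enc_nat ` inp S \<union> (\<Union>l \<in> set rl. S \<inter> set (grp l))"
    using S by (auto simp: elems_tuniv set_ip inp_def)
  moreover have "card (enc_nat ` inp S \<union> (\<Union>l \<in> set rl. S \<inter> set (grp l))) =
      card (enc_nat ` inp S) + card (\<Union>l \<in> set rl. S \<inter> set (grp l))"
    by (rule card_Un_disjoint) (use rl_props(6) in \<open>auto simp: inp_def inputs_def enc_nat_in_grp\<close>)
  moreover have "card (\<Union>l \<in> set rl. S \<inter> set (grp l)) = (\<Sum>l\<in>set rl. card (S \<inter> set (grp l)))"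
    by (rule card_UN_disjoint) (use grp_disjoint in auto)
  moreover have "\<dots> = length rl"
    using ok by (simp add: ok_def distinct_card[OF distinct_rl])
  ultimately show ?thesis by (simp add: card_image[OF inj_enc_nat])
qed

text \<open>The score is a sum of \<open>1 + length rl\<close> terms, each at most 1, so reaching
  this number forces every term to be 1.\<close>

lemma satisfiable_if_score:
  assumes S: "S \<subseteq> set (elems (tuniv d x))" and "card S = k + length rl"
    and score: "1 + int (length rl) \<le> pval S (tscore d x)"
  shows "satisfiable_with_weight C k"
proof -
  have 1: "(\<Sum>l\<leftarrow>rl. pval S (tcon d x (enc_nat l))) \<le> int (length rl)"
    by (rule sum_list_le_length) (rule pval_tcon)
  have 2: "pval S (gpoly (Suc d) x (enc_nat (length C - 1))) \<le> 1"
    using pval_gpoly[of S "Suc d" x "enc_nat (length C - 1)"] by auto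
  have "int (length rl) \<le> (\<Sum>l\<leftarrow>rl. pval S (tcon d x (enc_nat l)))"
    using score 2 unfolding pval_tscore by linarith
  from sum_list_eq_length[OF pval_tcon(1) this] have ok: "ok S l" if "l \<in> set rl" for l
    using that pval_tcon(2) by blast
  have "pval S (gpoly (Suc d) x (enc_nat (length C - 1))) = 1"
    using score 1 2 unfolding pval_tscore by linarith
  then have "last (node_vals (inp S) C)" using pval_output[OF ok] by (auto split: if_splits)
  moreover have "card (inp S) = k" using card_ok[OF S ok] assms(2) by simp
  moreover have "inp S \<subseteq> inputs C" by (auto simp: inp_def)
  ultimately show ?thesis unfolding satisfiable_with_weight_def by blast
qed

lemma score_if_satisfiable:
  assumes "satisfiable_with_weight C k"
  shows "\<exists>S \<subseteq> set (elems (tuniv d x)). card S = k + length rl \<and> pval S (tscore d x) = 1 + int (length rl)"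
proof -
  obtain A where A: "A \<subseteq> inputs C" "card A = k" "last (node_vals A C)"
    using assms by (auto simp: satisfiable_with_weight_def)
  \<comment> \<open>The truthful choice for each gate: the gate variable if no child decides it,
    otherwise some deciding child as witness.\<close>
  define w where "w l = (if lit C A l then enc_nat l else tz (enc_nat l)
    (enc_nat (SOME j. j \<in> set (preds (C ! l)) \<and> node_vals A C ! j \<noteq> isconj (C ! l))))" for l
  define S where "S = enc_nat ` A \<union> w ` set rl"
  have w_lit: "w l = enc_nat l" if "lit C A l" for l using that by (simp add: w_def)
  have w_not: "\<exists>j. j \<in> set (preds (C ! l)) \<and> node_vals A C ! j \<noteq> isconj (C ! l) \<and>
      w l = tz (enc_nat l) (enc_nat j)" if "\<not> lit C A l" for l
  proof -
    let ?P = "\<lambda>j. j \<in> set (preds (C ! l)) \<and> node_vals A C ! j \<noteq> isconj (C ! l)"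
    have "\<exists>j. ?P j" using that by (auto simp: lit_def)
    then have "?P (Eps ?P)" by (rule someI_ex)
    then show ?thesis using that by (intro exI[of _ "Eps ?P"]) (simp add: w_def)
  qed
  have w_grp: "w l \<in> set (grp l)" for l
    using w_lit[of l] w_not[of l] by (cases "lit C A l") (auto simp: grp_def)
  have Sgrp: "S \<inter> set (grp l) = {w l}" if l: "l \<in> set rl" for l
  proof -
    have "w l' = w l" if "w l' \<in> set (grp l)" for l'
      using grp_eq[OF that w_grp[of l']] by simp
    moreover have "enc_nat a \<notin> set (grp l)" if "a \<in> A" for a
      using A(1) rl_props(6)[OF l] that by (auto simp: enc_nat_in_grp)
    ultimately show ?thesis using w_grp[of l] l unfolding S_def by blast
  qed
  have "w l \<noteq> enc_nat a" if "l \<in> set rl" "a \<in> inputs C" for l a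
    using w_lit[of l] w_not[of l] rl_props(6)[OF that(1)] that(2) by (cases "lit C A l") auto
  then have inpS: "inp S = A"
    using A(1) by (fastforce simp: inp_def S_def)
  have ok: "ok S l" if l: "l \<in> set rl" for l
  proof (cases "lit C A l")
    case True
    have "j \<notin> set (preds (C ! l))" if "tz (enc_nat l) (enc_nat j) \<in> S" for j
    proof
      assume "j \<in> set (preds (C ! l))"
      with that have "tz (enc_nat l) (enc_nat j) \<in> S \<inter> set (grp l)" by (auto simp: grp_def)
      then show False using Sgrp[OF l] w_lit[OF True] by simp
    qed
    then show ?thesis using Sgrp[OF l] True unfolding ok_def inpS by (auto simp: lit_def)
  next
    case False
    obtain j where j: "j \<in> set (preds (C ! l))" "node_vals A C ! j \<noteq> isconj (C ! l)"
      "w l = tz (enc_nat l) (enc_nat j)"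
      using w_not[OF False] by blast
    have "enc_nat l \<notin> S" using Sgrp[OF l] j(3) by (auto simp: grp_def)
    moreover have "i = j" if "i \<in> set (preds (C ! l))" "tz (enc_nat l) (enc_nat i) \<in> S" for i
    proof -
      have "tz (enc_nat l) (enc_nat i) \<in> S \<inter> set (grp l)" using that by (auto simp: grp_def)
      then show ?thesis using Sgrp[OF l] j(3) by simp
    qed
    ultimately show ?thesis using Sgrp[OF l] j(2) unfolding ok_def inpS by auto
  qed
  have SU: "S \<subseteq> set (elems (tuniv d x))"
    using A(1) w_grp by (auto simp: S_def elems_tuniv set_ip)
  have "(\<Sum>l\<leftarrow>rl. pval S (tcon d x (enc_nat l))) = (\<Sum>l\<leftarrow>rl. 1)"
    by (rule arg_cong[of _ _ sum_list], rule map_cong[OF refl]) (use pval_tcon(2) ok in blast)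
  also have "\<dots> = int (length rl)" by (simp add: sum_list_triv)
  finally have "pval S (tscore d x) = 1 + int (length rl)"
    using pval_output[OF ok] A(3) by (simp add: pval_tscore inpS)
  moreover have "card S = k + length rl" using card_ok[OF SU ok] A(2) inpS by simp
  ultimately show ?thesis using SU by blast
qed

lemma pvars_tscore: "pvars (tscore d x) \<subseteq> set (elems (tuniv d x))"
proof -
  have U: "set (elems (tuniv d x)) = enc_nat ` inputs C \<union> (\<Union>l \<in> set rl. set (grp l))"
    by (simp add: elems_tuniv set_ip)
  have "pvars (gpoly (Suc d) x (enc_nat (length C - 1))) \<subseteq> set (elems (tuniv d x))"
  proof -
    have "set (elems (trel (Suc d) x (enc_nat (length C - 1)))) \<subseteq> enc_nat ` set rl"
      using trel_out by blast
    then have "set (elems (trel (Suc d) x (enc_nat (length C - 1)))) \<subseteq> (\<Union>l \<in> set rl. set (grp l))"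
      by (force simp: grp_def)
    then show ?thesis using pvars_gpoly_enc[OF wf chk out_less] unfolding U by blast
  qed
  moreover have "pvars (tcon d x (enc_nat l)) \<subseteq> set (elems (tuniv d x))" if l: "l \<in> set rl" for l
  proof -
    have "pvars (tchild d x (enc_nat l) (enc_nat j)) \<subseteq> enc_nat ` inputs C"
      if "j \<in> set (preds (C ! l))" for j
      using pvars_gpoly_enc[OF wf rl_props(3,4)[OF l that]] trel_flat[OF wf rl_props(3,4)[OF l that]]
      by (simp add: tchild_def)
    then have child: "pvars (pneg (tapp (pmul (pvar (enc_nat l)) (pcompl (tchild d x (enc_nat l) (enc_nat j))))
      (pmul (pvar (tz (enc_nat l) (enc_nat j))) (tchild d x (enc_nat l) (enc_nat j))))) \<subseteq>
      enc_nat ` inputs C \<union> set (grp l)" if "j \<in> set (preds (C ! l))" for j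
      using that pvars_pmul[of "pvar (enc_nat l)" "pcompl (tchild d x (enc_nat l) (enc_nat j))"]
        pvars_pmul[of "pvar (tz (enc_nat l) (enc_nat j))" "tchild d x (enc_nat l) (enc_nat j)"]
      by (fastforce simp: grp_def)
    have "pvars (pgroup (tgroup x (enc_nat l))) \<subseteq> set (grp l)"
      using pvars_pgroup[of "tgroup x (enc_nat l)"] elems_tgroup[OF rl_props(1)[OF l]] by simp
    with child show ?thesis
      unfolding tcon_def U using l rl_props(1)[OF l] by (simp add: tpreds_node del: pvars_simps(4)) blast
  qed
  ultimately show ?thesis
    by (auto simp: tscore_def tlast_enc_circuit elems_trels)
qed

end

text \<open>The largest degree comes from one variable times the polynomial of a child. It depends
  on \<open>d\<close> only, which keeps the number of tuples polynomial.\<close>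

lemma pdeg_le_tscore: "pdeg_le (Suc (2 ^ Suc d)) (tscore d x)"
proof -
  have 2: "(2::nat) \<le> Suc (2 ^ Suc d)" by simp
  have poly: "pdeg_le (2 ^ Suc d) (gpoly (Suc d) x i)" for i by (rule pdeg_le_gpoly)
  then have "pdeg_le (2 ^ Suc d) (tchild d x i j)" for i j by (simp add: tchild_def del: gpoly.simps)
  then have "pdeg_le (Suc (2 ^ Suc d)) (tcon d x i)" for i
    using pdeg_le_pmul[of 1 "pvar u" "2 ^ Suc d" for u] pdeg_le_mono[OF pdeg_le_pgroup 2]
    by (simp add: tcon_def del: power_Suc)
  moreover have "pdeg_le (Suc (2 ^ Suc d)) (gpoly (Suc d) x i)" for i
    by (rule pdeg_le_mono[OF poly]) simp
  ultimately show ?thesis by (simp add: tscore_def del: power_Suc gpoly.simps)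
qed

section \<open>From polynomials to graphs\<close>

text \<open>The vertices of \<open>U\<close> and \<open>B\<close> are adjacent to \<open>s\<close>,
  so only nodes in \<open>N - B\<close> can avoid both \<open>X\<close> and its neighbourhood, and
  only if all their attachments are in the neighbourhood. \<open>T\<close> is the number of nodes to
  be cut off; bounding the side of \<open>s\<close> by \<open>k\<close> demands just that.\<close>

lemma cut_iff:
  fixes s :: 'a and U N B :: "'a set" and att :: "'a \<Rightarrow> 'a set"
  assumes fin: "finite U" "finite N" and disj: "s \<notin> U" "s \<notin> N" "U \<inter> N = {}"
    and att: "\<And>e. e \<in> N \<Longrightarrow> att e \<subseteq> U" and B: "B \<subseteq> N"
    and E: "E = (\<lambda>x. {s, x}) ` U \<union> (\<Union>e \<in> N. (\<lambda>y. {e, y}) ` att e) \<union> (\<lambda>e. {s, e}) ` B"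
    and V: "V = insert s (U \<union> N)" and t: "t \<le> card U" and k: "k = card V - t - T"
  shows "1 \<le> k \<and> has_terminal_cut V E s k t \<longleftrightarrow>
    (\<exists>S \<subseteq> U. card S = t \<and> T \<le> card {e \<in> N - B. att e \<subseteq> S})"
proof
  assume "1 \<le> k \<and> has_terminal_cut V E s k t"
  then obtain X where k1: "1 \<le> k" and X: "X \<subseteq> V" "s \<in> X" "card X \<le> k" "card (set_nbhd E X) \<le> t"
    by (auto simp: has_terminal_cut_def)
  let ?NX = "set_nbhd E X"
  have finV: "finite V" using fin by (simp add: V)
  have EV: "u \<in> V" if "{u, v} \<in> E" for u v
  proof -
    have "e \<subseteq> V" if "e \<in> E" for e using that att B by (auto simp: E V)
    then show ?thesis using that by blast
  qed
  have NX: "?NX \<subseteq> V - X" using EV by (auto simp: set_nbhd_def nbhd_def)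
  \<comment> \<open>The part of the graph cut off from \<open>X\<close>.\<close>
  define Out where "Out = V - X - ?NX"
  have edge: "u \<notin> Out \<or> v \<notin> X" if "{u, v} \<in> E" for u v
    using that by (auto simp: Out_def set_nbhd_def nbhd_def)
  have edge': "{v, u} = {u, v}" for u v :: 'a by auto
  have "u \<notin> Out" if "u \<in> U" for u
    using edge[of u s] X(2) that by (auto simp: E edge'[of s u])
  moreover have "u \<notin> Out" if "u \<in> B" for u
    using edge[of u s] X(2) that by (auto simp: E edge'[of s u])
  ultimately have Out: "Out \<subseteq> N - B" using X(2) by (auto simp: Out_def V)
  have "att e \<subseteq> ?NX \<inter> U" if "e \<in> Out" for e
  proof
    fix y assume y: "y \<in> att e"
    have "e \<in> N" using that Out by blast
    then have "{e, y} \<in> E" "y \<in> U" using y att by (auto simp: E)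
    then have "y \<notin> X" using edge that by blast
    moreover have "y \<in> X \<union> ?NX"
      using \<open>y \<in> U\<close> \<open>s \<in> X\<close> by (auto simp: set_nbhd_def nbhd_def E edge'[of s y])
    ultimately show "y \<in> ?NX \<inter> U" using \<open>y \<in> U\<close> by blast
  qed
  then have OutS: "Out \<subseteq> {e \<in> N - B. att e \<subseteq> S}" if "?NX \<inter> U \<subseteq> S" for S
    using Out that by blast
  have "card V = card X + card ?NX + card Out"
  proof -
    have "card (V - X) = card V - card X" "card Out = card (V - X) - card ?NX"
      using X(1) NX finV unfolding Out_def by (auto intro!: card_Diff_subset intro: finite_subset)
    moreover have "card X \<le> card V" "card ?NX \<le> card (V - X)"
      using X(1) NX finV by (auto intro!: card_mono)
    ultimately show ?thesis by linarith
  qed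
  \<comment> \<open>The assumption \<open>1 \<le> k\<close> guarantees that the subtraction defining
    \<open>k\<close> is not truncated.\<close>
  then have T: "T \<le> card Out" using X(3,4) k k1 by linarith
  have "card (?NX \<inter> U) \<le> t"
    using X(4) card_mono[of ?NX "?NX \<inter> U"] NX finV finite_subset by fastforce
  \<comment> \<open>The separator is padded to exactly \<open>t\<close> variables, which is possible
    as \<open>t \<le> card U\<close>; this only enlarges the set of separated nodes.\<close>
  then obtain S where S: "?NX \<inter> U \<subseteq> S" "S \<subseteq> U" "card S = t"
    using exists_subset_between[of "?NX \<inter> U" t U] t fin(1) by auto
  have "card Out \<le> card {e \<in> N - B. att e \<subseteq> S}"
    by (rule card_mono[OF _ OutS[OF S(1)]]) (use fin(2) in simp)
  with T S show "\<exists>S \<subseteq> U. card S = t \<and> T \<le> card {e \<in> N - B. att e \<subseteq> S}"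
    by (intro exI[of _ S]) linarith
next
  assume "\<exists>S \<subseteq> U. card S = t \<and> T \<le> card {e \<in> N - B. att e \<subseteq> S}"
  then obtain S where S: "S \<subseteq> U" "card S = t" "T \<le> card {e \<in> N - B. att e \<subseteq> S}" by blast
  define Out where "Out = {e \<in> N - B. att e \<subseteq> S}"
  \<comment> \<open>The terminal keeps everything except the separator and the nodes that it cuts
    off.\<close>
  define X where "X = V - (S \<union> Out)"
  have finV: "finite V" using fin by (simp add: V)
  have OutN: "Out \<subseteq> N" by (auto simp: Out_def)
  have "set_nbhd E X \<subseteq> S"
  proof
    fix u assume "u \<in> set_nbhd E X"
    then obtain v where v: "{u, v} \<in> E" "v \<in> X" "u \<notin> X" by (auto simp: set_nbhd_def nbhd_def)
    have "u \<in> V" using v(1) att B by (fastforce simp: E V doubleton_eq_iff)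
    show "u \<in> S"
    proof (rule ccontr)
      assume "u \<notin> S"
      then have u: "u \<in> Out" using v(3) \<open>u \<in> V\<close> by (auto simp: X_def)
      then have "u \<in> N" "u \<notin> B" "att u \<subseteq> S" by (auto simp: Out_def)
      moreover have "u \<noteq> s" "u \<notin> U" using \<open>u \<in> N\<close> disj by auto
      \<comment> \<open>Outside \<open>B\<close>, all edges at a node lead to its
        attachments.\<close>
      ultimately have "v \<in> att u"
        using v(1) by (auto simp: E doubleton_eq_iff dest: subsetD[OF att])
      with \<open>att u \<subseteq> S\<close> have "v \<in> S" by blast
      then show False using v(2) by (simp add: X_def)
    qed
  qed
  then have "card (set_nbhd E X) \<le> t"
    using S(2) card_mono[of S] finite_subset[OF S(1) fin(1)] by blast
  moreover have sX: "s \<in> X" using disj S(1) OutN by (auto simp: X_def V)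
  moreover have "card V = card X + t + card Out"
  proof -
    have "card (S \<union> Out) = t + card Out"
      using S(1,2) OutN disj(3) finite_subset[OF S(1) fin(1)] finite_subset[OF OutN fin(2)]
      by (subst card_Un_disjoint) auto
    moreover have "S \<union> Out \<subseteq> V" using S(1) OutN by (auto simp: V)
    moreover have "finite (S \<union> Out)" using calculation(2) finV finite_subset by blast
    ultimately show ?thesis
      unfolding X_def using finV card_Diff_subset[of "S \<union> Out" V] card_mono[of V "S \<union> Out"]
      by simp
  qed
  moreover have "1 \<le> card X" using sX finV by (auto simp: X_def Suc_le_eq card_gt_0_iff)
  moreover have "X \<subseteq> V" by (auto simp: X_def)
  ultimately show "1 \<le> k \<and> has_terminal_cut V E s k t"
    using S(3) unfolding has_terminal_cut_def Out_def[symmetric] k by (intro conjI exI[of _ X]) auto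
qed

text \<open>All lists over \<open>U\<close> as long as \<open>m\<close>; of \<open>m\<close> only
  the length matters. \<open>Node Leaf Leaf\<close> is the list containing just the empty tuple. The
  constant fuel \<open>Q\<close> bounds the degree, so that recursion on it gives a program of fixed
  size.\<close>

primrec tup :: "nat \<Rightarrow> tree \<Rightarrow> tree \<Rightarrow> tree" where
  "tup 0 U m = Node Leaf Leaf"
| "tup (Suc Q) U m = (if m = Leaf then Node Leaf Leaf
    else tconcat (tmap (\<lambda>y. tmap (\<lambda>u. Node y u) (tup Q U (right m))) U))"

lemma pt_tup: "pt f \<Longrightarrow> pt g \<Longrightarrow> pt (\<lambda>v. tup Q (f v) (g v))"
proof (induction Q arbitrary: f g)
  case (Suc Q)
  have *: "pt (\<lambda>w. f (left w))" "pt (\<lambda>w. g (left w))"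
    by (rule pt_comp[OF _ pt_left[OF pt_id]], rule Suc.prems)+
  show ?case unfolding tup.simps by (intro pt_intros Suc.IH Suc.prems *)
qed (simp add: pt_const)

lemma tup_props:
  assumes "num m \<le> Q"
  shows "set (elems (tup Q U m)) = {u. set (elems u) \<subseteq> set (elems U) \<and> num u = num m}"
    "num (tup Q U m) = num U ^ num m"
    "distinct (elems U) \<Longrightarrow> distinct (elems (tup Q U m))"
proof -
  have "set (elems (tup Q U m)) = {u. set (elems u) \<subseteq> set (elems U) \<and> num u = num m} \<and>
    num (tup Q U m) = num U ^ num m \<and> (distinct (elems U) \<longrightarrow> distinct (elems (tup Q U m)))"
    using assms
  proof (induction Q arbitrary: m)
    case 0
    then have "m = Leaf" by simp
    then show ?case by (auto simp del: elems_eq_Nil) (metis elems_eq_Nil)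
  next
    case (Suc Q)
    show ?case
    proof (cases m)
      case Leaf
      then show ?thesis by auto
    next
      case (Node a m')
      note IH = Suc.IH[of m']
      have set: "set (elems (tup Q U m')) = {u. set (elems u) \<subseteq> set (elems U) \<and> num u = num m'}"
        and num: "num (tup Q U m') = num U ^ num m'"
        and dist: "distinct (elems U) \<Longrightarrow> distinct (elems (tup Q U m'))"
        using IH Suc.prems Node by auto
      have "set (elems (tup (Suc Q) U m)) = {u. set (elems u) \<subseteq> set (elems U) \<and> num u = num m}"
      proof (intro set_eqI)
        fix u
        show "u \<in> set (elems (tup (Suc Q) U m)) \<longleftrightarrow> u \<in> {u. set (elems u) \<subseteq> set (elems U) \<and> num u = num m}"
          using set Node by (cases u) auto
      qed
      moreover have "num (tup (Suc Q) U m) = num U ^ num m"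
        using num Node by (simp add: length_concat comp_def sum_list_triv)
      moreover have "distinct (elems (tup (Suc Q) U m))" if "distinct (elems U)"
      proof -
        \<comment> \<open>Empty sublists for different first components would coincide, which the
          concatenation rule does not allow; they arise only when \<open>U\<close> itself is
          empty.\<close>
        have "tup Q U m' = Leaf \<Longrightarrow> elems U = []"
          using num by (cases "elems U") (auto simp: power_0_left split: if_splits)
        then have "distinct (concat (map (\<lambda>y. map (Node y) (elems (tup Q U m'))) (elems U)))"
          using that dist[OF that]
        proof (induction "elems U" rule: rev_induct)
          case Nil
          then show ?case by simp
        next
          case (snoc y ys)
          show ?case
            by (rule distinct_concat)
              (use snoc.prems in \<open>auto simp: distinct_map inj_on_def elems_eq_Nil[symmetric] map_eq_conv
                simp del: elems_eq_Nil dest!: arg_cong[of _ _ "\<lambda>xs. left (hd xs)"]\<close>)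
        qed
        then show ?thesis using Node by (simp add: comp_def)
      qed
      ultimately show ?thesis by blast
    qed
  qed
  then show "set (elems (tup Q U m)) = {u. set (elems u) \<subseteq> set (elems U) \<and> num u = num m}"
    "num (tup Q U m) = num U ^ num m"
    "distinct (elems U) \<Longrightarrow> distinct (elems (tup Q U m))" by auto
qed

lemma card_tup:
  assumes "num m \<le> Q" "S \<subseteq> set (elems U)"
  shows "card {u \<in> set (elems (tup Q U m)). set (elems u) \<subseteq> S} = card S ^ num m"
proof -
  have "{u \<in> set (elems (tup Q U m)). set (elems u) \<subseteq> S} = enc_list ` {xs. set xs \<subseteq> S \<and> length xs = num m}"
    using assms by (auto simp: tup_props(1) image_iff) (metis enc_list_elems)
  moreover have "inj_on enc_list A" for A by (metis elems_enc_list inj_onI)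
  moreover have "finite S" using assms(2) finite_subset by blast
  ultimately show ?thesis by (simp add: card_image card_lists_length_eq)
qed

text \<open>
  The vertices are the terminal \<open>Leaf\<close>, the variables \<open>Node Leaf y\<close>, and the nodes
  \<open>Node (Node Leaf p) u\<close>, where \<open>u\<close> is a list of variables and \<open>p\<close> the position of a monomial.
  A set of \<open>t\<close> variables separates \<open>t ^ n - 1\<close> or \<open>t ^ n\<close> of the nodes that belong to a negative monomial
  \<open>u\<close> of degree \<open>n\<close>, since the node for \<open>u\<close> itself is adjacent to the terminal.
\<close>

definition tcopies :: "nat \<Rightarrow> tree \<Rightarrow> tree \<Rightarrow> tree" where
  "tcopies Q U a = (if left a = Leaf then Node (right a) Leaf else tup Q U (right a))"

definition tnodes :: "nat \<Rightarrow> tree \<Rightarrow> tree \<Rightarrow> tree" where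
  "tnodes Q U M = tconcat (tmap (\<lambda>p. tmap (\<lambda>u. Node (Node Leaf p) u) (tcopies Q U (tnth M p))) (tidx M))"

definition tblocked :: "tree \<Rightarrow> tree" where
  "tblocked M = tmap (\<lambda>p. Node (Node Leaf p) (right (tnth M p))) (tfilter (\<lambda>p. left (tnth M p) \<noteq> Leaf) (tidx M))"

definition tedges :: "nat \<Rightarrow> tree \<Rightarrow> tree \<Rightarrow> tree" where
  "tedges Q U M = tapp (tmap (\<lambda>y. Node Leaf (Node Leaf y)) U)
    (tapp (tconcat (tmap (\<lambda>e. tmap (\<lambda>y. Node e (Node Leaf y)) (right e)) (tnodes Q U M)))
      (tmap (\<lambda>e. Node Leaf e) (tblocked M)))"

definition tverts :: "nat \<Rightarrow> tree \<Rightarrow> tree \<Rightarrow> tree" where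
  "tverts Q U M = Node Leaf (tapp (tmap (\<lambda>y. Node Leaf y) U) (tnodes Q U M))"

text \<open>Computes \<open>card V - t - (1 + r + P)\<close> by dropping elements, where
  \<open>P\<close> is the sum of \<open>t ^ n\<close> over the negative monomials. Any list of
  length \<open>t\<close> has \<open>t ^ n\<close> tuples, so \<open>tup\<close> on \<open>t\<close>
  does the powers. Taking \<open>right\<close> removes the terminal and accounts for the 1.\<close>

definition tbudget :: "nat \<Rightarrow> tree \<Rightarrow> tree \<Rightarrow> tree \<Rightarrow> tree \<Rightarrow> tree" where
  "tbudget Q U M t r = tdrop (tapp t (tapp r
      (tconcat (tmap (\<lambda>a. if left a = Leaf then Leaf else tup Q t (right a)) M))))
    (right (tverts Q U M))"

lemma pt_tnodes:
  assumes "pt f" "pt g" shows "pt (\<lambda>v. tnodes Q (f v) (g v))"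
  unfolding tnodes_def tcopies_def
  by (intro pt_intros pt_tup pt_comp[OF assms(1)] pt_comp[OF assms(2)])

lemma pt_tedges:
  assumes "pt f" "pt g" shows "pt (\<lambda>v. tedges Q (f v) (g v))"
  unfolding tedges_def tblocked_def
  by (intro pt_intros pt_tnodes pt_comp[OF assms(1)] pt_comp[OF assms(2)])

lemma pt_tverts:
  assumes "pt f" "pt g" shows "pt (\<lambda>v. tverts Q (f v) (g v))"
  unfolding tverts_def by (intro pt_intros pt_tnodes assms)

lemma pt_tbudget:
  assumes "pt f" "pt g" "pt h" "pt r" shows "pt (\<lambda>v. tbudget Q (f v) (g v) (h v) (r v))"
  unfolding tbudget_def by (intro pt_intros pt_tup pt_tverts assms pt_comp[OF assms(3)])

lemma int_sum_list: "int (\<Sum>a\<leftarrow>xs. f a) = (\<Sum>a\<leftarrow>xs. int (f a))"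
  by (induction xs) auto

definition vlist :: "nat \<Rightarrow> tree \<Rightarrow> tree \<Rightarrow> tree list" where
  "vlist Q U M = elems (tverts Q U M)"

definition elist :: "nat \<Rightarrow> tree \<Rightarrow> tree \<Rightarrow> (tree \<times> tree) list" where
  "elist Q U M = map (\<lambda>e. (left e, right e)) (elems (tedges Q U M))"

lemma enc_graph_lists: "enc_graph (vlist Q U M) (elist Q U M) = Node (tverts Q U M) (tedges Q U M)"
proof -
  have "map (\<lambda>e. Node (left e) (right e)) (elems (tedges Q U M)) = elems (tedges Q U M)"
    by (rule map_idI) (auto simp: tedges_def)
  then show ?thesis by (simp add: enc_graph_def vlist_def elist_def comp_def)
qed

section \<open>The graph of a polynomial and its separated vertices\<close>

locale poly_graph =
  fixes Q :: nat and U M :: tree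
  assumes distinct_U: "distinct (elems U)" and vars: "pvars M \<subseteq> set (elems U)" and deg: "pdeg_le Q M"
begin

abbreviation "vars_of S \<equiv> (\<lambda>y. Node Leaf y) ` S"

lemma mono_vars: "a \<in> set (elems M) \<Longrightarrow> set (elems (right a)) \<subseteq> set (elems U)"
  using vars by (auto simp: pvars_def)

lemma mono_deg: "a \<in> set (elems M) \<Longrightarrow> num (right a) \<le> Q"
  using deg by (simp add: pdeg_le_def)

lemma tcopies_props:
  assumes "a \<in> set (elems M)"
  shows "distinct (elems (tcopies Q U a))" "right a \<in> set (elems (tcopies Q U a))"
    "u \<in> set (elems (tcopies Q U a)) \<Longrightarrow> set (elems u) \<subseteq> set (elems U)"
  using tup_props[OF mono_deg[OF assms], of U] mono_vars[OF assms] distinct_U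
  by (auto simp: tcopies_def split: if_splits)

lemma elems_tnodes:
  "elems (tnodes Q U M) = concat (map (\<lambda>p. map (\<lambda>u. Node (Node Leaf (enc_nat p)) u)
    (elems (tcopies Q U (elems M ! p)))) [0..<num M])"
  by (simp add: tnodes_def comp_def, intro arg_cong[of _ _ concat] map_cong refl) auto

lemma set_tnodes:
  "set (elems (tnodes Q U M)) = (\<Union>p < num M. (\<lambda>u. Node (Node Leaf (enc_nat p)) u) ` set (elems (tcopies Q U (elems M ! p))))"
  by (auto simp: elems_tnodes)

lemma set_tblocked:
  "set (elems (tblocked M)) = {Node (Node Leaf (enc_nat p)) (right (elems M ! p)) | p. p < num M \<and> left (elems M ! p) \<noteq> Leaf}"
  by (auto simp: tblocked_def image_iff)

lemma blocked_nodes: "set (elems (tblocked M)) \<subseteq> set (elems (tnodes Q U M))"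
  using tcopies_props(2) by (fastforce simp: set_tblocked set_tnodes)

lemma node_att: "e \<in> set (elems (tnodes Q U M)) \<Longrightarrow> set (elems (right e)) \<subseteq> set (elems U)"
proof -
  assume "e \<in> set (elems (tnodes Q U M))"
  then obtain p u where p: "p < num M" "u \<in> set (elems (tcopies Q U (elems M ! p)))"
    and e: "e = Node (Node Leaf (enc_nat p)) u"
    by (auto simp: set_tnodes)
  show ?thesis using tcopies_props(3)[OF nth_mem[OF p(1)] p(2)] by (simp add: e)
qed

lemma distinct_tnodes: "distinct (elems (tnodes Q U M))"
proof -
  have *: "distinct (concat (map (\<lambda>p. map (\<lambda>u. Node (Node Leaf (enc_nat p)) u) (f p)) ps))"
    if "distinct ps" "\<And>p. p \<in> set ps \<Longrightarrow> distinct (f p)" for ps f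
    using that by (induction ps) (auto simp: distinct_map inj_on_def)
  show ?thesis
    unfolding elems_tnodes by (rule *) (simp_all add: tcopies_props(1))
qed

lemma node_shape: "e \<in> set (elems (tnodes Q U M)) \<Longrightarrow> \<exists>p u. e = Node (Node Leaf p) u"
  by (auto simp: set_tnodes)

lemma set_vlist: "set (vlist Q U M) = insert Leaf (vars_of (set (elems U)) \<union> set (elems (tnodes Q U M)))"
  by (simp add: vlist_def tverts_def)

lemma distinct_vlist: "distinct (vlist Q U M)"
proof -
  have "Leaf \<notin> set (elems (tnodes Q U M))" "vars_of (set (elems U)) \<inter> set (elems (tnodes Q U M)) = {}"
    using node_shape by fastforce+
  then show ?thesis
    using distinct_U distinct_tnodes by (auto simp: vlist_def tverts_def distinct_map inj_on_def)
qed

lemma edge_set_elist: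
  "edge_set (elist Q U M) = (\<lambda>x. {Leaf, x}) ` vars_of (set (elems U)) \<union>
    (\<Union>e \<in> set (elems (tnodes Q U M)). (\<lambda>y. {e, y}) ` vars_of (set (elems (right e)))) \<union>
    (\<lambda>e. {Leaf, e}) ` set (elems (tblocked M))"
  by (simp add: edge_set_def elist_def tedges_def image_Un image_image image_UN Un_assoc)

lemma simple: "simple_graph (set (vlist Q U M)) (edge_set (elist Q U M))"
proof -
  have "e \<subseteq> set (vlist Q U M) \<and> card e = 2" if "e \<in> edge_set (elist Q U M)" for e
  proof -
    from that consider (var) y where "y \<in> set (elems U)" "e = {Leaf, Node Leaf y}"
      | (node) v y where "v \<in> set (elems (tnodes Q U M))" "y \<in> set (elems (right v))" "e = {v, Node Leaf y}"
      | (blocked) v where "v \<in> set (elems (tblocked M))" "e = {Leaf, v}"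
      unfolding edge_set_elist by blast
    then show ?thesis
    proof cases
      case var
      then show ?thesis by (simp add: set_vlist)
    next
      case node
      then show ?thesis using node_shape[OF node(1)] node_att[OF node(1)] by (auto simp: set_vlist)
    next
      case blocked
      then have "v \<in> set (elems (tnodes Q U M))" using blocked_nodes by blast
      with blocked show ?thesis using node_shape[of v] by (auto simp: set_vlist)
    qed
  qed
  then show ?thesis by (simp add: simple_graph_def)
qed

text \<open>A positive monomial has a single vertex, separated iff the monomial is 1. For a negative
  one all tuples over \<open>S\<close> are separated except the blocked tuple, which lies over
  \<open>S\<close> iff the monomial is nonzero.\<close>

lemma separated_copies:
  assumes a: "a \<in> set (elems M)" and S: "S \<subseteq> set (elems U)"
  shows "int (card {u \<in> set (elems (tcopies Q U a)). (left a \<noteq> Leaf \<longrightarrow> u \<noteq> right a) \<and> set (elems u) \<subseteq> S}) =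
    (if left a = Leaf then 0 else int (card S ^ num (right a))) + mval S a"
proof (cases "left a = Leaf")
  case True
  then have "{u \<in> set (elems (tcopies Q U a)). (left a \<noteq> Leaf \<longrightarrow> u \<noteq> right a) \<and> set (elems u) \<subseteq> S} =
    (if set (elems (right a)) \<subseteq> S then {right a} else {})"
    by (auto simp: tcopies_def)
  with True show ?thesis by (simp add: mval_def)
next
  case False
  let ?A = "{u \<in> set (elems (tup Q U (right a))). set (elems u) \<subseteq> S}"
  have "{u \<in> set (elems (tcopies Q U a)). (left a \<noteq> Leaf \<longrightarrow> u \<noteq> right a) \<and> set (elems u) \<subseteq> S} = ?A - {right a}"
    using False by (auto simp: tcopies_def)
  moreover have "right a \<in> ?A \<longleftrightarrow> set (elems (right a)) \<subseteq> S"
    using tcopies_props(2)[OF a] False by (auto simp: tcopies_def)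
  moreover have "card ?A = card S ^ num (right a)" by (rule card_tup[OF mono_deg[OF a] S])
  moreover have "int (card (?A - {right a})) = int (card ?A) - of_bool (right a \<in> ?A)"
  proof (cases "right a \<in> ?A")
    case True
    moreover have "finite ?A" by simp
    ultimately have "0 < card ?A" "card (?A - {right a}) = card ?A - 1" by (auto simp: card_gt_0_iff)
    with True show ?thesis by (simp only: of_bool_eq)
  qed simp
  ultimately show ?thesis using False by (simp add: mval_def)
qed

lemma card_separated:
  assumes S: "S \<subseteq> set (elems U)"
  shows "int (card {e \<in> set (elems (tnodes Q U M)) - set (elems (tblocked M)).
      vars_of (set (elems (right e))) \<subseteq> vars_of S}) =
    (\<Sum>a\<leftarrow>elems M. if left a = Leaf then 0 else int (card S ^ num (right a))) + pval S M"
proof -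
  define A where "A a = {u \<in> set (elems (tcopies Q U a)). (left a \<noteq> Leaf \<longrightarrow> u \<noteq> right a) \<and> set (elems u) \<subseteq> S}" for a
  let ?nd = "\<lambda>p u. Node (Node Leaf (enc_nat p)) u"
  have "{e \<in> set (elems (tnodes Q U M)) - set (elems (tblocked M)). vars_of (set (elems (right e))) \<subseteq> vars_of S} =
    (\<Union>p < num M. ?nd p ` A (elems M ! p))"
  proof -
    have sub: "vars_of X \<subseteq> vars_of S \<longleftrightarrow> X \<subseteq> S" for X
      by (rule inj_image_subset_iff) (simp add: inj_def)
    show ?thesis by (auto simp: set_tnodes set_tblocked A_def sub image_iff)
  qed
  also have "card \<dots> = (\<Sum>p<num M. card (?nd p ` A (elems M ! p)))"
    by (rule card_UN_disjoint) (auto simp: A_def)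
  also have "\<dots> = (\<Sum>p<num M. card (A (elems M ! p)))"
    by (intro sum.cong refl card_image) (simp add: inj_on_def)
  also have "\<dots> = (\<Sum>a\<leftarrow>elems M. card (A a))"
    by (simp add: sum_list_sum_nth atLeast0LessThan)
  also have "int \<dots> = (\<Sum>a\<leftarrow>elems M. int (card (A a)))"
    by (rule int_sum_list)
  also have "\<dots> = (\<Sum>a\<leftarrow>elems M. (if left a = Leaf then 0 else int (card S ^ num (right a))) + mval S a)"
    by (rule arg_cong[of _ _ sum_list], rule map_cong[OF refl]) (simp add: A_def separated_copies[OF _ S])
  also have "\<dots> = (\<Sum>a\<leftarrow>elems M. if left a = Leaf then 0 else int (card S ^ num (right a))) + pval S M"
    unfolding pval_def by (rule sum_list_addf)
  finally show ?thesis .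
qed

lemma terminal_cut_iff:
  assumes t: "num t \<le> num U"
  shows "1 \<le> num (tbudget Q U M t r) \<and>
      has_terminal_cut (set (vlist Q U M)) (edge_set (elist Q U M)) Leaf (num (tbudget Q U M t r)) (num t) \<longleftrightarrow>
    (\<exists>S \<subseteq> set (elems U). card S = num t \<and> 1 + int (num r) \<le> pval S M)"
proof -
  \<comment> \<open>The offset caused by the negative monomials; it is the same for all sets of
    \<open>num t\<close> variables.\<close>
  define P where "P = (\<Sum>a\<leftarrow>elems M. if left a = Leaf then 0 else num t ^ num (right a))"
  have intP: "int P = (\<Sum>a\<leftarrow>elems M. if left a = Leaf then 0 else int (num t ^ num (right a)))"
    unfolding P_def int_sum_list by (simp add: if_distrib cong: if_cong)
  have cardV: "card (set (vlist Q U M)) = 1 + (num U + num (tnodes Q U M))"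
    by (simp add: distinct_card[OF distinct_vlist]) (simp add: vlist_def tverts_def)
  have "num (tconcat (tmap (\<lambda>a. if left a = Leaf then Leaf else tup Q t (right a)) M)) = P"
  proof -
    have "(\<Sum>a\<leftarrow>elems M. num (if left a = Leaf then Leaf else tup Q t (right a))) = P"
      unfolding P_def
      by (rule arg_cong[of _ _ sum_list], rule map_cong[OF refl]) (simp add: tup_props(2)[OF mono_deg])
    then show ?thesis by (simp add: length_concat comp_def)
  qed
  then have k: "num (tbudget Q U M t r) = card (set (vlist Q U M)) - num t - (1 + num r + P)"
    unfolding cardV by (simp add: tbudget_def tverts_def)
  have cU: "card (vars_of (set (elems U))) = num U"
    using distinct_card[OF distinct_U] by (subst card_image) (auto simp: inj_on_def)
  have "(1 \<le> num (tbudget Q U M t r) \<and>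
      has_terminal_cut (set (vlist Q U M)) (edge_set (elist Q U M)) Leaf (num (tbudget Q U M t r)) (num t)) \<longleftrightarrow>
    (\<exists>S \<subseteq> vars_of (set (elems U)). card S = num t \<and> 1 + num r + P \<le>
      card {e \<in> set (elems (tnodes Q U M)) - set (elems (tblocked M)). vars_of (set (elems (right e))) \<subseteq> S})"
  proof (rule cut_iff[OF _ _ _ _ _ _ _ edge_set_elist set_vlist _ k])
    show "Leaf \<notin> set (elems (tnodes Q U M))" using node_shape by blast
    show "vars_of (set (elems U)) \<inter> set (elems (tnodes Q U M)) = {}" using node_shape by fastforce
    show "vars_of (set (elems (right e))) \<subseteq> vars_of (set (elems U))" if "e \<in> set (elems (tnodes Q U M))" for e
      using node_att[OF that] by blast
  qed (use t cU blocked_nodes in auto)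
  also have "\<dots> \<longleftrightarrow> (\<exists>S \<subseteq> set (elems U). card (vars_of S) = num t \<and> 1 + num r + P \<le>
      card {e \<in> set (elems (tnodes Q U M)) - set (elems (tblocked M)). vars_of (set (elems (right e))) \<subseteq> vars_of S})"
  proof -
    have "(\<exists>S \<subseteq> f ` A. R S) \<longleftrightarrow> (\<exists>S \<subseteq> A. R (f ` S))" for f :: "tree \<Rightarrow> tree" and A R
      unfolding subset_image_iff by blast
    then show ?thesis .
  qed
  also have "\<dots> \<longleftrightarrow> (\<exists>S \<subseteq> set (elems U). card S = num t \<and> 1 + int (num r) \<le> pval S M)"
  proof (rule ex_cong1)
    fix S
    let ?sep = "{e \<in> set (elems (tnodes Q U M)) - set (elems (tblocked M)). vars_of (set (elems (right e))) \<subseteq> vars_of S}"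
    have card: "card (vars_of S) = card S" by (rule card_image) (simp add: inj_on_def)
    show "S \<subseteq> set (elems U) \<and> card (vars_of S) = num t \<and> 1 + num r + P \<le> card ?sep \<longleftrightarrow>
      S \<subseteq> set (elems U) \<and> card S = num t \<and> 1 + int (num r) \<le> pval S M"
    proof (cases "S \<subseteq> set (elems U) \<and> card S = num t")
      case True
      then have "int (card ?sep) = int P + pval S M"
        using card_separated[of S] unfolding intP by (elim conjE) (simp only:)
      then have "1 + num r + P \<le> card ?sep \<longleftrightarrow> 1 + int (num r) \<le> pval S M" by linarith
      then show ?thesis unfolding card by blast
    qed (unfold card, blast)
  qed
  finally show ?thesis .
qed

end

section \<open>The reduction\<close>

definition tparam :: "nat \<Rightarrow> tree \<Rightarrow> tree \<Rightarrow> tree" where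
  "tparam d x k = tapp k (tmap (\<lambda>_. Leaf) (trels d x))"

abbreviation maxdeg :: "nat \<Rightarrow> nat" where
  "maxdeg d \<equiv> Suc (2 ^ Suc d)"

text \<open>The second test is necessary for weight \<open>k\<close> and ensures that there are at
  least as many variables as are to be chosen. If a test fails, the output is \<open>Leaf\<close>
  with parameter 0, a no-instance because every instance is encoded by a
  \<open>Node\<close>.\<close>

definition red :: "nat \<Rightarrow> tree \<Rightarrow> tree" where
  "red d w = (if tvalid d (left w) \<and> num (right w) \<le> num (tinputs (left w))
    then Node
      (Node (Node (tverts (maxdeg d) (tuniv d (left w)) (tscore d (left w)))
          (tedges (maxdeg d) (tuniv d (left w)) (tscore d (left w))))
        (Node Leaf (tbin (tbudget (maxdeg d) (tuniv d (left w)) (tscore d (left w))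
          (tparam d (left w) (right w)) (trels d (left w))))))
      (tparam d (left w) (right w))
    else Node Leaf Leaf)"

lemma pt_red: "pt (red d)"
proof -
  have w: "pt (\<lambda>w. left w)" "pt (\<lambda>w. right w)" by (intro pt_left pt_right pt_id)+
  have "pt (\<lambda>w. tparam d (left w) (right w))"
    unfolding tparam_def by (intro pt_tapp pt_tmap pt_trels pt_Leaf w)
  then show ?thesis
    unfolding red_def[abs_def]
    by (intro pt_If pt_Node pt_Leaf pt_tbin pt_tbudget pt_tverts pt_tedges pt_tuniv pt_tscore pt_trels
        ptp_conj ptp_tvalid ptp_num_le pt_tinputs w)
qed

section \<open>Correctness of the reduction\<close>

lemma enc_gate_inject [simp]: "enc_gate g = enc_gate h \<longleftrightarrow> g = h"
proof
  assume eq: "enc_gate g = enc_gate h"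
  have "map enc_nat (preds g) = map enc_nat (preds h)"
    using arg_cong[OF eq, of "\<lambda>g. elems (tpreds g)"] by simp
  then have "preds g = preds h" by (rule map_injective) (simp add: inj_on_def)
  with arg_cong[OF eq, of left] show "g = h"
    by (cases g; cases h) (simp_all add: enc_gate.simps del: enc_nat.simps)
qed simp

lemma enc_circuit_inject: "enc_circuit C = enc_circuit D \<longleftrightarrow> C = D"
proof
  assume "enc_circuit C = enc_circuit D"
  then have "map enc_gate C = map enc_gate D" by (metis elems_enc_circuit)
  then show "C = D" by (rule map_injective) (simp add: inj_on_def)
qed simp

lemma enc_bin_inject: "enc_bin m = enc_bin n \<longleftrightarrow> m = n"
proof
  show "enc_bin m = enc_bin n \<Longrightarrow> m = n"
  proof (induction m arbitrary: n rule: less_induct)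
    case (less m)
    show ?case
    proof (cases "m = 0 \<or> n = 0")
      case True
      with less.prems show ?thesis
        by (subst (asm) (1 2) enc_bin.simps) (auto split: if_splits)
    next
      case False
      have eq: "Node (if odd m then Node Leaf Leaf else Leaf) (enc_bin (m div 2)) =
        Node (if odd n then Node Leaf Leaf else Leaf) (enc_bin (n div 2))"
        using less.prems enc_bin.simps[of m] enc_bin.simps[of n] False by simp
      then have "m div 2 = n div 2" using False by (intro less.IH) auto
      moreover have "odd m \<longleftrightarrow> odd n" using eq by (auto split: if_splits)
      ultimately show ?thesis by (metis bit_eq_rec)
    qed
  qed
qed simp

lemma enc_graph_inject: "enc_graph vs es = enc_graph vs' es' \<longleftrightarrow> vs = vs' \<and> es = es'"
proof
  assume eq: "enc_graph vs es = enc_graph vs' es'"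
  have "vs = vs'" using arg_cong[OF eq, of "\<lambda>t. elems (left t)"] by (simp add: enc_graph_def)
  moreover have "map (\<lambda>(u, v). Node u v) es = map (\<lambda>(u, v). Node u v) es'"
    using arg_cong[OF eq, of "\<lambda>t. elems (right t)"] by (simp add: enc_graph_def)
  then have "es = es'" by (rule map_injective) (auto simp: inj_on_def)
  ultimately show "vs = vs' \<and> es = es'" by simp
qed simp

text \<open>Membership asserts that some graph with this encoding is a yes-instance; injectivity of
  the encodings identifies it with the given one.\<close>

lemma instance_iff:
  "(Node (enc_graph vs es) (Node s (enc_bin k)), t) \<in> cutting_at_most_k_with_terminal \<longleftrightarrow>
    simple_graph (set vs) (edge_set es) \<and> s \<in> set vs \<and> 1 \<le> k \<and> has_terminal_cut (set vs) (edge_set es) s k t"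
  by (auto simp: cutting_at_most_k_with_terminal_def enc_graph_inject enc_bin_inject)

lemma red_correct:
  assumes "red d (Node x (enc_nat k)) = Node y (enc_nat t)"
  shows "(x, k) \<in> weighted_circuit_sat 1 d \<longleftrightarrow> (y, t) \<in> cutting_at_most_k_with_terminal"
proof (cases "tvalid d x \<and> k \<le> num (tinputs x)")
  case True
  then obtain C where x: "x = enc_circuit C" using tvalidD by blast
  with True have C: "wf_circuit C" "weft_at_most C 1" "depth_at_most C d"
    using tvalid_enc_circuit by auto
  interpret weft_one C d
    by standard (use C chk_output[OF C(1)] in auto)
  interpret poly_graph "maxdeg d" "tuniv d (enc_circuit C)" "tscore d (enc_circuit C)"
    by standard (rule distinct_tuniv pvars_tscore pdeg_le_tscore)+
  let ?p = "tparam d (enc_circuit C) (enc_nat k)"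
  have p: "num ?p = k + length rl" by (simp add: tparam_def elems_trels)
  have "elems ?p = replicate (k + length rl) Leaf"
    by (simp add: tparam_def elems_trels replicate_add map_replicate_const comp_def)
  then have "?p = enc_nat (k + length rl)" by (rule enc_nat_eqI)
  with assms True have t: "t = k + length rl" and y: "y = Node (enc_graph
      (vlist (maxdeg d) (tuniv d (enc_circuit C)) (tscore d (enc_circuit C)))
      (elist (maxdeg d) (tuniv d (enc_circuit C)) (tscore d (enc_circuit C))))
    (Node Leaf (enc_bin (num (tbudget (maxdeg d) (tuniv d (enc_circuit C)) (tscore d (enc_circuit C)) ?p
      (trels d (enc_circuit C))))))"
    by (auto simp: red_def x enc_graph_lists tbin_def)
  \<comment> \<open>There are at least \<open>k\<close> inputs, and every group contains at least
    the variable of its gate.\<close>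
  have "k + length rl \<le> num (tuniv d (enc_circuit C))"
  proof -
    have "k \<le> length ip" using True by (simp add: x elems_tinputs)
    moreover have "length ls \<le> (\<Sum>l\<leftarrow>ls. length (grp l))" for ls
      by (induction ls) (simp_all add: grp_def)
    from this[of rl] have "length rl \<le> length (concat (map grp rl))" by (simp add: length_concat comp_def)
    ultimately show ?thesis by (simp add: elems_tuniv)
  qed
  then have "num ?p \<le> num (tuniv d (enc_circuit C))" by (simp only: p)
  note cut = terminal_cut_iff[OF this, of "trels d (enc_circuit C)"]
  have "num (trels d (enc_circuit C)) = length rl" by (simp add: elems_trels)
  note cut = cut[unfolded this p]
  have "(y, t) \<in> cutting_at_most_k_with_terminal \<longleftrightarrow>
    (\<exists>S \<subseteq> set (elems (tuniv d (enc_circuit C))). card S = k + length rl \<and>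
      1 + int (length rl) \<le> pval S (tscore d (enc_circuit C)))"
    unfolding y t instance_iff cut[symmetric] using simple by (simp only: set_vlist insertI1 simp_thms)
  also have "\<dots> \<longleftrightarrow> satisfiable_with_weight C k"
  proof
    show "satisfiable_with_weight C k \<Longrightarrow> \<exists>S \<subseteq> set (elems (tuniv d (enc_circuit C))).
        card S = k + length rl \<and> 1 + int (length rl) \<le> pval S (tscore d (enc_circuit C))"
      using score_if_satisfiable[of k] by auto
  qed (use satisfiable_if_score in blast)
  also have "\<dots> \<longleftrightarrow> (x, k) \<in> weighted_circuit_sat 1 d"
    using C by (auto simp: weighted_circuit_sat_def x enc_circuit_inject)
  finally show ?thesis by simp
next
  case False
  then have "y = Leaf" using assms by (auto simp: red_def split: if_splits)
  then have "(y, t) \<notin> cutting_at_most_k_with_terminal"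
    by (simp add: cutting_at_most_k_with_terminal_def)
  moreover have "(x, k) \<notin> weighted_circuit_sat 1 d"
  proof
    assume "(x, k) \<in> weighted_circuit_sat 1 d"
    then obtain C where C: "x = enc_circuit C" "wf_circuit C" "weft_at_most C 1" "depth_at_most C d"
      "satisfiable_with_weight C k"
      by (auto simp: weighted_circuit_sat_def)
    interpret weft_one C d
      by standard (use C chk_output[OF C(2)] in auto)
    obtain A where "A \<subseteq> inputs C" "card A = k" using C(5) by (auto simp: satisfiable_with_weight_def)
    then have "k \<le> card (set ip)" using card_mono[OF finite_set, of A ip] by (simp add: set_ip)
    then have "k \<le> num (tinputs x)" by (simp add: C(1) elems_tinputs distinct_card[OF distinct_ip])
    with False C tvalid_enc_circuit show False by auto
  qed
  ultimately show ?thesis by blast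
qed

lemma red_param: "\<exists>y t. red d (Node x (enc_nat k)) = Node y (enc_nat t) \<and> t \<le> k + 2 ^ Suc d"
proof (cases "tvalid d x \<and> k \<le> num (tinputs x)")
  case True
  then obtain C where x: "x = enc_circuit C" using tvalidD by blast
  with True have C: "wf_circuit C" "weft_at_most C 1" "depth_at_most C d"
    using tvalid_enc_circuit by auto
  interpret weft_one C d
    by standard (use C chk_output[OF C(1)] in auto)
  have "elems (tparam d x (enc_nat k)) = replicate (k + length rl) Leaf"
    by (simp add: x tparam_def elems_trels replicate_add map_replicate_const comp_def)
  then have "tparam d x (enc_nat k) = enc_nat (k + length rl)" by (rule enc_nat_eqI)
  then show ?thesis using True length_rl by (auto simp: red_def)
next
  case False
  then show ?thesis by (intro exI[of _ Leaf] exI[of _ 0]) (auto simp: red_def)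
qed

theorem theorem5: "W_hard 1 cutting_at_most_k_with_terminal"
  unfolding W_hard_def
proof
  fix L assume "L \<in> W 1"
  then obtain d where L: "L \<le>fpt weighted_circuit_sat 1 d" by (auto simp: W_def)
  define R where "R x k = left (red d (Node x (enc_nat k)))" for x k
  define K where "K x k = num (right (red d (Node x (enc_nat k))))" for x k
  have RK: "red d (Node x (enc_nat k)) = Node (R x k) (enc_nat (K x k))" "K x k \<le> k + 2 ^ Suc d" for x k
    using red_param[of d x k] by (auto simp: R_def K_def)
  show "L \<le>fpt cutting_at_most_k_with_terminal"
  proof (rule fpt_reducible_pt_trans[OF L pt_red[of d]])
    show "red d (Node x (enc_nat k)) = Node (R x k) (enc_nat (K x k))" for x k by (rule RK)
    show "(x, k) \<in> weighted_circuit_sat 1 d \<longleftrightarrow> (R x k, K x k) \<in> cutting_at_most_k_with_terminal" for x k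
      by (rule red_correct[OF RK(1)])
    show "K x k \<le> k + 2 ^ Suc d" for x k by (rule RK)
  qed
qed

end
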